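(* Let $\widetilde D\subset U$ and $D\subset\mathbb R^N$ be any dense and countable subsets, and let $\Theta=(\Theta_1,\Theta_2)$ be any suitable set of moduli of continuity. The following assertions hold for a set $E\subset\mathfrak{LC}$: (i) If $E$ has $L^1_{loc}$-bounded $l$-bounds, then for any $\mathcal T_1,\mathcal T_2\in\{\mathcal T_D,\mathcal T_\Theta,\mathcal T_B\}$, $(E,\mathcal T_1)=(E,\mathcal T_2)$ and $\mathrm{cls}_{(\mathfrak{LC},\mathcal T_1)}(E)=\mathrm{cls}_{(\mathfrak{LC},\mathcal T_2)}(E)$. (ii) If $E$ has $L^1_{loc}$-equicontinuous $m$-bounds and $L^1_{loc}$-bounded $l$-bounds, then $(E,\sigma_D)=(E,\sigma_\Theta)$ and $\mathrm{cls}_{(\mathfrak{LC},\sigma_D)}(E)=\mathrm{cls}_{(\mathfrak{LC},\sigma_\Theta)}(E)$. (iii) If $E$ has $L^1_{loc}$-bounded $l$-bounds with respect to a modulus of continuity $\widehat\theta$ in the variable $x$, then $(E,\sigma_{\widetilde DD})=(E,\sigma_D)$ and $\mathrm{cls}_{(\mathfrak{LC},\sigma_{\widetilde DD})}(E)=\mathrm{cls}_{(\mathfrak{LC},\sigma_D)}(E)$; and, for any $\mathcal T\in\{\mathcal T_D,\mathcal T_\Theta,\mathcal T_B\}$, $(E,\mathcal T_{\widetilde DD})=(E,\mathcal T)$ and $\mathrm{cls}_{(\mathfrak{LC},\mathcal T_{\widetilde DD})}(E)=\mathrm{cls}_{(\mathfrak{LC},\mathcal T)}(E)$.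
   Context: Setting. $M,N\ge1$; $U\subset\mathbb R^M$ is a bounded, open, connected set with sufficiently smooth boundary; $|y|=|y_1|+\dots+|y_N|$ on $\mathbb R^N$; $B_j\subset\mathbb R^N$ is the closed ball of radius $j$ centered at $0$; $\mathcal B_j=C(\overline U,B_j)$; $\|z\|=\sup_{x\in\overline U}|z(x)|$ for $z\in C(\overline U,\mathbb R^N)$; $L^1_{loc}$ is the space of locally integrable functions $\mathbb R\to\mathbb R$; $\mathbb R^+=[0,\infty)$; $\mathbb N=\{1,2,\dots\}$. $I=[q_1,q_2]$ always has rational endpoints $q_1<q_2$. Carathéodory maps. $f:\mathbb R\times\overline U\times\mathbb R^N\to\mathbb R^N$ is in $\mathfrak{SC}$ if it is Borel measurable; for every compact $K\subset\mathbb R^N$ there is a nonnegative $m^K\in L^1_{loc}$ (an $m$-bound of $f$ on $K$) with, for a.e. $t$, $|f(t,x,y)|\le m^K(t)$ for all $x\in\overline U,y\in K$; and for a.e. $t$ the map $f(t,\cdot,\cdot)$ is continuous. $f\in\mathfrak{LC}$ if moreover for every compact $K$ there is a nonnegative $l^K\in L^1_{loc}$ (an $l$-bound on $K$) such that for a.e. $t$, $|f(t,x,y_1)-f(t,x,y_2)|\le l^K(t)|y_1-y_2|$ for all $x\in\overline U$, $y_1,y_2\in K$. Functions differing on a negligible set are identified. A modulus of continuity $\widehat\theta:\mathbb R^+\to\mathbb R^+$ is a non-decreasing continuous function with $\widehat\theta(0)=0$; an $l$-bound of $f$ on $K$ with respect to $\widehat\theta$ in the variable $x$ is a nonnegative $l^K\in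 L^1_{loc}$ such that for a.e. $t$, $|f(t,x_1,y_1)-f(t,x_2,y_2)|\le l^K(t)\big(\widehat\theta(|x_1-x_2|)+|y_1-y_2|\big)$ for all $x_1,x_2\in\overline U$, $y_1,y_2\in K$. Put $\tilde f(t,z)(x)=f(t,x,z(x))$ for $z\in C(\overline U,\mathbb R^N)$. Families of bounds. $E\subset\mathfrak{LC}$ has $L^1_{loc}$-bounded $m$-bounds (resp. $l$-bounds, resp. $l$-bounds with respect to $\widehat\theta$ in $x$) if for every $j\in\mathbb N$ there is a set $S^j\subset L^1_{loc}$ of $m$-bounds (resp. $l$-bounds, resp. $l$-bounds w.r.t. $\widehat\theta$) on $B_j$ of the functions of $E$ (containing one for each $f\in E$) such that $\sup_{m\in S^j}\int_{-r}^r m<\infty$ for every $r>0$. It has $L^1_{loc}$-equicontinuous such bounds if $S^j$ can be chosen so that for all $r,\varepsilon>0$ there is $\delta>0$ with $\sup_{m\in S^j}\int_{t_1}^{t_2}m<\varepsilon$ whenever $-r\le t_1\le t_2\le r$ and $t_2-t_1<\delta$. Suitable set of moduli of continuity. $\Theta=(\Theta_1,\Theta_2)$, where $\Theta_1=\{\theta_j^I\in C(\mathbb R^+,\mathbb R^+): j\in\mathbb N,\ I=[q_1,q_2]\}$ and $\Theta_2=\{\theta_j^{I,\nu}\in C(\mathbb R^+,\mathbb R^+): j,\nu\in\mathbb N,\ I=[q_1,q_2],\ q_1+1/\nu<q_2\}$ consist of non-decreasing continuous functions vanishing at $0$ such that $\theta_{j_1}^{I_1}\le\theta_{j_2}^{I_2}$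 whenever $I_1\subseteq I_2$, $j_1\le j_2$, and $\theta_{j_1}^{I_1,\nu_1}\le\theta_{j_2}^{I_2,\nu_2}$ whenever $I_1\subseteq I_2$, $\nu_1\le\nu_2$, $j_1\le j_2$ (with $1/\nu_1$ smaller than the length of $I_1$). $\mathcal H_j^I$ is the set of $v\in C(I,\mathcal B_j)$ such that for every integer $\nu\ge1$ with $q_1+1/\nu<q_2$: $\|v(t_1)-v(t_2)\|\le\theta_j^{I,\nu}(|t_1-t_2|)+\theta_j^I(1/\nu)$ for all $t_1,t_2\in[q_1+1/\nu,q_2]$. Topologies on $\mathfrak{SC}$ (and, by restriction, on subsets), each generated by the indicated seminorms, over all $I=[q_1,q_2]$ with rational endpoints, $j\in\mathbb N$, $y\in D$, $x\in\widetilde D$ ($\tilde y$ is the constant map equal to $y$ on $\overline U$): $\mathcal T_B$: $\sup_{v\in C(I,\mathcal B_j)}\int_I\|\tilde f(s,v(s))\|\,ds$; $\mathcal T_D$: $\int_I\|\tilde f(s,\tilde y)\|\,ds$; $\sigma_D$: $\|\int_I\tilde f(s,\tilde y)\,ds\|=\sup_{x\in\overline U}|\int_I f(s,x,y)\,ds|$; $\mathcal T_{\widetilde DD}$: $\int_I|f(s,x,y)|\,ds$; $\sigma_{\widetilde DD}$: $|\int_I f(s,x,y)\,ds|$; $\mathcal T_\Theta$: $\sup_{v\in\mathcal H_j^I}\int_I\|\tilde f(s,v(s))\|\,ds$; $\sigma_\Theta$: $\sup_{v\in\mathcal H_j^I}\|\int_I\tilde f(s,v(s))\,ds\|=\sup_{x\in\overline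 U,\,v\in\mathcal H_j^I}|\int_I f(s,x,v(s)(x))\,ds|$. $(E,\mathcal T_1)=(E,\mathcal T_2)$ means the induced topologies on $E$ coincide; $\mathrm{cls}_{(\mathfrak{LC},\mathcal T)}(E)$ is the closure of $E$ in $(\mathfrak{LC},\mathcal T)$. *)

theory Defs
  imports "HOL-Analysis.Analysis"
begin

section \<open>Norms, domains, local integrability\<close>

definition l1norm :: "real ^ 'k \<Rightarrow> real" where
  "l1norm y = (\<Sum>i\<in>UNIV. \<bar>y $ i\<bar>)"

definition l1cball :: "nat \<Rightarrow> (real ^ 'k) set" where
  "l1cball j = {y. l1norm y \<le> real j}"

definition supnorm :: "(real ^ 'm) set \<Rightarrow> (real ^ 'm \<Rightarrow> real ^ 'n) \<Rightarrow> real" where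
  "supnorm U z = (SUP x\<in>closure U. l1norm (z x))"

text \<open>Boundary of class \<open>C\<^sup>1\<close>: near each boundary point, \<open>U\<close> is the sublevel set of a \<open>C\<^sup>1\<close>
  function with nonvanishing gradient \<open>G\<close> (so, by the implicit function theorem, \<open>U\<close> lies locally
  on one side of the graph of a \<open>C\<^sup>1\<close> function). This is the weakest of the conditions
  ``\<open>C\<^sup>k\<close> boundary'', \<open>k \<ge> 1\<close>.\<close>

definition C1_boundary :: "(real ^ 'm) set \<Rightarrow> bool" where
  "C1_boundary U \<longleftrightarrow> (\<forall>p\<in>frontier U. \<exists>r>0. \<exists>(\<phi> :: real ^ 'm \<Rightarrow> real) G.
     (\<forall>x\<in>ball p r. (\<phi> has_derivative (\<lambda>h. G x \<bullet> h)) (at x)) \<and>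
     continuous_on (ball p r) G \<and> G p \<noteq> 0 \<and>
     U \<inter> ball p r = {x \<in> ball p r. \<phi> x < 0})"

text \<open>Integrals are taken with respect to the completed measure \<open>lebesgue\<close>: for instance
  \<open>s \<mapsto> supnorm U (f s)\<close> need only agree almost everywhere with a Borel function.\<close>

definition L1loc :: "(real \<Rightarrow> real) set" where
  "L1loc = {m. \<forall>C. compact C \<longrightarrow> set_integrable lebesgue C m}"

section \<open>Caratheodory maps\<close>

text \<open>A map on \<open>\<real> \<times> closure U \<times> \<real>\<^sup>N\<close> is a total function whose values for \<open>x \<notin> closure U\<close> are
  ignored; the identification \<open>SC_rel\<close> below removes them.\<close>

type_synonym ('m, 'n) cmap = "real \<Rightarrow> real ^ 'm \<Rightarrow> real ^ 'n \<Rightarrow> real ^ 'n"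

definition m_bound ::
  "(real ^ 'm) set \<Rightarrow> ('m::finite, 'n::finite) cmap \<Rightarrow> (real ^ 'n) set \<Rightarrow> (real \<Rightarrow> real) \<Rightarrow> bool" where
  "m_bound U f K m \<longleftrightarrow> m \<in> L1loc \<and> (\<forall>t. 0 \<le> m t) \<and>
     (AE t in lebesgue. \<forall>x\<in>closure U. \<forall>y\<in>K. l1norm (f t x y) \<le> m t)"

definition l_bound ::
  "(real ^ 'm) set \<Rightarrow> ('m::finite, 'n::finite) cmap \<Rightarrow> (real ^ 'n) set \<Rightarrow> (real \<Rightarrow> real) \<Rightarrow> bool" where
  "l_bound U f K l \<longleftrightarrow> l \<in> L1loc \<and> (\<forall>t. 0 \<le> l t) \<and>
     (AE t in lebesgue. \<forall>x\<in>closure U. \<forall>y1\<in>K. \<forall>y2\<in>K.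
        l1norm (f t x y1 - f t x y2) \<le> l t * l1norm (y1 - y2))"

definition modulus :: "(real \<Rightarrow> real) \<Rightarrow> bool" where
  "modulus \<theta> \<longleftrightarrow> \<theta> \<in> {0..} \<rightarrow> {0..} \<and> mono_on {0..} \<theta> \<and> continuous_on {0..} \<theta> \<and> \<theta> 0 = 0"

definition l_bound_wrt ::
  "(real \<Rightarrow> real) \<Rightarrow> (real ^ 'm) set \<Rightarrow> ('m::finite, 'n::finite) cmap \<Rightarrow> (real ^ 'n) set
    \<Rightarrow> (real \<Rightarrow> real) \<Rightarrow> bool" where
  "l_bound_wrt \<theta> U f K l \<longleftrightarrow> l \<in> L1loc \<and> (\<forall>t. 0 \<le> l t) \<and>
     (AE t in lebesgue. \<forall>x1\<in>closure U. \<forall>x2\<in>closure U. \<forall>y1\<in>K. \<forall>y2\<in>K.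
        l1norm (f t x1 y1 - f t x2 y2) \<le> l t * (\<theta> (l1norm (x1 - x2)) + l1norm (y1 - y2)))"

definition SC_maps :: "(real ^ 'm) set \<Rightarrow> ('m::finite, 'n::finite) cmap set" where
  "SC_maps U = {f.
     (\<lambda>(t, x, y). f t x y) \<in> borel_measurable (restrict_space borel (UNIV \<times> closure U \<times> UNIV)) \<and>
     (\<forall>K. compact K \<longrightarrow> (\<exists>m. m_bound U f K m)) \<and>
     (AE t in lebesgue. continuous_on (closure U \<times> UNIV) (\<lambda>(x, y). f t x y))}"

definition LC_maps :: "(real ^ 'm) set \<Rightarrow> ('m::finite, 'n::finite) cmap set" where
  "LC_maps U = {f \<in> SC_maps U. \<forall>K. compact K \<longrightarrow> (\<exists>l. l_bound U f K l)}"

text \<open>Maps that differ on a negligible set are identified, so \<open>SC U\<close> and \<open>LC U\<close> consist of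
  equivalence classes. Bounds and seminorms of a class are those of a chosen representative; by
  \<open>SC_rel_imp_AE\<close> below they do not depend on the choice.\<close>

definition SC_rel :: "(real ^ 'm) set \<Rightarrow> (('m::finite, 'n::finite) cmap \<times> ('m, 'n) cmap) set" where
  "SC_rel U = {(f, g). f \<in> SC_maps U \<and> g \<in> SC_maps U \<and>
     negligible {(t, x, y). x \<in> closure U \<and> f t x y \<noteq> g t x y}}"

definition SC :: "(real ^ 'm) set \<Rightarrow> ('m::finite, 'n::finite) cmap set set" where
  "SC U = SC_maps U // SC_rel U"

definition rep :: "('m::finite, 'n::finite) cmap set \<Rightarrow> ('m, 'n) cmap" where
  "rep F = (SOME f. f \<in> F)"

definition LC :: "(real ^ 'm) set \<Rightarrow> ('m::finite, 'n::finite) cmap set set" where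
  "LC U = {F \<in> SC U. rep F \<in> LC_maps U}"

lemma equiv_SC_rel: "equiv (SC_maps U) (SC_rel U :: (('m::finite, 'n::finite) cmap \<times> _) set)"
proof (rule equivI)
  show "refl_on (SC_maps U) (SC_rel U :: (('m, 'n) cmap \<times> _) set)"
    by (auto simp: refl_on_def SC_rel_def case_prod_unfold)
  show "SC_rel U \<subseteq> SC_maps U \<times> (SC_maps U :: ('m, 'n) cmap set)"
    by (auto simp: SC_rel_def)
  show "sym (SC_rel U :: (('m, 'n) cmap \<times> _) set)"
    by (auto simp: sym_def SC_rel_def eq_commute)
  show "trans (SC_rel U :: (('m, 'n) cmap \<times> _) set)"
  proof (rule transI)
    fix f g h :: "('m, 'n) cmap"
    let ?N = "\<lambda>f g :: ('m, 'n) cmap. {(t, x, y). x \<in> closure U \<and> f t x y \<noteq> g t x y}"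
    assume *: "(f, g) \<in> SC_rel U" "(g, h) \<in> SC_rel U"
    then have "negligible (?N f g \<union> ?N g h)"
      by (intro negligible_Un) (auto simp: SC_rel_def)
    then have "negligible (?N f h)"
      by (rule negligible_subset) auto
    with * show "(f, h) \<in> SC_rel U"
      by (auto simp: SC_rel_def)
  qed
qed

lemma rep_in_class: "F \<in> SC U \<Longrightarrow> rep F \<in> F"
  unfolding rep_def SC_def
  using in_quotient_imp_non_empty[OF equiv_SC_rel, of F U] by (simp add: some_in_eq)

lemma SC_rel_imp_AE:
  fixes f g :: "('m::finite, 'n::finite) cmap"
  assumes "open U" and fg: "(f, g) \<in> SC_rel U"
  shows "AE t in lebesgue. \<forall>x\<in>closure U. \<forall>y. f t x y = g t x y"
proof -
  let ?N = "{(t, x, y). x \<in> closure U \<and> f t x y \<noteq> g t x y}"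
  have "?N \<in> null_sets lebesgue"
    using fg by (simp add: SC_rel_def negligible_iff_null_sets)
  then have "AE p in (lborel :: (real \<times> (real ^ 'm) \<times> (real ^ 'n)) measure). p \<notin> ?N"
    by (subst AE_completion_iff[symmetric]) (rule AE_not_in)
  then have "AE p in (lborel \<Otimes>\<^sub>M lborel :: (real \<times> (real ^ 'm) \<times> (real ^ 'n)) measure). p \<notin> ?N"
    by (subst lborel_prod)
  then have "AE t in lborel. AE q in (lborel :: ((real ^ 'm) \<times> (real ^ 'n)) measure). (t, q) \<notin> ?N"
    by (rule lborel_pair.AE_pair)
  then have 1: "AE t in lebesgue. AE q in (lborel :: ((real ^ 'm) \<times> (real ^ 'n)) measure). (t, q) \<notin> ?N"
    by (rule AE_completion)
  have 2: "AE t in lebesgue. continuous_on (closure U \<times> UNIV) (\<lambda>(x, y). f t x y)"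
    "AE t in lebesgue. continuous_on (closure U \<times> UNIV) (\<lambda>(x, y). g t x y)"
    using fg by (auto simp: SC_rel_def SC_maps_def)
  from 1 2 show ?thesis
  proof eventually_elim
    case (elim t)
    let ?d = "\<lambda>(x, y). f t x y - g t x y"
    have cont: "continuous_on (closure U \<times> UNIV) ?d"
      using continuous_on_diff[OF elim(2,3)] by (simp add: case_prod_unfold)
    let ?S = "(U \<times> UNIV) \<inter> ?d -` (- {0})"
    have "U \<times> UNIV \<subseteq> closure U \<times> (UNIV :: (real ^ 'n) set)"
      using closure_subset by blast
    then have "open ?S"
      using continuous_on_subset[OF cont] \<open>open U\<close>
      by (intro continuous_open_preimage) (auto intro: open_Times)
    have "AE q in lebesgue. q \<notin> ?S"
      using AE_completion[OF elim(1)] by eventually_elim (use closure_subset in auto)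
    moreover have "?S \<in> sets lebesgue"
      using \<open>open ?S\<close> by (intro sets_completionI_sets) auto
    ultimately have "negligible ?S"
      by (simp add: AE_iff_null_sets negligible_iff_null_sets)
    with \<open>open ?S\<close> have "?S = {}"
      using open_not_negligible by blast
    then have U: "?d q = 0" if "q \<in> U \<times> UNIV" for q
      using that by auto
    show ?case
    proof (intro ballI allI)
      fix x y assume "x \<in> closure U"
      then have "?d (x, y) = 0"
        using continuous_constant_on_closure[of "U \<times> UNIV" ?d 0 "(x, y)"] U cont
        by (simp only: closure_Times closure_UNIV mem_Times_iff fst_conv snd_conv UNIV_I simp_thms)
      then show "f t x y = g t x y" by simp
    qed
  qed
qed

section \<open>Families of bounds\<close>

text \<open>The parameter \<open>bd\<close> is one of \<open>m_bound U\<close>, \<open>l_bound U\<close>, \<open>l_bound_wrt \<theta> U\<close>. The suprema are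
  taken in the extended reals, where the supremum of the empty set is \<open>-\<infinity>\<close>.\<close>

definition bounds_family ::
  "(('m::finite, 'n::finite) cmap \<Rightarrow> (real ^ 'n) set \<Rightarrow> (real \<Rightarrow> real) \<Rightarrow> bool)
    \<Rightarrow> ('m, 'n) cmap set set \<Rightarrow> nat \<Rightarrow> (real \<Rightarrow> real) set \<Rightarrow> bool" where
  "bounds_family bd E j S \<longleftrightarrow>
     (\<forall>m\<in>S. \<exists>F\<in>E. bd (rep F) (l1cball j) m) \<and> (\<forall>F\<in>E. \<exists>m\<in>S. bd (rep F) (l1cball j) m)"

definition L1loc_bounded ::
  "(('m::finite, 'n::finite) cmap \<Rightarrow> (real ^ 'n) set \<Rightarrow> (real \<Rightarrow> real) \<Rightarrow> bool)
    \<Rightarrow> ('m, 'n) cmap set set \<Rightarrow> bool" where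
  "L1loc_bounded bd E \<longleftrightarrow> (\<forall>j\<ge>1. \<exists>S. bounds_family bd E j S \<and>
     (\<forall>r>0. (SUP m\<in>S. ereal (LINT t:{-r..r}|lebesgue. m t)) < \<infinity>))"

definition L1loc_equicontinuous ::
  "(('m::finite, 'n::finite) cmap \<Rightarrow> (real ^ 'n) set \<Rightarrow> (real \<Rightarrow> real) \<Rightarrow> bool)
    \<Rightarrow> ('m, 'n) cmap set set \<Rightarrow> bool" where
  "L1loc_equicontinuous bd E \<longleftrightarrow> (\<forall>j\<ge>1. \<exists>S. bounds_family bd E j S \<and>
     (\<forall>r>0. \<forall>\<epsilon>>0. \<exists>\<delta>>0. \<forall>t1 t2. -r \<le> t1 \<and> t1 \<le> t2 \<and> t2 \<le> r \<and> t2 - t1 < \<delta> \<longrightarrow>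
        (SUP m\<in>S. ereal (LINT t:{t1..t2}|lebesgue. m t)) < ereal \<epsilon>))"

section \<open>Suitable sets of moduli of continuity\<close>

text \<open>The interval \<open>[q1, q2]\<close> is encoded by the pair of its endpoints; the families are only
  constrained on the indices for which they are defined in the source.\<close>

definition rat_ivls :: "(real \<times> real) set" where
  "rat_ivls = {(q1, q2). q1 \<in> \<rat> \<and> q2 \<in> \<rat> \<and> q1 < q2}"

definition suitable_moduli ::
  "(nat \<Rightarrow> real \<times> real \<Rightarrow> real \<Rightarrow> real) \<Rightarrow> (nat \<Rightarrow> real \<times> real \<Rightarrow> nat \<Rightarrow> real \<Rightarrow> real) \<Rightarrow> bool" where
  "suitable_moduli \<Theta>1 \<Theta>2 \<longleftrightarrow>
     (\<forall>j\<ge>1. \<forall>I\<in>rat_ivls. modulus (\<Theta>1 j I)) \<and>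
     (\<forall>j\<ge>1. \<forall>(q1, q2)\<in>rat_ivls. \<forall>\<nu>\<ge>1. q1 + 1 / real \<nu> < q2 \<longrightarrow> modulus (\<Theta>2 j (q1, q2) \<nu>)) \<and>
     (\<forall>j1\<ge>1. \<forall>j2\<ge>j1. \<forall>(p1, p2)\<in>rat_ivls. \<forall>(q1, q2)\<in>rat_ivls. {p1..p2} \<subseteq> {q1..q2} \<longrightarrow>
        (\<forall>s\<ge>0. \<Theta>1 j1 (p1, p2) s \<le> \<Theta>1 j2 (q1, q2) s)) \<and>
     (\<forall>j1\<ge>1. \<forall>j2\<ge>j1. \<forall>\<nu>1\<ge>1. \<forall>\<nu>2\<ge>\<nu>1. \<forall>(p1, p2)\<in>rat_ivls. \<forall>(q1, q2)\<in>rat_ivls.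
        {p1..p2} \<subseteq> {q1..q2} \<and> p1 + 1 / real \<nu>1 < p2 \<longrightarrow>
        (\<forall>s\<ge>0. \<Theta>2 j1 (p1, p2) \<nu>1 s \<le> \<Theta>2 j2 (q1, q2) \<nu>2 s))"

text \<open>\<open>C(I, C(closure U, B\<^sub>j))\<close> for \<open>I = [q1, q2]\<close>, with continuity in \<open>t\<close> for the sup norm. Values
  outside \<open>I \<times> closure U\<close> are irrelevant.\<close>

definition CB :: "(real ^ 'm) set \<Rightarrow> nat \<Rightarrow> real \<times> real \<Rightarrow> (real \<Rightarrow> real ^ 'm \<Rightarrow> real ^ 'n) set" where
  "CB U j = (\<lambda>(q1, q2). {v.
     (\<forall>t\<in>{q1..q2}. continuous_on (closure U) (v t) \<and> v t ` closure U \<subseteq> l1cball j) \<and>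
     (\<forall>t0\<in>{q1..q2}. ((\<lambda>t. supnorm U (\<lambda>x. v t x - v t0 x)) \<longlongrightarrow> 0) (at t0 within {q1..q2}))})"

definition HH ::
  "(real ^ 'm) set \<Rightarrow> (nat \<Rightarrow> real \<times> real \<Rightarrow> real \<Rightarrow> real)
    \<Rightarrow> (nat \<Rightarrow> real \<times> real \<Rightarrow> nat \<Rightarrow> real \<Rightarrow> real) \<Rightarrow> nat \<Rightarrow> real \<times> real
    \<Rightarrow> (real \<Rightarrow> real ^ 'm \<Rightarrow> real ^ 'n) set" where
  "HH U \<Theta>1 \<Theta>2 j = (\<lambda>(q1, q2). {v \<in> CB U j (q1, q2).
     \<forall>\<nu>\<ge>1. q1 + 1 / real \<nu> < q2 \<longrightarrow>
       (\<forall>t1\<in>{q1 + 1 / real \<nu>..q2}. \<forall>t2\<in>{q1 + 1 / real \<nu>..q2}.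
          supnorm U (\<lambda>x. v t1 x - v t2 x)
            \<le> \<Theta>2 j (q1, q2) \<nu> \<bar>t1 - t2\<bar> + \<Theta>1 j (q1, q2) (1 / real \<nu>))})"

section \<open>The topologies\<close>

definition seminorm_topology ::
  "(real ^ 'm) set \<Rightarrow> (('m::finite, 'n::finite) cmap \<Rightarrow> real) set \<Rightarrow> ('m, 'n) cmap set topology" where
  "seminorm_topology U P = topology_generated_by (insert (SC U)
     {{G \<in> SC U. p (\<lambda>t x y. rep G t x y - rep F t x y) < \<epsilon>} | p F \<epsilon>. p \<in> P \<and> F \<in> SC U \<and> 0 < \<epsilon>})"

definition T_B :: "(real ^ 'm) set \<Rightarrow> ('m::finite, 'n::finite) cmap set topology" where
  "T_B U = seminorm_topology U
     {(\<lambda>f. SUP v\<in>CB U j (q1, q2). LINT s:{q1..q2}|lebesgue. supnorm U (\<lambda>x. f s x (v s x)))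
      | q1 q2 j. (q1, q2) \<in> rat_ivls \<and> 1 \<le> j}"

definition T_D :: "(real ^ 'm) set \<Rightarrow> (real ^ 'n) set \<Rightarrow> ('m::finite, 'n::finite) cmap set topology" where
  "T_D U D = seminorm_topology U
     {(\<lambda>f. LINT s:{q1..q2}|lebesgue. supnorm U (\<lambda>x. f s x y))
      | q1 q2 y. (q1, q2) \<in> rat_ivls \<and> y \<in> D}"

definition sigma_D ::
  "(real ^ 'm) set \<Rightarrow> (real ^ 'n) set \<Rightarrow> ('m::finite, 'n::finite) cmap set topology" where
  "sigma_D U D = seminorm_topology U
     {(\<lambda>f. supnorm U (\<lambda>x. LINT s:{q1..q2}|lebesgue. f s x y))
      | q1 q2 y. (q1, q2) \<in> rat_ivls \<and> y \<in> D}"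

definition T_DD :: "(real ^ 'm) set \<Rightarrow> (real ^ 'm) set \<Rightarrow> (real ^ 'n) set
    \<Rightarrow> ('m::finite, 'n::finite) cmap set topology" where
  "T_DD U D' D = seminorm_topology U
     {(\<lambda>f. LINT s:{q1..q2}|lebesgue. l1norm (f s x y))
      | q1 q2 x y. (q1, q2) \<in> rat_ivls \<and> x \<in> D' \<and> y \<in> D}"

definition sigma_DD :: "(real ^ 'm) set \<Rightarrow> (real ^ 'm) set \<Rightarrow> (real ^ 'n) set
    \<Rightarrow> ('m::finite, 'n::finite) cmap set topology" where
  "sigma_DD U D' D = seminorm_topology U
     {(\<lambda>f. l1norm (LINT s:{q1..q2}|lebesgue. f s x y))
      | q1 q2 x y. (q1, q2) \<in> rat_ivls \<and> x \<in> D' \<and> y \<in> D}"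

definition T_Theta ::
  "(real ^ 'm) set \<Rightarrow> (nat \<Rightarrow> real \<times> real \<Rightarrow> real \<Rightarrow> real)
    \<Rightarrow> (nat \<Rightarrow> real \<times> real \<Rightarrow> nat \<Rightarrow> real \<Rightarrow> real) \<Rightarrow> ('m::finite, 'n::finite) cmap set topology" where
  "T_Theta U \<Theta>1 \<Theta>2 = seminorm_topology U
     {(\<lambda>f. SUP v\<in>HH U \<Theta>1 \<Theta>2 j (q1, q2).
            LINT s:{q1..q2}|lebesgue. supnorm U (\<lambda>x. f s x (v s x)))
      | q1 q2 j. (q1, q2) \<in> rat_ivls \<and> 1 \<le> j}"

definition sigma_Theta ::
  "(real ^ 'm) set \<Rightarrow> (nat \<Rightarrow> real \<times> real \<Rightarrow> real \<Rightarrow> real)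
    \<Rightarrow> (nat \<Rightarrow> real \<times> real \<Rightarrow> nat \<Rightarrow> real \<Rightarrow> real) \<Rightarrow> ('m::finite, 'n::finite) cmap set topology" where
  "sigma_Theta U \<Theta>1 \<Theta>2 = seminorm_topology U
     {(\<lambda>f. SUP v\<in>HH U \<Theta>1 \<Theta>2 j (q1, q2).
            supnorm U (\<lambda>x. LINT s:{q1..q2}|lebesgue. f s x (v s x)))
      | q1 q2 j. (q1, q2) \<in> rat_ivls \<and> 1 \<le> j}"

definition cls :: "'a set \<Rightarrow> 'a topology \<Rightarrow> 'a set \<Rightarrow> 'a set" where
  "cls L T E = subtopology T L closure_of E"

end

theory Submission
  imports Defs
begin

text \<open>Let \<open>d = g - f\<close> be a difference of two members of the family. On \<open>B\<^sub>j\<close> choose a finite net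
  in \<open>D\<close>: replacing \<open>v s x\<close> by the nearest net point costs at most the mesh times an \<open>l\<close>-bound of
  \<open>d\<close>, whose integral is bounded on the family, so finitely many seminorms of \<open>T_D\<close> control one of
  \<open>T_B\<close>. For integrals without absolute values \<open>v\<close> is first frozen on a partition of the interval into
  short pieces with rational endpoints; the moduli in \<open>HH\<close> make this possible away from the left
  endpoint, where the equicontinuous \<open>m\<close>-bounds take over. Likewise a finite net in \<open>D'\<close> handles the
  variable \<open>x\<close>. For closures, each argument is applied to \<open>E\<close> enlarged by one element of \<open>LC\<close>.\<close>

section \<open>The norm and integrals\<close>

text \<open>In every comparison one direction is cheap: constant maps belong to \<open>HH\<close>
  and \<open>CB\<close>, and points of \<open>D'\<close> to \<open>closure U\<close>, so the smaller
  index set gives the coarser topology. Only the reverse uses the bounds assumed on the family. With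
  the norm inside the integral, the net point may change with \<open>s\<close> and \<open>x\<close>
  in any way, because the sum over the whole net dominates whichever point is nearest. With the norm
  outside, cancellation in time must survive, so the point has to stay fixed on whole subintervals.
  The order of the choices is then forced: \<open>\<nu>\<close> comes first, making the defect
  \<open>\<Theta>1 j (a, b) (1 / \<nu>)\<close> small and the initial piece short; then the mesh,
  since \<open>\<Theta>2\<close> depends on \<open>\<nu>\<close>; last the tolerance, since it is
  divided among the pieces. A second obstacle is technical: a real supremum is meaningful only over
  a bounded set, and over an uncountable index set it need not be measurable. Suprema are therefore
  bounded by \<open>m\<close>-bounds and reduced, outside a null set, to countable dense
  subsets.\<close>

lemma l1norm_0 [simp]: "l1norm 0 = 0"
  by (simp add: l1norm_def)

lemma l1norm_nonneg [simp]: "0 \<le> l1norm y"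
  by (simp add: l1norm_def sum_nonneg)

lemma l1norm_triangle: "l1norm (x + y) \<le> l1norm x + l1norm y"
  unfolding l1norm_def sum.distrib[symmetric] by (intro sum_mono) simp

lemma l1norm_minus_commute: "l1norm (x - y) = l1norm (y - x)"
  unfolding l1norm_def by (simp add: abs_minus_commute)

lemma l1norm_triangle_diff: "l1norm (x - z) \<le> l1norm (x - y) + l1norm (y - z)"
  using l1norm_triangle[of "x - y" "y - z"] by simp

lemma l1norm_diff_le: "l1norm (x - y) \<le> l1norm x + l1norm y"
  unfolding l1norm_def sum.distrib[symmetric] by (intro sum_mono) simp

lemma norm_le_l1norm: "norm y \<le> l1norm y"
  unfolding l1norm_def by (rule norm_le_l1_cart)

lemma continuous_on_l1norm [continuous_intros]:
  "continuous_on S f \<Longrightarrow> continuous_on S (\<lambda>x. l1norm (f x))"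
  unfolding l1norm_def by (intro continuous_intros)

lemma compact_l1cball: "compact (l1cball j :: (real ^ 'k) set)"
proof -
  have "l1cball j \<subseteq> cball (0 :: real ^ 'k) (real j)"
    unfolding l1cball_def using norm_le_l1norm order_trans by fastforce
  then have "bounded (l1cball j :: (real ^ 'k) set)"
    using bounded_cball bounded_subset by blast
  moreover have "closed (l1cball j :: (real ^ 'k) set)"
    unfolding l1cball_def by (intro closed_Collect_le continuous_intros)
  ultimately show ?thesis
    by (simp add: compact_eq_bounded_closed)
qed

lemma zero_in_l1cball [simp]: "0 \<in> l1cball j"
  by (simp add: l1cball_def)

lemma ex_l1cball: "\<exists>j\<ge>1. y \<in> l1cball j"
proof -
  obtain j :: nat where "l1norm y \<le> real j"
    using real_arch_simple by blast
  then have "y \<in> l1cball (Suc j)"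
    by (simp add: l1cball_def)
  then show ?thesis
    by (intro exI[of _ "Suc j"]) auto
qed

text \<open>Compactness applied to the cover of \<open>S\<close> by balls centred in
  \<open>A\<close>. The net lies in \<open>A\<close> and may leave \<open>S\<close>; this allows
  nets drawn from \<open>D\<close> for a ball of values and from \<open>D'\<close> for
  \<open>closure U\<close>.\<close>

lemma finite_l1norm_net:
  fixes S A :: "(real ^ 'k) set"
  assumes "compact S" "S \<subseteq> closure A" "\<delta> > 0"
  shows "\<exists>Y. finite Y \<and> Y \<subseteq> A \<and> (\<forall>x\<in>S. \<exists>y\<in>Y. l1norm (x - y) < \<delta>)"
proof -
  have op: "open {x. l1norm (x - y) < r}" for y :: "real ^ 'k" and r
    by (intro open_Collect_less continuous_intros)
  have "S \<subseteq> (\<Union>y\<in>A. {x. l1norm (x - y) < \<delta>})"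
  proof
    fix x assume "x \<in> S"
    then have "x \<in> {z. l1norm (z - x) < \<delta>}" "x \<in> closure A"
      using assms by auto
    moreover have "open {z. l1norm (z - x) < \<delta>}"
      by (intro open_Collect_less continuous_intros)
    ultimately have "A \<inter> {z. l1norm (z - x) < \<delta>} \<noteq> {}"
      by (simp only: closure_iff_nhds_not_empty) blast
    then obtain y where "y \<in> A" "l1norm (y - x) < \<delta>"
      by blast
    then show "x \<in> (\<Union>y\<in>A. {x. l1norm (x - y) < \<delta>})"
      by (intro UN_I[of y]) (simp_all only: mem_Collect_eq l1norm_minus_commute[of x y])
  qed
  then obtain Y where "Y \<subseteq> A" "finite Y" "S \<subseteq> (\<Union>y\<in>Y. {x. l1norm (x - y) < \<delta>})"
    using compactE_image[OF \<open>compact S\<close>, of A "\<lambda>y. {x. l1norm (x - y) < \<delta>}"] op by metis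
  then show ?thesis
    by (intro exI[of _ Y]) auto
qed

lemma set_integrable_nth:
  fixes g :: "real \<Rightarrow> real ^ 'n"
  assumes "set_integrable M A g"
  shows "set_integrable M A (\<lambda>s. g s $ i)"
  using integrable_bounded_linear[OF bounded_linear_vec_nth[of i] assms[unfolded set_integrable_def]]
  by (simp add: set_integrable_def)

lemma set_integrable_l1norm:
  fixes g :: "real \<Rightarrow> real ^ 'n"
  assumes "set_integrable M A g"
  shows "set_integrable M A (\<lambda>s. l1norm (g s))"
proof -
  have "set_integrable M A (\<lambda>s. \<bar>g s $ i\<bar>)" for i
    by (intro set_integrable_abs set_integrable_nth assms)
  then show ?thesis
    unfolding l1norm_def set_integrable_def scaleR_sum_right by (intro Bochner_Integration.integrable_sum) auto
qed

text \<open>Proved coordinate by coordinate: the Bochner estimate concerns the Euclidean norm, and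
  comparing the two norms would cost a dimensional constant.\<close>

lemma l1norm_set_integral_le:
  fixes g :: "real \<Rightarrow> real ^ 'n"
  assumes g: "set_integrable M A g"
  shows "l1norm (LINT s:A|M. g s) \<le> (LINT s:A|M. l1norm (g s))"
proof -
  have i: "set_integrable M A (\<lambda>s. \<bar>g s $ i\<bar>)" for i
    by (intro set_integrable_abs set_integrable_nth assms)
  have "\<bar>(LINT s:A|M. g s) $ i\<bar> \<le> (LINT s:A|M. \<bar>g s $ i\<bar>)" for i
  proof -
    have "(LINT s:A|M. g s) $ i = (LINT s:A|M. g s $ i)"
      using integral_bounded_linear[OF bounded_linear_vec_nth[of i] g[unfolded set_integrable_def]]
      by (simp add: set_lebesgue_integral_def)
    also have "\<bar>\<dots>\<bar> \<le> (LINT s:A|M. \<bar>g s $ i\<bar>)"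
      using integral_abs_bound[of M "\<lambda>s. indicator A s *\<^sub>R g s $ i"]
      by (simp add: set_lebesgue_integral_def abs_mult)
    finally show ?thesis .
  qed
  then have "l1norm (LINT s:A|M. g s) \<le> (\<Sum>i\<in>UNIV. LINT s:A|M. \<bar>g s $ i\<bar>)"
    unfolding l1norm_def by (rule sum_mono)
  also have "\<dots> = (LINT s:A|M. l1norm (g s))"
    using i unfolding l1norm_def set_integrable_def set_lebesgue_integral_def scaleR_sum_right
    by (subst Bochner_Integration.integral_sum) auto
  finally show ?thesis .
qed

lemma set_integral_combine:
  fixes g :: "real \<Rightarrow> 'a::euclidean_space"
  assumes "a \<le> c" "c \<le> b" "set_integrable lebesgue {a..b} g"
  shows "(LINT s:{a..b}|lebesgue. g s) = (LINT s:{a..c}|lebesgue. g s) + (LINT s:{c..b}|lebesgue. g s)"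
proof -
  have i: "set_integrable lebesgue {a..c} g" "set_integrable lebesgue {c..b} g"
    using assms by (auto intro: set_integrable_subset)
  have "g integrable_on {a..b}"
    using set_lebesgue_integral_eq_integral(1)[OF assms(3)] .
  then show ?thesis
    using Henstock_Kurzweil_Integration.integral_combine[OF assms(1,2), of g] i assms(3)
    by (simp add: set_lebesgue_integral_eq_integral(2))
qed

lemma set_integral_subset_le:
  fixes g :: "real \<Rightarrow> real"
  assumes "set_integrable lebesgue A g" "B \<subseteq> A" "B \<in> sets lebesgue" "\<And>s. s \<in> A \<Longrightarrow> 0 \<le> g s"
  shows "(LINT s:B|lebesgue. g s) \<le> (LINT s:A|lebesgue. g s)"
  unfolding set_lebesgue_integral_def
proof (rule integral_mono)
  show "integrable lebesgue (\<lambda>s. indicat_real B s *\<^sub>R g s)" "integrable lebesgue (\<lambda>s. indicat_real A s *\<^sub>R g s)"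
    using assms(1) set_integrable_subset[OF assms(1,3,2)] by (simp_all only: set_integrable_def)
  show "indicat_real B s *\<^sub>R g s \<le> indicat_real A s *\<^sub>R g s" for s
    using assms(2,4) by (auto simp: indicator_def)
qed

text \<open>This rests on completeness: the preimages of a Borel set under the two functions differ
  only inside a null set.\<close>

lemma borel_measurable_lebesgue_cong_AE:
  fixes f g :: "real \<Rightarrow> real"
  assumes f: "f \<in> borel_measurable lebesgue" and eq: "AE t in lebesgue. f t = g t"
  shows "g \<in> borel_measurable lebesgue"
proof (rule measurableI)
  fix B :: "real set" assume "B \<in> sets borel"
  then have "f -` B \<inter> space lebesgue \<in> sets lebesgue"
    using f by (rule measurable_sets[rotated])
  then show "g -` B \<inter> space lebesgue \<in> sets lebesgue"
  proof (rule completion.in_sets_AE[rotated])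
    show "AE t in lebesgue. t \<in> f -` B \<inter> space lebesgue \<longleftrightarrow> t \<in> g -` B \<inter> space lebesgue"
      using eq by eventually_elim auto
  qed auto
qed simp

text \<open>The values attached to a fixed \<open>t\<close> are bounded only for almost every
  \<open>t\<close>, so both boundedness and the formula for \<open>g\<close> are required only up to
  a null set.\<close>

lemma borel_measurable_cSUP_AE:
  fixes F :: "'i \<Rightarrow> real \<Rightarrow> real"
  assumes "countable Y"
    and F: "\<And>i. i \<in> Y \<Longrightarrow> F i \<in> borel_measurable lebesgue"
    and bdd: "AE t in lebesgue. bdd_above ((\<lambda>i. F i t) ` Y)"
    and g: "AE t in lebesgue. g t = (SUP i\<in>Y. F i t)"
  shows "g \<in> borel_measurable lebesgue"
proof -
  obtain N where N: "{t \<in> space lebesgue. \<not> bdd_above ((\<lambda>i. F i t) ` Y)} \<subseteq> N" "N \<in> null_sets lebesgue"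
    using bdd by (auto simp: eventually_ae_filter)
  \<comment> \<open>Replacing the functions by 0 on the exceptional null set makes every supremum a
    genuine one without changing the result almost everywhere.\<close>
  let ?F = "\<lambda>i t. if t \<in> N then 0 else F i t"
  have [measurable]: "N \<in> sets lebesgue"
    using N by auto
  have "(\<lambda>t. SUP i\<in>Y. ?F i t) \<in> borel_measurable lebesgue"
  proof (rule borel_measurable_cSUP[OF \<open>countable Y\<close>])
    show "?F i \<in> borel_measurable lebesgue" if "i \<in> Y" for i
      using F[OF that] by measurable
    show "bdd_above ((\<lambda>i. ?F i t) ` Y)" for t
    proof (cases "t \<in> N")
      case True
      then show ?thesis by (auto intro: bdd_aboveI[of _ 0])
    next
      case False
      then show ?thesis using N by auto
    qed
  qed
  moreover have "AE t in lebesgue. (SUP i\<in>Y. ?F i t) = g t"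
    using AE_not_in[OF N(2)] g by eventually_elim simp
  ultimately show ?thesis
    by (rule borel_measurable_lebesgue_cong_AE)
qed

section \<open>Superpositions of Caratheodory maps\<close>

lemma l1norm_le_supnorm:
  assumes "x \<in> closure U" "\<And>x. x \<in> closure U \<Longrightarrow> l1norm (z x) \<le> c"
  shows "l1norm (z x) \<le> supnorm U z"
  unfolding supnorm_def using assms by (intro cSUP_upper bdd_aboveI2)

lemma CB_in_l1cball:
  "v \<in> CB U j (a, b) \<Longrightarrow> t \<in> {a..b} \<Longrightarrow> x \<in> closure U \<Longrightarrow> v t x \<in> l1cball j"
  unfolding CB_def by fastforce

lemma CB_l1norm_diff_le:
  assumes "v \<in> CB U j (a, b)" "t \<in> {a..b}" "t' \<in> {a..b}" "x \<in> closure U"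
  shows "l1norm (v t x - v t' x) \<le> supnorm U (\<lambda>x. v t x - v t' x)"
proof (rule l1norm_le_supnorm[OF assms(4)])
  fix x assume x: "x \<in> closure U"
  show "l1norm (v t x - v t' x) \<le> real j + real j"
    using CB_in_l1cball[OF assms(1,2) x] CB_in_l1cball[OF assms(1,3) x]
      l1norm_diff_le[of "v t x" "v t' x"] by (simp add: l1cball_def)
qed

lemma const_in_CB:
  assumes "U \<noteq> {}" "y \<in> l1cball j"
  shows "(\<lambda>_ _. y) \<in> CB U j (a, b)"
  using assms by (auto simp: CB_def supnorm_def)

lemma continuous_on_CB:
  assumes v: "v \<in> CB U j (a, b)" and x: "x \<in> closure U"
  shows "continuous_on {a..b} (\<lambda>t. v t x)"
  unfolding continuous_on_def
proof
  fix t0 assume t0: "t0 \<in> {a..b}"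
  have "((\<lambda>t. v t x - v t0 x) \<longlongrightarrow> 0) (at t0 within {a..b})"
  proof (rule Lim_null_comparison)
    show "\<forall>\<^sub>F t in at t0 within {a..b}. norm (v t x - v t0 x) \<le> supnorm U (\<lambda>x. v t x - v t0 x)"
      unfolding eventually_at_filter
    proof (intro always_eventually allI impI)
      fix t assume "t \<in> {a..b}"
      then show "norm (v t x - v t0 x) \<le> supnorm U (\<lambda>x. v t x - v t0 x)"
        using CB_l1norm_diff_le[OF v _ t0 x] norm_le_l1norm order_trans by blast
    qed
    show "((\<lambda>t. supnorm U (\<lambda>x. v t x - v t0 x)) \<longlongrightarrow> 0) (at t0 within {a..b})"
      using v t0 by (simp add: CB_def)
  qed
  then show "((\<lambda>t. v t x) \<longlongrightarrow> v t0 x) (at t0 within {a..b})"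
    by (simp add: LIM_zero_iff)
qed

lemma L1loc_set_integrable: "m \<in> L1loc \<Longrightarrow> set_integrable lebesgue {a..b} m"
  by (simp add: L1loc_def)

section \<open>Measurability and integrability along a path\<close>

lemma SC_maps_diff:
  assumes f: "f \<in> SC_maps U" and g: "g \<in> SC_maps U"
  shows "(\<lambda>t x y. f t x y - g t x y) \<in> SC_maps U"
proof -
  let ?M = "restrict_space borel (UNIV \<times> closure U \<times> UNIV)"
  have "(\<lambda>(t, x, y). f t x y - g t x y) \<in> borel_measurable ?M"
    unfolding case_prod_unfold
    using f g by (intro borel_measurable_diff) (simp_all add: SC_maps_def case_prod_unfold)
  moreover have "\<exists>m. m_bound U (\<lambda>t x y. f t x y - g t x y) K m" if K: "compact K" for K
  proof -
    obtain m n where m: "m_bound U f K m" and n: "m_bound U g K n"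
      using f g K unfolding SC_maps_def mem_Collect_eq by metis
    have "AE t in lebesgue. \<forall>x\<in>closure U. \<forall>y\<in>K. l1norm (f t x y) \<le> m t"
      "AE t in lebesgue. \<forall>x\<in>closure U. \<forall>y\<in>K. l1norm (g t x y) \<le> n t"
      using m n by (auto simp: m_bound_def)
    then have "AE t in lebesgue. \<forall>x\<in>closure U. \<forall>y\<in>K. l1norm (f t x y - g t x y) \<le> m t + n t"
      proof eventually_elim
      case (elim t)
      then show ?case
        using order_trans[OF l1norm_diff_le add_mono] by blast
    qed
    then have "m_bound U (\<lambda>t x y. f t x y - g t x y) K (\<lambda>t. m t + n t)"
      using m n by (auto simp: m_bound_def L1loc_def)
    then show ?thesis
      by (intro exI)
  qed
  moreover have "AE t in lebesgue. continuous_on (closure U \<times> UNIV) (\<lambda>(x, y). f t x y - g t x y)"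
  proof -
    have "AE t in lebesgue. continuous_on (closure U \<times> UNIV) (\<lambda>(x, y). f t x y)"
      "AE t in lebesgue. continuous_on (closure U \<times> UNIV) (\<lambda>(x, y). g t x y)"
      using f g by (auto simp: SC_maps_def)
    then show ?thesis
    proof eventually_elim
      case (elim t)
      show ?case
        using continuous_on_diff[OF elim] by (simp add: case_prod_unfold)
    qed
  qed
  ultimately show ?thesis
    by (simp add: SC_maps_def)
qed

lemma SC_maps_m_bound:
  assumes "f \<in> SC_maps U"
  obtains m where "m_bound U f (l1cball j) m"
proof -
  have "\<exists>m. m_bound U f (l1cball j) m"
    using assms compact_l1cball[of j] unfolding SC_maps_def mem_Collect_eq by metis
  then show ?thesis
    using that by blast
qed

lemma m_bound_CB_AE:
  assumes "m_bound U f (l1cball j) m" "v \<in> CB U j (a, b)"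
  shows "AE s in lebesgue. s \<in> {a..b} \<longrightarrow> (\<forall>x\<in>closure U. l1norm (f s x (v s x)) \<le> m s)"
proof -
  have "AE s in lebesgue. \<forall>x\<in>closure U. \<forall>y\<in>l1cball j. l1norm (f s x y) \<le> m s"
    using assms by (simp add: m_bound_def)
  then show ?thesis
    by eventually_elim (simp add: CB_in_l1cball[OF assms(2)])
qed

text \<open>For fixed \<open>x\<close> the curve \<open>s \<mapsto> (s, x, v s x)\<close> is
  continuous, hence Borel into the domain of \<open>f\<close>; joint Borel measurability of
  \<open>f\<close> then passes to the composition.\<close>

lemma set_borel_measurable_superposition:
  assumes f: "f \<in> SC_maps U" and v: "v \<in> CB U j (a, b)" and x: "x \<in> closure U"
  shows "set_borel_measurable lebesgue {a..b} (\<lambda>s. f s x (v s x))"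
proof -
  let ?M = "restrict_space borel (UNIV \<times> closure U \<times> UNIV)"
  have "(\<lambda>s. (s, x, v s x)) \<in> borel_measurable (restrict_space borel {a..b})"
    by (intro borel_measurable_continuous_on_restrict continuous_intros continuous_on_CB[OF v x])
  then have "(\<lambda>s. (s, x, v s x)) \<in> restrict_space borel {a..b} \<rightarrow>\<^sub>M ?M"
    using x by (intro measurable_restrict_space2) auto
  moreover have "(\<lambda>(t, x, y). f t x y) \<in> borel_measurable ?M"
    using f by (simp add: SC_maps_def)
  ultimately have "(\<lambda>s. f s x (v s x)) \<in> borel_measurable (restrict_space borel {a..b})"
    using measurable_compose[of "\<lambda>s. (s, x, v s x)" _ ?M "\<lambda>(t, x, y). f t x y" borel] by simp
  then have "(\<lambda>s. indicat_real {a..b} s *\<^sub>R f s x (v s x)) \<in> borel_measurable borel"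
    by (subst (asm) borel_measurable_restrict_space_iff) auto
  then show ?thesis
    unfolding set_borel_measurable_def by (intro measurable_completion) simp
qed

lemma set_integrable_superposition:
  assumes f: "f \<in> SC_maps U" and v: "v \<in> CB U j (a, b)" and x: "x \<in> closure U"
  shows "set_integrable lebesgue {a..b} (\<lambda>s. f s x (v s x))"
proof -
  obtain m where m: "m_bound U f (l1cball j) m"
    using SC_maps_m_bound[OF f] .
  show ?thesis
  proof (rule set_integrable_bound)
    show "set_integrable lebesgue {a..b} m"
      using m by (auto simp: m_bound_def intro: L1loc_set_integrable)
    show "set_borel_measurable lebesgue {a..b} (\<lambda>s. f s x (v s x))"
      using assms by (rule set_borel_measurable_superposition)
    show "AE s in lebesgue. s \<in> {a..b} \<longrightarrow> norm (f s x (v s x)) \<le> norm (m s)"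
      using m_bound_CB_AE[OF m v]
    proof eventually_elim
      case (elim s)
      show ?case
      proof
        assume "s \<in> {a..b}"
        then have "l1norm (f s x (v s x)) \<le> m s"
          using elim x by blast
        then show "norm (f s x (v s x)) \<le> norm (m s)"
          using norm_le_l1norm[of "f s x (v s x)"] by simp
      qed
    qed
  qed
qed

section \<open>Suprema over the space variable\<close>

lemma bdd_above_image_subset: "bdd_above (f ` B) \<Longrightarrow> A \<subseteq> B \<Longrightarrow> bdd_above (f ` A)"
  by (rule bdd_above_mono[OF _ image_mono])

text \<open>A continuous function that is at most \<open>c\<close> on \<open>Y\<close> is at most
  \<open>c\<close> on the closure of \<open>Y\<close>. With \<open>Y\<close> countable this turns a
  supremum over space into a countable one.\<close>

lemma SUP_dense_eq:
  fixes \<phi> :: "'a::topological_space \<Rightarrow> real"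
  assumes \<phi>: "continuous_on (closure Y) \<phi>" and "Y \<subseteq> X" "X \<subseteq> closure Y" "Y \<noteq> {}"
    and bdd: "bdd_above (\<phi> ` X)"
  shows "(SUP x\<in>X. \<phi> x) = (SUP x\<in>Y. \<phi> x)"
proof (rule antisym)
  have bddY: "bdd_above (\<phi> ` Y)"
    using bdd \<open>Y \<subseteq> X\<close> by (rule bdd_above_image_subset)
  show "(SUP x\<in>Y. \<phi> x) \<le> (SUP x\<in>X. \<phi> x)"
    by (rule cSUP_subset_mono[OF \<open>Y \<noteq> {}\<close> bdd \<open>Y \<subseteq> X\<close>]) (rule order_refl)
  show "(SUP x\<in>X. \<phi> x) \<le> (SUP x\<in>Y. \<phi> x)"
  proof (rule cSUP_least)
    show "X \<noteq> {}"
      using \<open>Y \<subseteq> X\<close> \<open>Y \<noteq> {}\<close> by blast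
    fix x assume "x \<in> X"
    then have "x \<in> closure Y"
      using \<open>X \<subseteq> closure Y\<close> by blast
    then show "\<phi> x \<le> (SUP x\<in>Y. \<phi> x)"
      by (rule continuous_le_on_closure[OF \<phi>]) (rule cSUP_upper[OF _ bddY])
  qed
qed

lemma continuous_on_superposition:
  assumes f: "continuous_on (closure U \<times> UNIV) (\<lambda>(x, y). f x y)" and v: "continuous_on (closure U) v"
  shows "continuous_on (closure U) (\<lambda>x. f x (v x))"
proof -
  have "continuous_on (closure U) (\<lambda>x. (x, v x))"
    using v by (intro continuous_intros)
  then show ?thesis
    using continuous_on_compose2[OF f, of "closure U" "\<lambda>x. (x, v x)"] by (simp add: image_subset_iff)
qed

lemma SC_maps_good_AE:
  assumes f: "f \<in> SC_maps U" and v: "v \<in> CB U j (a, b)"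
  shows "AE s in lebesgue. s \<in> {a..b} \<longrightarrow> continuous_on (closure U) (\<lambda>x. l1norm (f s x (v s x)))
     \<and> bdd_above ((\<lambda>x. l1norm (f s x (v s x))) ` closure U)"
proof -
  obtain m where m: "m_bound U f (l1cball j) m"
    using SC_maps_m_bound[OF f] .
  have "AE s in lebesgue. continuous_on (closure U \<times> UNIV) (\<lambda>(x, y). f s x y)"
    using f by (simp add: SC_maps_def)
  with m_bound_CB_AE[OF m v] show ?thesis
  proof eventually_elim
    case (elim s)
    show ?case
    proof
      assume s: "s \<in> {a..b}"
      then have "continuous_on (closure U) (v s)"
        using v by (simp add: CB_def)
      then have "continuous_on (closure U) (\<lambda>x. l1norm (f s x (v s x)))"
        by (intro continuous_on_l1norm continuous_on_superposition[OF elim(2)])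
      moreover have "l1norm (f s x (v s x)) \<le> m s" if "x \<in> closure U" for x
        using elim(1) s that by simp
      ultimately show "continuous_on (closure U) (\<lambda>x. l1norm (f s x (v s x)))
          \<and> bdd_above ((\<lambda>x. l1norm (f s x (v s x))) ` closure U)"
        by (intro conjI bdd_aboveI2)
    qed
  qed
qed

text \<open>A real supremum is an upper bound only where the values are bounded; an
  \<open>m\<close>-bound guarantees this for almost every \<open>s\<close>.\<close>

lemma SUP_upper_AE:
  assumes f: "f \<in> SC_maps U" and v: "v \<in> CB U j (a, b)" and X: "X \<subseteq> closure U"
  shows "AE s in lebesgue. s \<in> {a..b} \<longrightarrow>
    (\<forall>x\<in>X. l1norm (f s x (v s x)) \<le> (SUP x\<in>X. l1norm (f s x (v s x))))"
  using SC_maps_good_AE[OF f v]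
proof eventually_elim
  case (elim s)
  have "bdd_above ((\<lambda>x. l1norm (f s x (v s x))) ` X)" if "s \<in> {a..b}"
    using elim that by (intro bdd_above_image_subset[OF _ X]) simp
  then show ?case
    by (auto intro: cSUP_upper)
qed

text \<open>Measurability is the difficulty, as \<open>X\<close> may be uncountable. For almost
  every \<open>s\<close> the function of \<open>x\<close> is continuous and bounded, so the supremum
  agrees with the one over a countable dense \<open>Y\<close>. An \<open>m\<close>-bound on the ball
  containing the values of \<open>v\<close> dominates it.\<close>

lemma set_integrable_SUP_superposition:
  assumes f: "f \<in> SC_maps U" and v: "v \<in> CB U j (a, b)" and X: "X \<subseteq> closure U" "X \<noteq> {}"
  shows "set_integrable lebesgue {a..b} (\<lambda>s. SUP x\<in>X. l1norm (f s x (v s x)))"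
proof -
  let ?\<phi> = "\<lambda>s x. l1norm (f s x (v s x))"
  obtain m where m: "m_bound U f (l1cball j) m"
    using SC_maps_m_bound[OF f] .
  obtain Y where Y: "countable Y" "Y \<subseteq> X" "X \<subseteq> closure Y"
    using separable .
  then have "Y \<noteq> {}"
    using X by auto
  have YU: "closure Y \<subseteq> closure U"
    using Y(2) X(1) by (metis closure_closure closure_mono order_trans)
  note good = SC_maps_good_AE[OF f v]
  show ?thesis
  proof (rule set_integrable_bound)
    show "set_integrable lebesgue {a..b} m"
      using m by (auto simp: m_bound_def intro: L1loc_set_integrable)
    show "set_borel_measurable lebesgue {a..b} (\<lambda>s. SUP x\<in>X. ?\<phi> s x)"
      unfolding set_borel_measurable_def
    proof (rule borel_measurable_cSUP_AE[OF \<open>countable Y\<close>])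
      fix x assume "x \<in> Y"
      then have "x \<in> closure U"
        using Y X by auto
      then show "(\<lambda>s. indicat_real {a..b} s *\<^sub>R ?\<phi> s x) \<in> borel_measurable lebesgue"
        using set_integrable_l1norm[OF set_integrable_superposition[OF f v]]
        by (auto simp: set_integrable_def)
    next
      show "AE s in lebesgue. bdd_above ((\<lambda>x. indicat_real {a..b} s *\<^sub>R ?\<phi> s x) ` Y)"
        using good
      proof eventually_elim
        case (elim s)
        show ?case
        proof (cases "s \<in> {a..b}")
          case True
          then have "bdd_above (?\<phi> s ` closure U)"
            using elim by simp
          then have "bdd_above (?\<phi> s ` Y)"
            by (rule bdd_above_image_subset) (use Y X in blast)
          then show ?thesis
            using True by simp
        qed (auto intro: bdd_aboveI2[of _ _ 0])
      qed
      show "AE s in lebesgue. indicat_real {a..b} s *\<^sub>R (SUP x\<in>X. ?\<phi> s x)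
          = (SUP x\<in>Y. indicat_real {a..b} s *\<^sub>R ?\<phi> s x)"
        using good
      proof eventually_elim
        case (elim s)
        show ?case
        proof (cases "s \<in> {a..b}")
          case True
          then have "continuous_on (closure U) (?\<phi> s)" "bdd_above (?\<phi> s ` closure U)"
            using elim by simp_all
          note this(1)[THEN continuous_on_subset, OF YU] this(2)[THEN bdd_above_image_subset, OF X(1)]
          then have "(SUP x\<in>X. ?\<phi> s x) = (SUP x\<in>Y. ?\<phi> s x)"
            using Y \<open>Y \<noteq> {}\<close> by (intro SUP_dense_eq)
          then show ?thesis
            using True by simp
        qed (use \<open>Y \<noteq> {}\<close> in simp)
      qed
    qed
    show "AE s in lebesgue. s \<in> {a..b} \<longrightarrow> norm (SUP x\<in>X. ?\<phi> s x) \<le> norm (m s)"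
      using m_bound_CB_AE[OF m v]
    proof eventually_elim
      case (elim s)
      show ?case
      proof
        assume "s \<in> {a..b}"
        then have le: "?\<phi> s x \<le> m s" if "x \<in> X" for x
          using elim X that by blast
        \<comment> \<open>A member of \<open>X\<close> shows that the supremum is nonnegative, so
          the upper bound \<open>m s\<close> also controls its absolute value.\<close>
        obtain x where x: "x \<in> X"
          using X by blast
        have "(SUP x\<in>X. ?\<phi> s x) \<le> m s"
          using X le by (intro cSUP_least)
        moreover have "?\<phi> s x \<le> (SUP x\<in>X. ?\<phi> s x)"
          using x le by (intro cSUP_upper bdd_aboveI2)
        then have "0 \<le> (SUP x\<in>X. ?\<phi> s x)"
          using order_trans[OF l1norm_nonneg] by blast
        ultimately show "norm (SUP x\<in>X. ?\<phi> s x) \<le> norm (m s)"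
          by simp
      qed
    qed
  qed
qed

section \<open>Seminorms\<close>

abbreviation cdiff :: "('m::finite, 'n::finite) cmap \<Rightarrow> ('m, 'n) cmap \<Rightarrow> ('m, 'n) cmap" where
  "cdiff f g \<equiv> \<lambda>t x y. f t x y - g t x y"

text \<open>Every seminorm of the topologies is an instance of \<open>strong_sn\<close> or \<open>weak_sn\<close>: \<open>X\<close> is a point
  of \<open>D'\<close> or \<open>closure U\<close>, and \<open>V\<close> consists of a constant map or is one of \<open>HH\<close>, \<open>CB\<close>.\<close>

definition strong_int :: "(real ^ 'm) set \<Rightarrow> (real \<Rightarrow> real ^ 'm \<Rightarrow> real ^ 'n) \<Rightarrow> real \<Rightarrow> real
    \<Rightarrow> ('m::finite, 'n::finite) cmap \<Rightarrow> real" where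
  "strong_int X v a b f = (LINT s:{a..b}|lebesgue. SUP x\<in>X. l1norm (f s x (v s x)))"

definition strong_sn :: "(real ^ 'm) set \<Rightarrow> (real \<Rightarrow> real ^ 'm \<Rightarrow> real ^ 'n) set \<Rightarrow> real \<Rightarrow> real
    \<Rightarrow> ('m::finite, 'n::finite) cmap \<Rightarrow> real" where
  "strong_sn X V a b f = (SUP v\<in>V. strong_int X v a b f)"

definition weak_sn :: "(real ^ 'm) set \<Rightarrow> (real \<Rightarrow> real ^ 'm \<Rightarrow> real ^ 'n) set \<Rightarrow> real \<Rightarrow> real
    \<Rightarrow> ('m::finite, 'n::finite) cmap \<Rightarrow> real" where
  "weak_sn X V a b f = (SUP v\<in>V. SUP x\<in>X. l1norm (LINT s:{a..b}|lebesgue. f s x (v s x)))"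

text \<open>Reduces every strong estimate below to a pointwise one: it suffices to dominate the
  integrand for almost every \<open>s\<close>, uniformly in \<open>x\<close>, by an integrable
  function of \<open>s\<close>.\<close>

lemma strong_int_le:
  assumes "f \<in> SC_maps U" "v \<in> CB U j (a, b)" "X \<subseteq> closure U" "X \<noteq> {}"
    and g: "set_integrable lebesgue {a..b} g"
    and le: "AE s in lebesgue. s \<in> {a..b} \<longrightarrow> (\<forall>x\<in>X. l1norm (f s x (v s x)) \<le> g s)"
  shows "strong_int X v a b f \<le> (LINT s:{a..b}|lebesgue. g s)"
  unfolding strong_int_def
proof (rule set_integral_mono_AE[OF set_integrable_SUP_superposition[OF assms(1-4)] g])
  show "AE s\<in>{a..b} in lebesgue. (SUP x\<in>X. l1norm (f s x (v s x))) \<le> g s"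
    using le
  proof eventually_elim
    case (elim s)
    then show ?case
      using \<open>X \<noteq> {}\<close> by (auto intro!: cSUP_least)
  qed
qed

lemma strong_int_le_m_bound:
  assumes f: "f \<in> SC_maps U" and m: "m_bound U f (l1cball j) m" and v: "v \<in> CB U j (a, b)"
    and X: "X \<subseteq> closure U" "X \<noteq> {}"
  shows "strong_int X v a b f \<le> (LINT s:{a..b}|lebesgue. m s)"
proof (rule strong_int_le[OF f v X])
  show "set_integrable lebesgue {a..b} m"
    using m by (simp add: m_bound_def L1loc_set_integrable)
  show "AE s in lebesgue. s \<in> {a..b} \<longrightarrow> (\<forall>x\<in>X. l1norm (f s x (v s x)) \<le> m s)"
    using m_bound_CB_AE[OF m v] by eventually_elim (use X in blast)
qed

text \<open>Moving the norm inside the integral bounds the weak quantity by the strong one, and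
  thereby by the integral of an \<open>m\<close>-bound.\<close>

lemma l1norm_integral_le_strong_int:
  assumes f: "f \<in> SC_maps U" and v: "v \<in> CB U j (a, b)" and X: "X \<subseteq> closure U" "x \<in> X"
  shows "l1norm (LINT s:{a..b}|lebesgue. f s x (v s x)) \<le> strong_int X v a b f"
proof -
  have x: "x \<in> closure U" "X \<noteq> {}"
    using X by auto
  note int = set_integrable_superposition[OF f v x(1)]
  have "l1norm (LINT s:{a..b}|lebesgue. f s x (v s x)) \<le> (LINT s:{a..b}|lebesgue. l1norm (f s x (v s x)))"
    by (rule l1norm_set_integral_le[OF int])
  also have "\<dots> \<le> strong_int X v a b f"
    unfolding strong_int_def
  proof (rule set_integral_mono_AE[OF set_integrable_l1norm[OF int] set_integrable_SUP_superposition[OF f v X(1) x(2)]])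
    show "AE s\<in>{a..b} in lebesgue. l1norm (f s x (v s x)) \<le> (SUP x\<in>X. l1norm (f s x (v s x)))"
      using SUP_upper_AE[OF f v X(1)] by eventually_elim (use X(2) in blast)
  qed
  finally show ?thesis .
qed

lemma strong_sn_upper:
  assumes f: "f \<in> SC_maps U" and V: "V \<subseteq> CB U j (a, b)" "v \<in> V" and X: "X \<subseteq> closure U" "X \<noteq> {}"
  shows "strong_int X v a b f \<le> strong_sn X V a b f"
proof -
  obtain m where m: "m_bound U f (l1cball j) m"
    using SC_maps_m_bound[OF f] .
  show ?thesis
    unfolding strong_sn_def
  proof (rule cSUP_upper[OF V(2) bdd_aboveI2])
    fix v assume "v \<in> V"
    then have "v \<in> CB U j (a, b)"
      using V by blast
    then show "strong_int X v a b f \<le> (LINT s:{a..b}|lebesgue. m s)"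
      by (rule strong_int_le_m_bound[OF f m _ X])
  qed
qed

text \<open>A single constant serves all \<open>v\<close> and \<open>x\<close>, namely the integral
  of an \<open>m\<close>-bound. This is what makes both nested suprema in \<open>weak_sn\<close>
  suprema of bounded sets.\<close>

lemma weak_sn_bound:
  fixes f :: "('m::finite, 'n::finite) cmap"
  assumes f: "f \<in> SC_maps U" and X: "X \<subseteq> closure U"
  obtains c where "\<And>v x. v \<in> CB U j (a, b) \<Longrightarrow> x \<in> X \<Longrightarrow>
    l1norm (LINT s:{a..b}|lebesgue. f s x (v s x)) \<le> c"
proof -
  obtain m where m: "m_bound U f (l1cball j) m"
    using SC_maps_m_bound[OF f] .
  show ?thesis
  proof (rule that)
    fix v :: "real \<Rightarrow> real ^ 'm \<Rightarrow> real ^ 'n" and x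
    assume v: "v \<in> CB U j (a, b)" and x: "x \<in> X"
    then have "X \<noteq> {}"
      by blast
    then show "l1norm (LINT s:{a..b}|lebesgue. f s x (v s x)) \<le> (LINT s:{a..b}|lebesgue. m s)"
      using l1norm_integral_le_strong_int[OF f v X x] strong_int_le_m_bound[OF f m v X] by linarith
  qed
qed

lemma weak_sn_upper:
  assumes f: "f \<in> SC_maps U" and V: "V \<subseteq> CB U j (a, b)" "v \<in> V" and X: "X \<subseteq> closure U" "x \<in> X"
  shows "l1norm (LINT s:{a..b}|lebesgue. f s x (v s x)) \<le> weak_sn X V a b f"
proof -
  obtain c where c: "\<And>v x. v \<in> CB U j (a, b) \<Longrightarrow> x \<in> X \<Longrightarrow>
    l1norm (LINT s:{a..b}|lebesgue. f s x (v s x)) \<le> c"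
    using weak_sn_bound[OF f X(1)] by metis
  have "l1norm (LINT s:{a..b}|lebesgue. f s x (v s x))
      \<le> (SUP x\<in>X. l1norm (LINT s:{a..b}|lebesgue. f s x (v s x)))"
    by (rule cSUP_upper[OF X(2) bdd_aboveI2], rule c) (use V in blast)+
  also have "\<dots> \<le> weak_sn X V a b f"
    unfolding weak_sn_def
    by (rule cSUP_upper[OF V(2) bdd_aboveI2], rule cSUP_least) (use V X c in blast)+
  finally show ?thesis .
qed

lemma strong_sn_least:
  assumes "V \<noteq> {}" "\<And>v. v \<in> V \<Longrightarrow> strong_int X v a b f \<le> c"
  shows "strong_sn X V a b f \<le> c"
  unfolding strong_sn_def using assms by (rule cSUP_least)

lemma weak_sn_least:
  assumes "V \<noteq> {}" "X \<noteq> {}"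
    "\<And>v x. v \<in> V \<Longrightarrow> x \<in> X \<Longrightarrow> l1norm (LINT s:{a..b}|lebesgue. f s x (v s x)) \<le> c"
  shows "weak_sn X V a b f \<le> c"
  unfolding weak_sn_def by (intro cSUP_least assms)

text \<open>Provides the cheap direction of the strong comparisons: one enlarges either the set of
  points or the set of paths. Boundedness over the larger sets comes from \<open>f\<close> being a
  Caratheodory map.\<close>

lemma strong_sn_mono:
  assumes f: "f \<in> SC_maps U" and V: "V \<noteq> {}" "V \<subseteq> V'" "V' \<subseteq> CB U j (a, b)"
    and X: "X \<noteq> {}" "X \<subseteq> X'" "X' \<subseteq> closure U"
  shows "strong_sn X V a b f \<le> strong_sn X' V' a b f"
proof (rule strong_sn_least[OF V(1)])
  fix v assume "v \<in> V"
  then have v: "v \<in> V'" "v \<in> CB U j (a, b)"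
    using V by auto
  have X'_ne: "X' \<noteq> {}"
    using X by auto
  have "strong_int X v a b f \<le> strong_int X' v a b f"
    unfolding strong_int_def[of X']
  proof (rule strong_int_le[OF f v(2) order_trans[OF X(2,3)] X(1) set_integrable_SUP_superposition[OF f v(2) X(3) X'_ne]])
    show "AE s in lebesgue. s \<in> {a..b} \<longrightarrow>
        (\<forall>x\<in>X. l1norm (f s x (v s x)) \<le> (SUP x\<in>X'. l1norm (f s x (v s x))))"
      using SUP_upper_AE[OF f v(2) X(3)] by eventually_elim (use X(2) in blast)
  qed
  also have "\<dots> \<le> strong_sn X' V' a b f"
    by (rule strong_sn_upper[OF f V(3) v(1) X(3) X'_ne])
  finally show "strong_int X v a b f \<le> strong_sn X' V' a b f" .
qed

lemma weak_sn_mono: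
  assumes f: "f \<in> SC_maps U" and V: "V \<noteq> {}" "V \<subseteq> V'" "V' \<subseteq> CB U j (a, b)"
    and X: "X \<noteq> {}" "X \<subseteq> X'" "X' \<subseteq> closure U"
  shows "weak_sn X V a b f \<le> weak_sn X' V' a b f"
proof (rule weak_sn_least[OF V(1) X(1)])
  fix v x assume "v \<in> V" "x \<in> X"
  then have "v \<in> V'" "x \<in> X'"
    using V(2) X(2) by auto
  then show "l1norm (LINT s:{a..b}|lebesgue. f s x (v s x)) \<le> weak_sn X' V' a b f"
    by (rule weak_sn_upper[OF f V(3) _ X(3)])
qed

text \<open>Stated for differences of three maps, the form in which a ball around one representative
  is compared with a ball around another.\<close>

lemma strong_sn_triangle:
  assumes f: "f \<in> SC_maps U" and g: "g \<in> SC_maps U" and h: "h \<in> SC_maps U"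
    and V: "V \<noteq> {}" "V \<subseteq> CB U j (a, b)" and X: "X \<subseteq> closure U" "X \<noteq> {}"
  shows "strong_sn X V a b (cdiff f h) \<le> strong_sn X V a b (cdiff f g) + strong_sn X V a b (cdiff g h)"
proof (rule strong_sn_least[OF V(1)])
  fix v assume v: "v \<in> V"
  then have vCB: "v \<in> CB U j (a, b)"
    using V by auto
  note d = SC_maps_diff[OF f h] SC_maps_diff[OF f g] SC_maps_diff[OF g h]
  note int = set_integrable_SUP_superposition[OF d(2) vCB X] set_integrable_SUP_superposition[OF d(3) vCB X]
  have "strong_int X v a b (cdiff f h) \<le> (LINT s:{a..b}|lebesgue.
      (SUP x\<in>X. l1norm (cdiff f g s x (v s x))) + (SUP x\<in>X. l1norm (cdiff g h s x (v s x))))"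
  proof (rule strong_int_le[OF d(1) vCB X set_integral_add(1)[OF int]])
    show "AE s in lebesgue. s \<in> {a..b} \<longrightarrow> (\<forall>x\<in>X. l1norm (f s x (v s x) - h s x (v s x)) \<le>
      (SUP x\<in>X. l1norm (cdiff f g s x (v s x))) + (SUP x\<in>X. l1norm (cdiff g h s x (v s x))))"
      using SUP_upper_AE[OF d(2) vCB X(1)] SUP_upper_AE[OF d(3) vCB X(1)]
    proof eventually_elim
      case (elim s)
      show ?case
      proof (intro impI ballI)
        fix x assume "s \<in> {a..b}" "x \<in> X"
        then show "l1norm (f s x (v s x) - h s x (v s x)) \<le>
          (SUP x\<in>X. l1norm (cdiff f g s x (v s x))) + (SUP x\<in>X. l1norm (cdiff g h s x (v s x)))"
          using elim by (intro order_trans[OF l1norm_triangle_diff[of _ _ "g s x (v s x)"]] add_mono) simp_all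
      qed
    qed
  qed
  also have "\<dots> = strong_int X v a b (cdiff f g) + strong_int X v a b (cdiff g h)"
    unfolding strong_int_def by (rule set_integral_add(2)[OF int])
  also have "\<dots> \<le> strong_sn X V a b (cdiff f g) + strong_sn X V a b (cdiff g h)"
    by (intro add_mono strong_sn_upper[OF _ V(2) v X] d)
  finally show "strong_int X v a b (cdiff f h) \<le> strong_sn X V a b (cdiff f g) + strong_sn X V a b (cdiff g h)" .
qed

lemma weak_sn_triangle:
  assumes f: "f \<in> SC_maps U" and g: "g \<in> SC_maps U" and h: "h \<in> SC_maps U"
    and V: "V \<noteq> {}" "V \<subseteq> CB U j (a, b)" and X: "X \<subseteq> closure U" "X \<noteq> {}"
  shows "weak_sn X V a b (cdiff f h) \<le> weak_sn X V a b (cdiff f g) + weak_sn X V a b (cdiff g h)"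
proof (rule weak_sn_least[OF V(1) X(2)])
  fix v x assume v: "v \<in> V" and x: "x \<in> X"
  then have vCB: "v \<in> CB U j (a, b)" and xU: "x \<in> closure U"
    using V X by auto
  note d = SC_maps_diff[OF f g] SC_maps_diff[OF g h]
  let ?I = "\<lambda>f. LINT s:{a..b}|lebesgue. f s x (v s x)"
  have "?I (cdiff f h) = (LINT s:{a..b}|lebesgue. cdiff f g s x (v s x) + cdiff g h s x (v s x))"
    by simp
  also have "\<dots> = ?I (cdiff f g) + ?I (cdiff g h)"
    by (intro set_integral_add(2) set_integrable_superposition[OF _ vCB xU] d)
  finally have "l1norm (?I (cdiff f h)) \<le> l1norm (?I (cdiff f g)) + l1norm (?I (cdiff g h))"
    by (simp only: l1norm_triangle)
  also have "\<dots> \<le> weak_sn X V a b (cdiff f g) + weak_sn X V a b (cdiff g h)"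
    by (intro add_mono weak_sn_upper[OF _ V(2) v X(1) x] d)
  finally show "l1norm (?I (cdiff f h)) \<le> weak_sn X V a b (cdiff f g) + weak_sn X V a b (cdiff g h)" .
qed

lemma strong_sn_zero: "V \<noteq> {} \<Longrightarrow> X \<noteq> {} \<Longrightarrow> strong_sn X V a b (\<lambda>_ _ _. 0) = 0"
  by (simp add: strong_sn_def strong_int_def)

lemma weak_sn_zero: "V \<noteq> {} \<Longrightarrow> X \<noteq> {} \<Longrightarrow> weak_sn X V a b (\<lambda>_ _ _. 0) = 0"
  by (simp add: weak_sn_def)

section \<open>Comparison of seminorm topologies\<close>

lemma topspace_seminorm_topology: "topspace (seminorm_topology U P) = SC U"
  unfolding seminorm_topology_def topology_generated_by_topspace by auto

lemma rep_SC_maps: "F \<in> SC U \<Longrightarrow> rep F \<in> SC_maps U"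
  using rep_in_class[of F U] in_quotient_imp_subset[OF equiv_SC_rel, of F U] by (auto simp: SC_def)

lemma openin_seminorm_ball:
  assumes "p \<in> P" "F \<in> SC U" "0 < \<epsilon>"
  shows "openin (seminorm_topology U P) {G \<in> SC U. p (cdiff (rep G) (rep F)) < \<epsilon>}"
  unfolding seminorm_topology_def
  by (rule topology_generated_by_Basis) (use assms in blast)

text \<open>The subbasic balls may be centred at any class of \<open>SC U\<close>, whereas control
  is available only between members of \<open>E\<close>. For a point \<open>G\<close> of
  \<open>E\<close> in such a ball, the triangle inequality recentres at \<open>G\<close> with the
  remaining radius; control at \<open>G\<close> then gives a neighbourhood for the other family. In
  this way every generating set is open relative to \<open>E\<close>, that is, the identity is
  continuous.\<close>

lemma openin_seminorm_topology_transfer: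
  fixes P Q :: "(('m::finite, 'n::finite) cmap \<Rightarrow> real) set"
  assumes E: "E \<subseteq> SC U"
    and triangle: "\<And>p f g h. p \<in> P \<Longrightarrow> f \<in> SC_maps U \<Longrightarrow> g \<in> SC_maps U \<Longrightarrow> h \<in> SC_maps U \<Longrightarrow>
      p (cdiff f h) \<le> p (cdiff f g) + p (cdiff g h)"
    and zero: "\<And>q. q \<in> Q \<Longrightarrow> q (\<lambda>_ _ _. 0) = 0"
    and control: "\<And>p F \<epsilon>. p \<in> P \<Longrightarrow> F \<in> E \<Longrightarrow> 0 < \<epsilon> \<Longrightarrow> \<exists>Q0 \<delta>. finite Q0 \<and> Q0 \<subseteq> Q \<and> 0 < \<delta> \<and>
      (\<forall>G\<in>E. (\<forall>q\<in>Q0. q (cdiff (rep G) (rep F)) < \<delta>) \<longrightarrow> p (cdiff (rep G) (rep F)) < \<epsilon>)"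
    and W: "openin (subtopology (seminorm_topology U P) E) W"
  shows "openin (subtopology (seminorm_topology U Q) E) W"
proof -
  let ?TQ = "subtopology (seminorm_topology U Q) E"
  have top: "topspace ?TQ = E"
    using E by (auto simp: topspace_seminorm_topology)
  have "continuous_map ?TQ (seminorm_topology U P) id"
    unfolding seminorm_topology_def[of U P] continuous_on_generated_topo_iff
  proof (intro conjI allI impI)
    fix B assume "B \<in> insert (SC U)
     {{G \<in> SC U. p (\<lambda>t x y. rep G t x y - rep F t x y) < \<epsilon>} | p F \<epsilon>. p \<in> P \<and> F \<in> SC U \<and> 0 < \<epsilon>}"
    then consider "B = SC U"
      | p F \<epsilon> where "p \<in> P" "F \<in> SC U" "0 < \<epsilon>" "B = {G \<in> SC U. p (cdiff (rep G) (rep F)) < \<epsilon>}"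
      by auto
    then show "openin ?TQ (id -` B \<inter> topspace ?TQ)"
    proof cases
      case 1
      then have "id -` B \<inter> topspace ?TQ = topspace ?TQ"
        using top E by auto
      then show ?thesis
        by (simp only: openin_topspace)
    next
      case B: 2
      show ?thesis
      proof (subst openin_subopen, intro ballI)
        fix G assume "G \<in> id -` B \<inter> topspace ?TQ"
        then have G: "G \<in> E" "G \<in> SC U" "p (cdiff (rep G) (rep F)) < \<epsilon>"
          using top B E by auto
        then have "0 < \<epsilon> - p (cdiff (rep G) (rep F))"
          by simp
        from control[OF \<open>p \<in> P\<close> \<open>G \<in> E\<close> this] obtain Q0 \<delta> where
          Q0: "finite Q0" "Q0 \<subseteq> Q" "0 < \<delta>" and
          ctl: "\<forall>H\<in>E. (\<forall>q\<in>Q0. q (cdiff (rep H) (rep G)) < \<delta>) \<longrightarrow>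
            p (cdiff (rep H) (rep G)) < \<epsilon> - p (cdiff (rep G) (rep F))"
          by (elim exE conjE)
        \<comment> \<open>\<open>Q0\<close> may be empty, and the intersection is then everything;
          intersecting with the whole space keeps the set open in that case too.\<close>
        let ?N = "\<Inter>q\<in>Q0. {H \<in> SC U. q (cdiff (rep H) (rep G)) < \<delta>}"
        let ?T = "E \<inter> (topspace (seminorm_topology U Q) \<inter> ?N)"
        have "openin (seminorm_topology U Q) (topspace (seminorm_topology U Q) \<inter> ?N)"
          using Q0 G by (intro openin_Int_Inter) (auto intro!: openin_seminorm_ball)
        then have "openin ?TQ ?T"
          by (simp add: openin_subtopology_Int2)
        \<comment> \<open>Places the centre \<open>G\<close> in the neighbourhood: its difference
          with itself is the zero map.\<close>
        moreover have "\<forall>q\<in>Q0. q (\<lambda>_ _ _. 0) < \<delta>"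
          using zero Q0(2,3) by (metis subsetD)
        then have "G \<in> ?T"
          using G by (simp add: topspace_seminorm_topology)
        moreover have "?T \<subseteq> id -` B \<inter> topspace ?TQ"
        proof
          fix H assume H: "H \<in> ?T"
          then have HE: "H \<in> E" "H \<in> SC U"
            using E by auto
          have "p (cdiff (rep H) (rep G)) < \<epsilon> - p (cdiff (rep G) (rep F))"
            using H by (intro ctl[rule_format] HE) simp
          moreover have "p (cdiff (rep H) (rep F)) \<le> p (cdiff (rep H) (rep G)) + p (cdiff (rep G) (rep F))"
            using HE G B by (intro triangle rep_SC_maps)
          ultimately show "H \<in> id -` B \<inter> topspace ?TQ"
            using HE B top by simp
        qed
        ultimately show "\<exists>T. openin ?TQ T \<and> G \<in> T \<and> T \<subseteq> id -` B \<inter> topspace ?TQ"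
          by blast
      qed
    qed
  next
    show "id ` topspace ?TQ \<subseteq> \<Union> (insert (SC U)
     {{G \<in> SC U. p (\<lambda>t x y. rep G t x y - rep F t x y) < \<epsilon>} | p F \<epsilon>. p \<in> P \<and> F \<in> SC U \<and> 0 < \<epsilon>})"
      using E top by auto
  qed
  moreover obtain T where "openin (seminorm_topology U P) T" "W = T \<inter> E"
    using W by (auto simp: openin_subtopology)
  ultimately have "openin ?TQ {G \<in> topspace ?TQ. id G \<in> T}"
    by (intro openin_continuous_map_preimage)
  moreover have "{G \<in> topspace ?TQ. id G \<in> T} = W"
    using \<open>W = T \<inter> E\<close> top by auto
  ultimately show ?thesis
    by simp
qed

text \<open>Closure in a subspace is the trace of the closure, so whether a given \<open>G\<close>
  adheres to \<open>E\<close> is decided by the topology induced on \<open>insert G E\<close>. No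
  comparison of the topologies on all of \<open>L\<close> is required.\<close>

lemma agree_on_insert_imp_cls_eq:
  assumes "E \<subseteq> L" "\<And>G. G \<in> L \<Longrightarrow> subtopology T1 (insert G E) = subtopology T2 (insert G E)"
  shows "cls L T1 E = cls L T2 E"
proof -
  have "G \<in> cls L T E \<longleftrightarrow> G \<in> L \<and> G \<in> subtopology T (insert G E) closure_of E" for G T
    using \<open>E \<subseteq> L\<close> by (auto simp: cls_def closure_of_subtopology Int_absorb1 insert_absorb subset_insertI)
  then show ?thesis
    using assms(2) by auto
qed

section \<open>Control of the finer seminorms\<close>

text \<open>The bound of a class may vary with the interval here, whereas
  \<open>L1loc_bounded\<close> fixes one set \<open>S\<close> for all radii; similarly for
  \<open>m_equicontinuous\<close>, where it may also vary with \<open>\<epsilon>\<close>. In this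
  form adjoining a class only changes a constant or a radius.\<close>

definition l_bounded :: "(real ^ 'm) set \<Rightarrow> ('m::finite, 'n::finite) cmap set set \<Rightarrow> bool" where
  "l_bounded U E \<longleftrightarrow> (\<forall>j\<ge>1. \<forall>a b. \<exists>c\<ge>0. \<forall>F\<in>E. \<exists>l.
     l_bound U (rep F) (l1cball j) l \<and> (LINT t:{a..b}|lebesgue. l t) \<le> c)"

definition m_equicontinuous :: "(real ^ 'm) set \<Rightarrow> ('m::finite, 'n::finite) cmap set set \<Rightarrow> bool" where
  "m_equicontinuous U E \<longleftrightarrow> (\<forall>j\<ge>1. \<forall>a b. \<forall>\<epsilon>>0. \<exists>\<delta>>0. \<forall>F\<in>E. \<exists>m. m_bound U (rep F) (l1cball j) m \<and>
     (\<forall>t1 t2. a \<le> t1 \<and> t1 \<le> t2 \<and> t2 \<le> b \<and> t2 - t1 < \<delta> \<longrightarrow> (LINT t:{t1..t2}|lebesgue. m t) < \<epsilon>))"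

text \<open>Oscillation in \<open>x\<close> that is small in \<open>L\<^sup>1\<close>, uniformly on the family. Unlike \<open>l_bound_wrt \<theta>\<close> with
  a fixed modulus \<open>\<theta>\<close>, this holds for every single Caratheodory map, so it survives adding to \<open>E\<close>
  a point of its closure.\<close>

definition x_equicontinuous :: "(real ^ 'm) set \<Rightarrow> ('m::finite, 'n::finite) cmap set set \<Rightarrow> bool" where
  "x_equicontinuous U E \<longleftrightarrow> (\<forall>y a b. \<forall>\<epsilon>>0. \<exists>\<delta>>0. \<forall>F\<in>E. \<exists>w.
     set_integrable lebesgue {a..b} w \<and> (LINT t:{a..b}|lebesgue. w t) \<le> \<epsilon> \<and>
     (AE t in lebesgue. t \<in> {a..b} \<longrightarrow> (\<forall>x1\<in>closure U. \<forall>x2\<in>closure U. l1norm (x1 - x2) < \<delta> \<longrightarrow>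
        l1norm (rep F t x1 y - rep F t x2 y) \<le> w t)))"

lemma set_integral_sum:
  fixes h :: "'i \<Rightarrow> real \<Rightarrow> real"
  assumes "\<And>i. i \<in> I \<Longrightarrow> set_integrable M A (h i)"
  shows "set_integrable M A (\<lambda>s. \<Sum>i\<in>I. h i s)"
    and "(LINT s:A|M. \<Sum>i\<in>I. h i s) = (\<Sum>i\<in>I. LINT s:A|M. h i s)"
proof -
  show "set_integrable M A (\<lambda>s. \<Sum>i\<in>I. h i s)"
    using assms unfolding set_integrable_def scaleR_sum_right
    by (intro Bochner_Integration.integrable_sum)
  show "(LINT s:A|M. \<Sum>i\<in>I. h i s) = (\<Sum>i\<in>I. LINT s:A|M. h i s)"
    using assms unfolding set_integrable_def set_lebesgue_integral_def scaleR_sum_right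
    by (intro Bochner_Integration.integral_sum)
qed

section \<open>Bounds for differences of two classes\<close>

lemma l_bound_cdiff:
  assumes f: "l_bound U f K k" and g: "l_bound U g K l"
  shows "l_bound U (cdiff f g) K (\<lambda>t. k t + l t)"
proof -
  have "AE t in lebesgue. \<forall>x\<in>closure U. \<forall>y1\<in>K. \<forall>y2\<in>K. l1norm (f t x y1 - f t x y2) \<le> k t * l1norm (y1 - y2)"
    "AE t in lebesgue. \<forall>x\<in>closure U. \<forall>y1\<in>K. \<forall>y2\<in>K. l1norm (g t x y1 - g t x y2) \<le> l t * l1norm (y1 - y2)"
    using f g by (auto simp: l_bound_def)
  then have "AE t in lebesgue. \<forall>x\<in>closure U. \<forall>y1\<in>K. \<forall>y2\<in>K.
      l1norm (cdiff f g t x y1 - cdiff f g t x y2) \<le> (k t + l t) * l1norm (y1 - y2)"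
  proof eventually_elim
    case (elim t)
    show ?case
    proof (intro ballI)
      fix x y1 y2 assume *: "x \<in> closure U" "y1 \<in> K" "y2 \<in> K"
      have "cdiff f g t x y1 - cdiff f g t x y2 = (f t x y1 - f t x y2) - (g t x y1 - g t x y2)"
        by simp
      then have "l1norm (cdiff f g t x y1 - cdiff f g t x y2)
          \<le> l1norm (f t x y1 - f t x y2) + l1norm (g t x y1 - g t x y2)"
        using l1norm_diff_le[of "f t x y1 - f t x y2" "g t x y1 - g t x y2"] by (simp only:)
      also have "\<dots> \<le> k t * l1norm (y1 - y2) + l t * l1norm (y1 - y2)"
        using elim * by (intro add_mono) blast+
      finally show "l1norm (cdiff f g t x y1 - cdiff f g t x y2) \<le> (k t + l t) * l1norm (y1 - y2)"
        by (simp add: distrib_right)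
    qed
  qed
  then show ?thesis
    using f g by (simp add: l_bound_def L1loc_def)
qed

lemma m_bound_cdiff:
  assumes f: "m_bound U f K k" and g: "m_bound U g K m"
  shows "m_bound U (cdiff f g) K (\<lambda>t. k t + m t)"
proof -
  have "AE t in lebesgue. \<forall>x\<in>closure U. \<forall>y\<in>K. l1norm (f t x y) \<le> k t"
    "AE t in lebesgue. \<forall>x\<in>closure U. \<forall>y\<in>K. l1norm (g t x y) \<le> m t"
    using f g by (auto simp: m_bound_def)
  then have "AE t in lebesgue. \<forall>x\<in>closure U. \<forall>y\<in>K. l1norm (f t x y - g t x y) \<le> k t + m t"
  proof eventually_elim
    case (elim t)
    then show ?case
      using order_trans[OF l1norm_diff_le add_mono] by blast
  qed
  then show ?thesis
    using f g by (simp add: m_bound_def L1loc_def)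
qed

lemma LC_imp_SC: "F \<in> LC U \<Longrightarrow> F \<in> SC U"
  by (simp add: LC_def)

text \<open>The balls measure differences, whose \<open>l\<close>-bound is the sum of two; the
  constant is thus twice that of the family and does not depend on the pair.\<close>

lemma l_bounded_cdiff:
  assumes "l_bounded U E" "1 \<le> j"
  obtains c where "0 \<le> c" "\<And>F G. F \<in> E \<Longrightarrow> G \<in> E \<Longrightarrow> \<exists>l.
    l_bound U (cdiff (rep G) (rep F)) (l1cball j) l \<and> (LINT t:{a..b}|lebesgue. l t) \<le> c"
proof -
  obtain c where c: "0 \<le> c" "\<forall>F\<in>E. \<exists>l.
     l_bound U (rep F) (l1cball j) l \<and> (LINT t:{a..b}|lebesgue. l t) \<le> c"
    using assms unfolding l_bounded_def by metis
  show ?thesis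
  proof (rule that)
    show "0 \<le> 2 * c"
      using c by simp
    fix F G assume "F \<in> E" "G \<in> E"
    then obtain k l where kl: "l_bound U (rep F) (l1cball j) k" "(LINT t:{a..b}|lebesgue. k t) \<le> c"
      "l_bound U (rep G) (l1cball j) l" "(LINT t:{a..b}|lebesgue. l t) \<le> c"
      using c(2) by metis
    have "set_integrable lebesgue {a..b} k" "set_integrable lebesgue {a..b} l"
      using kl by (simp_all add: l_bound_def L1loc_set_integrable)
    then have "(LINT t:{a..b}|lebesgue. l t + k t) \<le> 2 * c"
      using kl by simp
    then show "\<exists>l. l_bound U (cdiff (rep G) (rep F)) (l1cball j) l \<and> (LINT t:{a..b}|lebesgue. l t) \<le> 2 * c"
      using l_bound_cdiff[OF kl(3,1)] by (intro exI conjI)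
  qed
qed

text \<open>Points of \<open>D\<close> near the boundary of the ball may lie outside it, but those
  closer than 1 stay in the ball of radius \<open>Suc j\<close>. The \<open>l\<close>-bounds are
  therefore taken on that larger ball, where they compare a value of \<open>v\<close> with its net
  point.\<close>

lemma finite_net_l1cball:
  fixes D :: "(real ^ 'k) set"
  assumes D: "closure D = UNIV" and \<rho>: "0 < \<rho>" "\<rho> \<le> 1"
  shows "\<exists>Y. finite Y \<and> Y \<subseteq> D \<and> Y \<subseteq> l1cball (Suc j) \<and> (\<forall>z\<in>l1cball j. \<exists>y\<in>Y. l1norm (z - y) < \<rho>)"
proof -
  have cl: "(l1cball j :: (real ^ 'k) set) \<subseteq> closure D"
    using D by simp
  obtain Z where Z: "finite Z" "Z \<subseteq> D" "\<forall>z\<in>l1cball j. \<exists>y\<in>Z. l1norm (z - y) < \<rho>"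
    using finite_l1norm_net[OF compact_l1cball cl \<rho>(1)] by (elim exE conjE)
  have "\<exists>y\<in>Z \<inter> l1cball (Suc j). l1norm (z - y) < \<rho>" if z: "z \<in> l1cball j" for z
  proof -
    obtain y where y: "y \<in> Z" "l1norm (z - y) < \<rho>"
      using bspec[OF Z(3) z] by blast
    have "l1norm y \<le> l1norm (y - z) + l1norm z"
      using l1norm_triangle[of "y - z" z] by simp
    then have "y \<in> l1cball (Suc j)"
      using y(2) z \<rho>(2) l1norm_minus_commute[of y z] by (simp add: l1cball_def)
    then show ?thesis
      using y by blast
  qed
  then show ?thesis
    using Z(1,2) by (intro exI[of _ "Z \<inter> l1cball (Suc j)"]) auto
qed

text \<open>At each \<open>s\<close> and \<open>x\<close> the value \<open>v s x\<close> has a net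
  point within \<open>\<rho>\<close>. Summing the suprema of \<open>d\<close> over all net points
  dominates the contribution of the chosen one, so no measurable selection is made, and the
  replacement adds at most \<open>\<rho>\<close> times an \<open>l\<close>-bound. The resulting
  dominating function does not involve \<open>v\<close>, which makes the estimate uniform over
  \<open>CB\<close>.\<close>

lemma strong_sn_CB_control:
  fixes E :: "('m::finite, 'n::finite) cmap set set"
  assumes U: "U \<noteq> {}" and D: "closure D = UNIV" and E: "E \<subseteq> LC U" "l_bounded U E"
    and F: "F \<in> E" and "0 < \<epsilon>" "1 \<le> j"
  shows "\<exists>Y \<delta>. finite Y \<and> Y \<subseteq> D \<and> 0 < \<delta> \<and> (\<forall>G\<in>E.
    (\<forall>y\<in>Y. strong_sn (closure U) {\<lambda>_ _. y} a b (cdiff (rep G) (rep F)) < \<delta>) \<longrightarrow>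
    strong_sn (closure U) (CB U j (a, b)) a b (cdiff (rep G) (rep F)) < \<epsilon>)"
proof -
  obtain c where c: "0 \<le> c" "\<And>F G. F \<in> E \<Longrightarrow> G \<in> E \<Longrightarrow> \<exists>l.
      l_bound U (cdiff (rep G) (rep F)) (l1cball (Suc j)) l \<and> (LINT t:{a..b}|lebesgue. l t) \<le> c"
    by (rule l_bounded_cdiff[OF E(2), of "Suc j" a b]) auto
  \<comment> \<open>The cap 1 keeps the net in the ball of radius \<open>Suc j\<close>; the other
    term makes the Lipschitz error at most \<open>\<epsilon> / 2\<close>, with \<open>c + 1\<close>
    in place of \<open>c\<close> because \<open>c\<close> may be 0.\<close>
  define \<rho> where "\<rho> = min 1 (\<epsilon> / (2 * (c + 1)))"
  have \<rho>: "0 < \<rho>" "\<rho> \<le> 1" "\<rho> \<le> \<epsilon> / (2 * (c + 1))"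
    using c(1) \<open>0 < \<epsilon>\<close> by (auto simp: \<rho>_def)
  have "\<rho> * c \<le> \<epsilon> / (2 * (c + 1)) * c"
    using \<rho>(3) c(1) by (rule mult_right_mono)
  also have "\<dots> \<le> \<epsilon> / 2"
    using c(1) \<open>0 < \<epsilon>\<close> by (simp add: field_simps)
  finally have \<rho>c: "\<rho> * c \<le> \<epsilon> / 2" .
  obtain Y where Y: "finite Y" "Y \<subseteq> D" "Y \<subseteq> l1cball (Suc j)" "\<forall>z\<in>l1cball j. \<exists>y\<in>Y. l1norm (z - y) < \<rho>"
    using finite_net_l1cball[OF D \<rho>(1,2), of j] by (elim exE conjE)
  \<comment> \<open>The extra 1 admits an empty net and makes the total of the
    \<open>\<delta>\<close> strictly less than \<open>\<epsilon> / 2\<close>. Strictness must come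
    from here, since passing to a supremum preserves only weak inequalities.\<close>
  define \<delta> where "\<delta> = \<epsilon> / (2 * (real (card Y) + 1))"
  have \<delta>: "0 < \<delta>"
    using \<open>0 < \<epsilon>\<close> by (simp add: \<delta>_def)
  have card\<delta>: "real (card Y) * \<delta> < \<epsilon> / 2"
    using \<open>0 < \<epsilon>\<close> by (simp add: \<delta>_def field_simps)
  have U': "closure U \<noteq> {}"
    using U by simp
  have "strong_sn (closure U) (CB U j (a, b)) a b (cdiff (rep G) (rep F)) < \<epsilon>"
    if G: "G \<in> E" and small: "\<forall>y\<in>Y. strong_sn (closure U) {\<lambda>_ _. y} a b (cdiff (rep G) (rep F)) < \<delta>" for G
  proof -
    let ?d = "cdiff (rep G) (rep F)"
    let ?h = "\<lambda>y s. SUP x\<in>closure U. l1norm (?d s x y)"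
    have d: "?d \<in> SC_maps U"
      using E F G by (intro SC_maps_diff rep_SC_maps LC_imp_SC) auto
    obtain l where l: "l_bound U ?d (l1cball (Suc j)) l" "(LINT t:{a..b}|lebesgue. l t) \<le> c"
      using c(2)[OF F G] by blast
    have lint: "set_integrable lebesgue {a..b} (\<lambda>s. \<rho> * l s)"
      using l by (simp add: l_bound_def L1loc_set_integrable)
    have CBy: "(\<lambda>_ _. y) \<in> CB U (Suc j) (a, b)" if "y \<in> Y" for y
      using const_in_CB[OF U] Y(3) that by blast
    have hint: "set_integrable lebesgue {a..b} (?h y)" if "y \<in> Y" for y
      using set_integrable_SUP_superposition[OF d CBy[OF that] order_refl U'] .
    note int = set_integral_sum[of Y lebesgue "{a..b}" ?h, OF hint]
    let ?g = "\<lambda>s. (\<Sum>y\<in>Y. ?h y s) + \<rho> * l s"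
    have AEh: "AE s in lebesgue. \<forall>y\<in>Y. s \<in> {a..b} \<longrightarrow> (\<forall>x\<in>closure U. l1norm (?d s x y) \<le> ?h y s)"
      using Y(1) SUP_upper_AE[OF d CBy order_refl] by (intro AE_finite_allI) auto
    have AEl: "AE s in lebesgue. \<forall>x\<in>closure U. \<forall>y1\<in>l1cball (Suc j). \<forall>y2\<in>l1cball (Suc j).
        l1norm (?d s x y1 - ?d s x y2) \<le> l s * l1norm (y1 - y2)"
      using l(1) by (simp add: l_bound_def)
    have "strong_int (closure U) v a b ?d \<le> (LINT s:{a..b}|lebesgue. ?g s)" if v: "v \<in> CB U j (a, b)" for v
    proof (rule strong_int_le[OF d v order_refl U' set_integral_add(1)[OF int(1) lint]])
      show "AE s in lebesgue. s \<in> {a..b} \<longrightarrow> (\<forall>x\<in>closure U. l1norm (?d s x (v s x)) \<le> ?g s)"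
        using AEh AEl
      proof eventually_elim
        case (elim s)
        show ?case
        proof (intro impI ballI)
          fix x assume s: "s \<in> {a..b}" and x: "x \<in> closure U"
          have vj: "v s x \<in> l1cball j"
            using CB_in_l1cball[OF v s x] .
          then obtain y where y: "y \<in> Y" "l1norm (v s x - y) < \<rho>"
            using Y(4) by blast
          have vSj: "v s x \<in> l1cball (Suc j)" "y \<in> l1cball (Suc j)"
            using vj y Y by (auto simp: l1cball_def)
          have h0: "0 \<le> ?h z s" if "z \<in> Y" for z
            using elim(1) that s x l1norm_nonneg order_trans by blast
          have "l1norm (?d s x (v s x)) \<le> l1norm (?d s x y) + l1norm (?d s x (v s x) - ?d s x y)"
            using l1norm_triangle[of "?d s x y" "?d s x (v s x) - ?d s x y"] by simp
          also have "l1norm (?d s x y) \<le> ?h y s"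
            using elim(1) y s x by blast
          also have "?h y s \<le> (\<Sum>y\<in>Y. ?h y s)"
            using Y(1) y(1) h0 by (intro member_le_sum) auto
          also have "l1norm (?d s x (v s x) - ?d s x y) \<le> l s * l1norm (v s x - y)"
            using elim(2) vSj x by blast
          also have "\<dots> \<le> \<rho> * l s"
            using y(2) l(1) by (subst mult.commute) (intro mult_right_mono, auto simp: l_bound_def)
          finally show "l1norm (?d s x (v s x)) \<le> ?g s"
            by simp
        qed
      qed
    qed
    moreover have "(LINT s:{a..b}|lebesgue. ?g s) = (\<Sum>y\<in>Y. LINT s:{a..b}|lebesgue. ?h y s) + \<rho> * (LINT s:{a..b}|lebesgue. l s)"
      using set_integral_add(2)[OF int(1) lint] int(2) by simp
    moreover have "(\<Sum>y\<in>Y. LINT s:{a..b}|lebesgue. ?h y s) \<le> (\<Sum>y\<in>Y. \<delta>)"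
    proof (rule sum_mono)
      fix y assume "y \<in> Y"
      then show "(LINT s:{a..b}|lebesgue. ?h y s) \<le> \<delta>"
        using small by (auto simp: strong_sn_def strong_int_def intro: less_imp_le)
    qed
    moreover have "\<rho> * (LINT s:{a..b}|lebesgue. l s) \<le> \<rho> * c"
      using l(2) \<rho>(1) by simp
    ultimately have "strong_int (closure U) v a b ?d \<le> real (card Y) * \<delta> + \<epsilon> / 2" if "v \<in> CB U j (a, b)" for v
      using \<rho>c that by fastforce
    then have "strong_sn (closure U) (CB U j (a, b)) a b ?d \<le> real (card Y) * \<delta> + \<epsilon> / 2"
      using const_in_CB[OF U zero_in_l1cball, of j a b] by (intro strong_sn_least) auto
    then show ?thesis
      using card\<delta> by simp
  qed
  then show ?thesis
    using Y(1,2) \<delta> by blast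
qed

lemma x_equicontinuous_cdiff:
  assumes "x_equicontinuous U E" "0 < \<epsilon>"
  shows "\<exists>\<delta>>0. \<forall>F\<in>E. \<forall>G\<in>E. \<exists>w. set_integrable lebesgue {a..b} w \<and>
    (LINT t:{a..b}|lebesgue. w t) \<le> \<epsilon> \<and>
    (AE t in lebesgue. t \<in> {a..b} \<longrightarrow> (\<forall>x1\<in>closure U. \<forall>x2\<in>closure U. l1norm (x1 - x2) < \<delta> \<longrightarrow>
        l1norm (cdiff (rep G) (rep F) t x1 y - cdiff (rep G) (rep F) t x2 y) \<le> w t))"
proof -
  have \<epsilon>: "0 < \<epsilon> / 2"
    using assms by simp
  obtain \<delta> where \<delta>: "0 < \<delta>" "\<forall>F\<in>E. \<exists>w.
     set_integrable lebesgue {a..b} w \<and> (LINT t:{a..b}|lebesgue. w t) \<le> \<epsilon> / 2 \<and>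
     (AE t in lebesgue. t \<in> {a..b} \<longrightarrow> (\<forall>x1\<in>closure U. \<forall>x2\<in>closure U. l1norm (x1 - x2) < \<delta> \<longrightarrow>
        l1norm (rep F t x1 y - rep F t x2 y) \<le> w t))"
    using assms(1)[unfolded x_equicontinuous_def, rule_format, OF \<epsilon>, of a b y]
    by (elim exE conjE)
  show ?thesis
  proof (intro exI[of _ \<delta>] conjI \<delta>(1) ballI)
    fix F G assume "F \<in> E" "G \<in> E"
    obtain w1 where w1: "set_integrable lebesgue {a..b} w1" "(LINT t:{a..b}|lebesgue. w1 t) \<le> \<epsilon> / 2"
     "AE t in lebesgue. t \<in> {a..b} \<longrightarrow> (\<forall>x1\<in>closure U. \<forall>x2\<in>closure U. l1norm (x1 - x2) < \<delta> \<longrightarrow>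
        l1norm (rep F t x1 y - rep F t x2 y) \<le> w1 t)"
      using bspec[OF \<delta>(2) \<open>F \<in> E\<close>] by (elim exE conjE)
    obtain w2 where w2: "set_integrable lebesgue {a..b} w2" "(LINT t:{a..b}|lebesgue. w2 t) \<le> \<epsilon> / 2"
     "AE t in lebesgue. t \<in> {a..b} \<longrightarrow> (\<forall>x1\<in>closure U. \<forall>x2\<in>closure U. l1norm (x1 - x2) < \<delta> \<longrightarrow>
        l1norm (rep G t x1 y - rep G t x2 y) \<le> w2 t)"
      using bspec[OF \<delta>(2) \<open>G \<in> E\<close>] by (elim exE conjE)
    let ?d = "cdiff (rep G) (rep F)"
    have "AE t in lebesgue. t \<in> {a..b} \<longrightarrow> (\<forall>x1\<in>closure U. \<forall>x2\<in>closure U. l1norm (x1 - x2) < \<delta> \<longrightarrow>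
        l1norm (?d t x1 y - ?d t x2 y) \<le> w1 t + w2 t)"
      using w1(3) w2(3)
    proof eventually_elim
      case (elim t)
      show ?case
      proof (intro impI ballI)
        fix x1 x2 assume t: "t \<in> {a..b}" and x: "x1 \<in> closure U" "x2 \<in> closure U" "l1norm (x1 - x2) < \<delta>"
        have "?d t x1 y - ?d t x2 y = (rep G t x1 y - rep G t x2 y) - (rep F t x1 y - rep F t x2 y)"
          by simp
        then have "l1norm (?d t x1 y - ?d t x2 y) \<le> l1norm (rep G t x1 y - rep G t x2 y) + l1norm (rep F t x1 y - rep F t x2 y)"
          using l1norm_diff_le[of "rep G t x1 y - rep G t x2 y" "rep F t x1 y - rep F t x2 y"] by (simp only:)
        also have "\<dots> \<le> w2 t + w1 t"
          using elim t x by (intro add_mono) blast+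
        finally show "l1norm (?d t x1 y - ?d t x2 y) \<le> w1 t + w2 t"
          by simp
      qed
    qed
    then show "\<exists>w. set_integrable lebesgue {a..b} w \<and> (LINT t:{a..b}|lebesgue. w t) \<le> \<epsilon> \<and>
      (AE t in lebesgue. t \<in> {a..b} \<longrightarrow> (\<forall>x1\<in>closure U. \<forall>x2\<in>closure U. l1norm (x1 - x2) < \<delta> \<longrightarrow>
        l1norm (?d t x1 y - ?d t x2 y) \<le> w t))"
      using w1(1,2) w2(1,2) by (intro exI[of _ "\<lambda>t. w1 t + w2 t"]) simp
  qed
qed

text \<open>The net argument is now carried out in space: the sum over net points dominates the
  value at the nearest one, and \<open>w\<close> absorbs the oscillation between that point and
  \<open>x\<close>. The radius \<open>r\<close> is uniform over pairs from \<open>E\<close>, so the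
  net does not depend on \<open>G\<close>.\<close>

lemma strong_sn_x_control:
  fixes E :: "('m::finite, 'n::finite) cmap set set"
  assumes U: "bounded U" "U \<noteq> {}" and D': "D' \<subseteq> U" "U \<subseteq> closure D'"
    and E: "E \<subseteq> LC U" "x_equicontinuous U E" and F: "F \<in> E" and "0 < \<epsilon>"
  shows "\<exists>Y \<delta>. finite Y \<and> Y \<subseteq> D' \<and> 0 < \<delta> \<and> (\<forall>G\<in>E.
    (\<forall>x\<in>Y. strong_sn {x} {\<lambda>_ _. y} a b (cdiff (rep G) (rep F)) < \<delta>) \<longrightarrow>
    strong_sn (closure U) {\<lambda>_ _. y} a b (cdiff (rep G) (rep F)) < \<epsilon>)"
proof -
  have \<epsilon>: "0 < \<epsilon> / 2"
    using \<open>0 < \<epsilon>\<close> by simp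
  obtain r where r: "0 < r" "\<forall>F\<in>E. \<forall>G\<in>E. \<exists>w. set_integrable lebesgue {a..b} w \<and>
    (LINT t:{a..b}|lebesgue. w t) \<le> \<epsilon> / 2 \<and>
    (AE t in lebesgue. t \<in> {a..b} \<longrightarrow> (\<forall>x1\<in>closure U. \<forall>x2\<in>closure U. l1norm (x1 - x2) < r \<longrightarrow>
        l1norm (cdiff (rep G) (rep F) t x1 y - cdiff (rep G) (rep F) t x2 y) \<le> w t))"
    using x_equicontinuous_cdiff[OF E(2) \<epsilon>, of a b y] by (elim exE conjE)
  have cl: "closure U \<subseteq> closure D'" "compact (closure U)" "closure U \<noteq> {}"
    using U D' by (simp_all add: closure_minimal)
  obtain Y where Y: "finite Y" "Y \<subseteq> D'" "\<forall>x\<in>closure U. \<exists>z\<in>Y. l1norm (x - z) < r"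
    using finite_l1norm_net[OF cl(2,1) r(1)] by (elim exE conjE)
  have YU: "z \<in> closure U" if "z \<in> Y" for z
    using that Y(2) D'(1) closure_subset by blast
  obtain j where j: "1 \<le> j" "y \<in> l1cball j"
    using ex_l1cball by blast
  note CBy = const_in_CB[OF U(2) j(2), of a b]
  define \<delta> where "\<delta> = \<epsilon> / (2 * (real (card Y) + 1))"
  have \<delta>: "0 < \<delta>" "real (card Y) * \<delta> < \<epsilon> / 2"
    using \<open>0 < \<epsilon>\<close> by (simp_all add: \<delta>_def field_simps)
  have "strong_sn (closure U) {\<lambda>_ _. y} a b (cdiff (rep G) (rep F)) < \<epsilon>"
    if G: "G \<in> E" and small: "\<forall>x\<in>Y. strong_sn {x} {\<lambda>_ _. y} a b (cdiff (rep G) (rep F)) < \<delta>" for G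
  proof -
    let ?d = "cdiff (rep G) (rep F)"
    have d: "?d \<in> SC_maps U"
      using E F G by (intro SC_maps_diff rep_SC_maps LC_imp_SC) auto
    obtain w where w: "set_integrable lebesgue {a..b} w" "(LINT t:{a..b}|lebesgue. w t) \<le> \<epsilon> / 2"
      and osc: "AE t in lebesgue. t \<in> {a..b} \<longrightarrow> (\<forall>x1\<in>closure U. \<forall>x2\<in>closure U. l1norm (x1 - x2) < r \<longrightarrow>
        l1norm (?d t x1 y - ?d t x2 y) \<le> w t)"
      using bspec[OF bspec[OF r(2) F] G] by (elim exE conjE)
    have hint: "set_integrable lebesgue {a..b} (\<lambda>s. l1norm (?d s z y))" if "z \<in> Y" for z
      using set_integrable_l1norm[OF set_integrable_superposition[OF d CBy YU[OF that]]] .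
    note int = set_integral_sum[of Y lebesgue "{a..b}" "\<lambda>z s. l1norm (?d s z y)", OF hint]
    let ?g = "\<lambda>s. (\<Sum>z\<in>Y. l1norm (?d s z y)) + w s"
    have "strong_int (closure U) (\<lambda>_ _. y) a b ?d \<le> (LINT s:{a..b}|lebesgue. ?g s)"
    proof (rule strong_int_le[OF d CBy order_refl cl(3) set_integral_add(1)[OF int(1) w(1)]])
      show "AE s in lebesgue. s \<in> {a..b} \<longrightarrow> (\<forall>x\<in>closure U. l1norm (?d s x y) \<le> ?g s)"
        using osc
      proof eventually_elim
        case (elim s)
        show ?case
        proof (intro impI ballI)
          fix x assume s: "s \<in> {a..b}" and x: "x \<in> closure U"
          obtain z where z: "z \<in> Y" "l1norm (x - z) < r"
            using bspec[OF Y(3) x] by blast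
          have "l1norm (?d s x y) \<le> l1norm (?d s z y) + l1norm (?d s x y - ?d s z y)"
            using l1norm_triangle[of "?d s z y" "?d s x y - ?d s z y"] by simp
          also have "l1norm (?d s z y) \<le> (\<Sum>z\<in>Y. l1norm (?d s z y))"
            using member_le_sum[OF z(1) _ Y(1), of "\<lambda>z. l1norm (?d s z y)"] by simp
          also have "l1norm (?d s x y - ?d s z y) \<le> w s"
            using elim s x YU[OF z(1)] z(2) by blast
          finally show "l1norm (?d s x y) \<le> ?g s"
            by simp
        qed
      qed
    qed
    also have "\<dots> = (\<Sum>z\<in>Y. LINT s:{a..b}|lebesgue. l1norm (?d s z y)) + (LINT s:{a..b}|lebesgue. w s)"
      using set_integral_add(2)[OF int(1) w(1)] int(2) by simp
    also have "\<dots> \<le> (\<Sum>z\<in>Y. \<delta>) + \<epsilon> / 2"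
    proof (intro add_mono sum_mono w(2))
      fix z assume "z \<in> Y"
      then show "(LINT s:{a..b}|lebesgue. l1norm (?d s z y)) \<le> \<delta>"
        using small by (auto simp: strong_sn_def strong_int_def intro: less_imp_le)
    qed
    finally show ?thesis
      using \<delta>(2) by (simp add: strong_sn_def)
  qed
  then show ?thesis
    using Y(1,2) \<delta>(1) by blast
qed

text \<open>The net point is chosen from \<open>x\<close> alone and is the same for all
  \<open>s\<close>, so the integral at the net point keeps its cancellation and a single seminorm
  enters instead of a sum. The absolute value is put inside only for the oscillation term, which
  costs at most \<open>\<epsilon> / 2\<close>; the tolerance \<open>\<epsilon> / 4\<close> leaves
  room for the strict inequality.\<close>

lemma weak_sn_x_control:
  fixes E :: "('m::finite, 'n::finite) cmap set set"
  assumes U: "bounded U" "U \<noteq> {}" and D': "D' \<subseteq> U" "U \<subseteq> closure D'"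
    and E: "E \<subseteq> LC U" "x_equicontinuous U E" and F: "F \<in> E" and "0 < \<epsilon>"
  shows "\<exists>Y \<delta>. finite Y \<and> Y \<subseteq> D' \<and> 0 < \<delta> \<and> (\<forall>G\<in>E.
    (\<forall>x\<in>Y. weak_sn {x} {\<lambda>_ _. y} a b (cdiff (rep G) (rep F)) < \<delta>) \<longrightarrow>
    weak_sn (closure U) {\<lambda>_ _. y} a b (cdiff (rep G) (rep F)) < \<epsilon>)"
proof -
  have \<epsilon>: "0 < \<epsilon> / 2"
    using \<open>0 < \<epsilon>\<close> by simp
  obtain r where r: "0 < r" "\<forall>F\<in>E. \<forall>G\<in>E. \<exists>w. set_integrable lebesgue {a..b} w \<and>
    (LINT t:{a..b}|lebesgue. w t) \<le> \<epsilon> / 2 \<and>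
    (AE t in lebesgue. t \<in> {a..b} \<longrightarrow> (\<forall>x1\<in>closure U. \<forall>x2\<in>closure U. l1norm (x1 - x2) < r \<longrightarrow>
        l1norm (cdiff (rep G) (rep F) t x1 y - cdiff (rep G) (rep F) t x2 y) \<le> w t))"
    using x_equicontinuous_cdiff[OF E(2) \<epsilon>, of a b y] by (elim exE conjE)
  have cl: "closure U \<subseteq> closure D'" "compact (closure U)" "closure U \<noteq> {}"
    using U D' by (simp_all add: closure_minimal)
  obtain Y where Y: "finite Y" "Y \<subseteq> D'" "\<forall>x\<in>closure U. \<exists>z\<in>Y. l1norm (x - z) < r"
    using finite_l1norm_net[OF cl(2,1) r(1)] by (elim exE conjE)
  have YU: "z \<in> closure U" if "z \<in> Y" for z
    using that Y(2) D'(1) closure_subset by blast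
  obtain j where j: "1 \<le> j" "y \<in> l1cball j"
    using ex_l1cball by blast
  note CBy = const_in_CB[OF U(2) j(2), of a b]
  have "weak_sn (closure U) {\<lambda>_ _. y} a b (cdiff (rep G) (rep F)) < \<epsilon>"
    if G: "G \<in> E" and small: "\<forall>x\<in>Y. weak_sn {x} {\<lambda>_ _. y} a b (cdiff (rep G) (rep F)) < \<epsilon> / 4" for G
  proof -
    let ?d = "cdiff (rep G) (rep F)"
    have d: "?d \<in> SC_maps U"
      using E F G by (intro SC_maps_diff rep_SC_maps LC_imp_SC) auto
    obtain w where w: "set_integrable lebesgue {a..b} w" "(LINT t:{a..b}|lebesgue. w t) \<le> \<epsilon> / 2"
      and osc: "AE t in lebesgue. t \<in> {a..b} \<longrightarrow> (\<forall>x1\<in>closure U. \<forall>x2\<in>closure U. l1norm (x1 - x2) < r \<longrightarrow>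
        l1norm (?d t x1 y - ?d t x2 y) \<le> w t)"
      using bspec[OF bspec[OF r(2) F] G] by (elim exE conjE)
    have dint: "set_integrable lebesgue {a..b} (\<lambda>s. ?d s x y)" if "x \<in> closure U" for x
      using set_integrable_superposition[OF d CBy that] .
    have "weak_sn (closure U) {\<lambda>_ _. y} a b ?d \<le> \<epsilon> / 4 + \<epsilon> / 2"
    proof (rule weak_sn_least)
      fix v :: "real \<Rightarrow> real ^ 'm \<Rightarrow> real ^ 'n" and x assume v: "v \<in> {\<lambda>_ _. y}" and x: "x \<in> closure U"
      obtain z where z: "z \<in> Y" "l1norm (x - z) < r"
        using bspec[OF Y(3) x] by blast
      note diff = set_integral_diff[OF dint[OF x] dint[OF YU[OF z(1)]]]
      have "(LINT s:{a..b}|lebesgue. ?d s x y)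
          = (LINT s:{a..b}|lebesgue. ?d s z y) + (LINT s:{a..b}|lebesgue. ?d s x y - ?d s z y)"
        unfolding diff(2) by simp
      then have "l1norm (LINT s:{a..b}|lebesgue. ?d s x y) \<le> l1norm (LINT s:{a..b}|lebesgue. ?d s z y)
          + l1norm (LINT s:{a..b}|lebesgue. ?d s x y - ?d s z y)"
        by (simp only: l1norm_triangle)
      moreover have "l1norm (LINT s:{a..b}|lebesgue. ?d s z y) \<le> \<epsilon> / 4"
        using small z(1) by (auto simp: weak_sn_def intro: less_imp_le)
      moreover have "l1norm (LINT s:{a..b}|lebesgue. ?d s x y - ?d s z y)
          \<le> (LINT s:{a..b}|lebesgue. l1norm (?d s x y - ?d s z y))"
        by (rule l1norm_set_integral_le[OF diff(1)])
      moreover have "(LINT s:{a..b}|lebesgue. l1norm (?d s x y - ?d s z y)) \<le> (LINT s:{a..b}|lebesgue. w s)"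
      proof (rule set_integral_mono_AE[OF set_integrable_l1norm[OF diff(1)] w(1)])
        show "AE s\<in>{a..b} in lebesgue. l1norm (?d s x y - ?d s z y) \<le> w s"
          using osc by eventually_elim (use x YU[OF z(1)] z(2) in blast)
      qed
      ultimately show "l1norm (LINT s:{a..b}|lebesgue. ?d s x (v s x)) \<le> \<epsilon> / 4 + \<epsilon> / 2"
        using v w(2) by simp
    qed (use cl in auto)
    then show ?thesis
      using \<open>0 < \<epsilon>\<close> by simp
  qed
  then show ?thesis
    using Y(1,2) \<open>0 < \<epsilon>\<close> by (intro exI[of _ Y] exI[of _ "\<epsilon> / 4"]) auto
qed

section \<open>Freezing a path in time\<close>

lemma CB_mono: "v \<in> CB U j (a, b) \<Longrightarrow> j \<le> k \<Longrightarrow> v \<in> CB U k (a, b)"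
  unfolding CB_def l1cball_def by fastforce

lemma modulus_small:
  assumes "modulus \<theta>" "0 < e"
  obtains r where "0 < r" "\<And>s. 0 \<le> s \<Longrightarrow> s < r \<Longrightarrow> \<theta> s < e"
proof -
  have "continuous_on {0..} \<theta>" "\<theta> 0 = 0"
    using assms(1) by (auto simp: modulus_def)
  then obtain r where r: "0 < r" "\<forall>s\<in>{0..}. dist s 0 < r \<longrightarrow> dist (\<theta> s) 0 < e"
    unfolding continuous_on_iff using \<open>0 < e\<close> by force
  show ?thesis
  proof (rule that[OF r(1)])
    fix s :: real assume "0 \<le> s" "s < r"
    then show "\<theta> s < e"
      using r(2) by (auto simp: dist_real_def dest!: bspec[of _ _ s])
  qed
qed

text \<open>The replacement of \<open>v\<close> by the constant \<open>y\<close> is estimated with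
  the norm inside the integral, by the \<open>l\<close>-bound; only the term with constant
  \<open>y\<close>, which a weak seminorm can measure, keeps its norm outside.\<close>

lemma superposition_freeze:
  assumes U: "U \<noteq> {}" and d: "d \<in> SC_maps U" and l: "l_bound U d (l1cball k) l"
    and v: "v \<in> CB U k (a, b)" and x: "x \<in> closure U" and y: "y \<in> l1cball k"
    and ivl: "a \<le> p" "q \<le> b"
    and near: "\<And>s. s \<in> {p..q} \<Longrightarrow> l1norm (v s x - y) \<le> \<rho>"
  shows "l1norm (LINT s:{p..q}|lebesgue. d s x (v s x))
    \<le> l1norm (LINT s:{p..q}|lebesgue. d s x y) + \<rho> * (LINT s:{p..q}|lebesgue. l s)"
proof -
  have "{p..q} \<subseteq> {a..b}"
    using ivl by auto
  then have int: "set_integrable lebesgue {p..q} (\<lambda>s. d s x (v s x))"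
    "set_integrable lebesgue {p..q} (\<lambda>s. d s x y)"
    using set_integrable_superposition[OF d v x] set_integrable_superposition[OF d const_in_CB[OF U y, of a b] x]
    by (auto intro: set_integrable_subset)
  note diff = set_integral_diff[OF int]
  have lint: "set_integrable lebesgue {p..q} (\<lambda>s. \<rho> * l s)"
    using l by (simp add: l_bound_def L1loc_set_integrable)
  have "(LINT s:{p..q}|lebesgue. d s x (v s x))
      = (LINT s:{p..q}|lebesgue. d s x y) + (LINT s:{p..q}|lebesgue. d s x (v s x) - d s x y)"
    unfolding diff(2) by simp
  then have "l1norm (LINT s:{p..q}|lebesgue. d s x (v s x)) \<le> l1norm (LINT s:{p..q}|lebesgue. d s x y)
      + l1norm (LINT s:{p..q}|lebesgue. d s x (v s x) - d s x y)"
    by (simp only: l1norm_triangle)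
  moreover have "l1norm (LINT s:{p..q}|lebesgue. d s x (v s x) - d s x y)
      \<le> (LINT s:{p..q}|lebesgue. l1norm (d s x (v s x) - d s x y))"
    by (rule l1norm_set_integral_le[OF diff(1)])
  moreover have "(LINT s:{p..q}|lebesgue. l1norm (d s x (v s x) - d s x y)) \<le> (LINT s:{p..q}|lebesgue. \<rho> * l s)"
  proof (rule set_integral_mono_AE[OF set_integrable_l1norm[OF diff(1)] lint])
    have "AE s in lebesgue. \<forall>x\<in>closure U. \<forall>y1\<in>l1cball k. \<forall>y2\<in>l1cball k.
        l1norm (d s x y1 - d s x y2) \<le> l s * l1norm (y1 - y2)"
      using l by (simp add: l_bound_def)
    then show "AE s\<in>{p..q} in lebesgue. l1norm (d s x (v s x) - d s x y) \<le> \<rho> * l s"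
    proof eventually_elim
      case (elim s)
      show ?case
      proof
        assume s: "s \<in> {p..q}"
        then have "v s x \<in> l1cball k"
          using ivl by (intro CB_in_l1cball[OF v _ x]) auto
        then have "l1norm (d s x (v s x) - d s x y) \<le> l s * l1norm (v s x - y)"
          using elim x y by blast
        also have "\<dots> \<le> l s * \<rho>"
          using near[OF s] l by (intro mult_left_mono) (auto simp: l_bound_def)
        finally show "l1norm (d s x (v s x) - d s x y) \<le> \<rho> * l s"
          by (simp add: mult.commute)
      qed
    qed
  qed
  ultimately show ?thesis
    by simp
qed

text \<open>The two errors accumulate differently: \<open>\<eta>\<close> is paid once per piece,
  whereas the Lipschitz errors join into one integral over the whole interval without a factor
  \<open>K\<close>. So \<open>\<rho>\<close> can be fixed before the partition and
  \<open>\<eta>\<close> after it.\<close>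

lemma superposition_partition:
  assumes U: "U \<noteq> {}" and d: "d \<in> SC_maps U" and l: "l_bound U d (l1cball k) l"
    and v: "v \<in> CB U k (a, b)" and x: "x \<in> closure U" and ivl: "a \<le> p" "0 \<le> h" "p + real K * h \<le> b"
    and pieces: "\<And>i. i < K \<Longrightarrow> \<exists>y\<in>l1cball k.
      (\<forall>s\<in>{p + real i * h..p + real (Suc i) * h}. l1norm (v s x - y) \<le> \<rho>) \<and>
      l1norm (LINT s:{p + real i * h..p + real (Suc i) * h}|lebesgue. d s x y) \<le> \<eta>"
  shows "l1norm (LINT s:{p..p + real K * h}|lebesgue. d s x (v s x))
    \<le> real K * \<eta> + \<rho> * (LINT s:{p..p + real K * h}|lebesgue. l s)"
proof -
  let ?\<tau> = "\<lambda>i. p + real i * h"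
  have \<tau>_mono: "?\<tau> i \<le> ?\<tau> n" if "i \<le> n" for i n
    using that ivl(2) by (simp add: mult_right_mono)
  have int: "set_integrable lebesgue {p..?\<tau> n} (\<lambda>s. d s x (v s x))" if "n \<le> K" for n
  proof (rule set_integrable_subset[OF set_integrable_superposition[OF d v x]])
    show "{p..?\<tau> n} \<subseteq> {a..b}"
      using ivl \<tau>_mono[OF that] by auto
  qed simp
  have lint: "set_integrable lebesgue {p..?\<tau> n} l" for n
    using l by (simp add: l_bound_def L1loc_set_integrable)
  have "l1norm (LINT s:{p..?\<tau> n}|lebesgue. d s x (v s x)) \<le> real n * \<eta> + \<rho> * (LINT s:{p..?\<tau> n}|lebesgue. l s)"
    if "n \<le> K" for n
    using that
  proof (induction n)
    \<comment> \<open>Splitting the one-point interval at its only point shows that its integral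
      equals twice itself, hence vanishes.\<close>
    case 0
    then show ?case
      using set_integral_combine[OF _ _ int, of p 0] set_integral_combine[OF _ _ lint, of p 0] by simp
  next
    case (Suc n)
    have n: "p \<le> ?\<tau> n" "?\<tau> n \<le> ?\<tau> (Suc n)"
      using \<tau>_mono[of 0 n] \<tau>_mono[of n "Suc n"] by simp_all
    have "n < K"
      using Suc.prems by simp
    then obtain y where y: "y \<in> l1cball k" "\<forall>s\<in>{?\<tau> n..?\<tau> (Suc n)}. l1norm (v s x - y) \<le> \<rho>"
      "l1norm (LINT s:{?\<tau> n..?\<tau> (Suc n)}|lebesgue. d s x y) \<le> \<eta>"
      using pieces by blast
    have "?\<tau> (Suc n) \<le> b" "a \<le> ?\<tau> n"
      using \<tau>_mono[OF Suc.prems] ivl(1,3) n by linarith+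
    then have "l1norm (LINT s:{?\<tau> n..?\<tau> (Suc n)}|lebesgue. d s x (v s x))
        \<le> \<eta> + \<rho> * (LINT s:{?\<tau> n..?\<tau> (Suc n)}|lebesgue. l s)"
      using superposition_freeze[OF U d l v x y(1) _ _ bspec[OF y(2)]] y(3) by fastforce
    moreover have "l1norm (LINT s:{p..?\<tau> n}|lebesgue. d s x (v s x)) \<le> real n * \<eta> + \<rho> * (LINT s:{p..?\<tau> n}|lebesgue. l s)"
      using Suc by simp
    moreover have "l1norm (LINT s:{p..?\<tau> (Suc n)}|lebesgue. d s x (v s x))
        \<le> l1norm (LINT s:{p..?\<tau> n}|lebesgue. d s x (v s x)) + l1norm (LINT s:{?\<tau> n..?\<tau> (Suc n)}|lebesgue. d s x (v s x))"
      unfolding set_integral_combine[OF n int[OF Suc.prems]] by (rule l1norm_triangle)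
    moreover have "real (Suc n) * \<eta> + \<rho> * (LINT s:{p..?\<tau> (Suc n)}|lebesgue. l s)
      = (real n * \<eta> + \<rho> * (LINT s:{p..?\<tau> n}|lebesgue. l s)) + (\<eta> + \<rho> * (LINT s:{?\<tau> n..?\<tau> (Suc n)}|lebesgue. l s))"
      unfolding set_integral_combine[OF n lint] by (simp add: algebra_simps)
    ultimately show ?case
      by linarith
  qed
  then show ?thesis
    by simp
qed

lemma suitable_moduli_modulus:
  assumes \<Theta>: "suitable_moduli \<Theta>1 \<Theta>2" and "1 \<le> j" "(a, b) \<in> rat_ivls"
  shows "modulus (\<Theta>1 j (a, b))"
    and "1 \<le> \<nu> \<Longrightarrow> a + 1 / real \<nu> < b \<Longrightarrow> modulus (\<Theta>2 j (a, b) \<nu>)"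
proof -
  note * = \<Theta>[unfolded suitable_moduli_def]
  note 1 = conjunct1[OF *] and 2 = conjunct1[OF conjunct2[OF *]]
  show "modulus (\<Theta>1 j (a, b))"
    using 1 assms(2,3) by blast
  show "modulus (\<Theta>2 j (a, b) \<nu>)" if "1 \<le> \<nu>" "a + 1 / real \<nu> < b"
    using 2[rule_format, OF assms(2,3)] that by simp
qed

lemma HH_subset_CB: "HH U \<Theta>1 \<Theta>2 j (a, b) \<subseteq> CB U j (a, b)"
  by (auto simp: HH_def)

text \<open>The increments of a constant path vanish, and the moduli are nonnegative. This makes the
  seminorms at constants coarser than those over \<open>HH\<close>, and also shows that
  \<open>HH\<close> is not empty.\<close>

lemma const_in_HH:
  assumes U: "U \<noteq> {}" and \<Theta>: "suitable_moduli \<Theta>1 \<Theta>2" and j: "1 \<le> j" and ab: "(a, b) \<in> rat_ivls"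
    and y: "y \<in> l1cball j"
  shows "(\<lambda>_ _. y) \<in> HH U \<Theta>1 \<Theta>2 j (a, b)"
proof -
  have "0 \<le> \<Theta>1 j (a, b) s" if "0 \<le> s" for s
    using suitable_moduli_modulus(1)[OF \<Theta> j ab] that by (auto simp: modulus_def)
  moreover have "0 \<le> \<Theta>2 j (a, b) \<nu> s" if "0 \<le> s" "1 \<le> \<nu>" "a + 1 / real \<nu> < b" for s \<nu>
    using suitable_moduli_modulus(2)[OF \<Theta> j ab that(2,3)] that(1) by (auto simp: modulus_def)
  ultimately show ?thesis
    using const_in_CB[OF U y, of a b] U by (auto simp: HH_def supnorm_def intro!: add_nonneg_nonneg)
qed

text \<open>The interval is cut at \<open>p = a + 1 / \<nu>\<close>. On the first part only the
  short length and the \<open>m\<close>-bounds help. On the second, all paths in \<open>HH\<close>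
  have a common modulus up to a small defect, so one partition serves all of them at once.
  Partition, net and tolerance are fixed before \<open>G\<close> is given.\<close>

lemma weak_sn_HH_control:
  fixes E :: "('m::finite, 'n::finite) cmap set set"
  assumes U: "U \<noteq> {}" and D: "closure D = UNIV" and \<Theta>: "suitable_moduli \<Theta>1 \<Theta>2"
    and ab: "(a, b) \<in> rat_ivls" and j: "1 \<le> j"
    and E: "E \<subseteq> LC U" "l_bounded U E" "m_equicontinuous U E" and F: "F \<in> E" and \<epsilon>: "0 < \<epsilon>"
  shows "\<exists>R \<delta>. finite R \<and> R \<subseteq> rat_ivls \<times> D \<and> 0 < \<delta> \<and> (\<forall>G\<in>E.
    (\<forall>q\<in>R. weak_sn (closure U) {\<lambda>_ _. snd q} (fst (fst q)) (snd (fst q)) (cdiff (rep G) (rep F)) < \<delta>) \<longrightarrow>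
    weak_sn (closure U) (HH U \<Theta>1 \<Theta>2 j (a, b)) a b (cdiff (rep G) (rep F)) < \<epsilon>)"
proof -
  have rat: "a \<in> \<rat>" "b \<in> \<rat>" "a < b"
    using ab by (auto simp: rat_ivls_def)
  obtain c where c: "0 \<le> c" "\<And>F G. F \<in> E \<Longrightarrow> G \<in> E \<Longrightarrow> \<exists>l.
      l_bound U (cdiff (rep G) (rep F)) (l1cball (Suc j)) l \<and> (LINT t:{a..b}|lebesgue. l t) \<le> c"
    by (rule l_bounded_cdiff[OF E(2), of "Suc j" a b]) auto
  \<comment> \<open>Here the Lipschitz error is to be at most \<open>\<epsilon> / 4\<close>, since
    the initial piece and the sum over the pieces need shares of their own.\<close>
  define \<rho> where "\<rho> = min 1 (\<epsilon> / (4 * (c + 1)))"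
  have \<rho>: "0 < \<rho>" "\<rho> \<le> 1" "\<rho> \<le> \<epsilon> / (4 * (c + 1))"
    using c(1) \<epsilon> by (auto simp: \<rho>_def)
  have "\<rho> * c \<le> \<epsilon> / (4 * (c + 1)) * c"
    using \<rho>(3) c(1) by (rule mult_right_mono)
  also have "\<dots> \<le> \<epsilon> / 4"
    using c(1) \<epsilon> by (simp add: field_simps)
  finally have \<rho>c: "\<rho> * c \<le> \<epsilon> / 4" .
  \<comment> \<open>Half of \<open>\<rho>\<close> goes to the distance from the net; the other half
    is kept for the variation of \<open>v\<close> on a piece, split evenly between the two
    moduli.\<close>
  have "0 < \<rho> / 2" "\<rho> / 2 \<le> 1"
    using \<rho> by simp_all
  from finite_net_l1cball[OF D this, of j]
  obtain Y where Y: "finite Y" "Y \<subseteq> D" "Y \<subseteq> l1cball (Suc j)" "\<forall>z\<in>l1cball j. \<exists>y\<in>Y. l1norm (z - y) < \<rho> / 2"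
    by (elim exE conjE)
  have "0 < \<epsilon> / 8"
    using \<epsilon> by simp
  from E(3)[unfolded m_equicontinuous_def, rule_format, OF j this, of a b]
  obtain \<delta>m where \<delta>m: "0 < \<delta>m" "\<forall>F\<in>E. \<exists>m. m_bound U (rep F) (l1cball j) m \<and>
     (\<forall>t1 t2. a \<le> t1 \<and> t1 \<le> t2 \<and> t2 \<le> b \<and> t2 - t1 < \<delta>m \<longrightarrow> (LINT t:{t1..t2}|lebesgue. m t) < \<epsilon> / 8)"
    by (elim exE conjE)
  have "0 < \<rho> / 4"
    using \<rho> by simp
  have "modulus (\<Theta>1 j (a, b))"
    using suitable_moduli_modulus(1)[OF \<Theta> j ab] .
  then obtain r1 where r1: "0 < r1" "\<And>s. 0 \<le> s \<Longrightarrow> s < r1 \<Longrightarrow> \<Theta>1 j (a, b) s < \<rho> / 4"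
    using modulus_small[OF _ \<open>0 < \<rho> / 4\<close>] by metis
  \<comment> \<open>One choice of \<open>\<nu>\<close> meets three demands: \<open>p\<close> lies
    before \<open>b\<close>, the initial piece is short enough for the \<open>m\<close>-bounds, and
    the defect of the modulus is below \<open>\<rho> / 4\<close>.\<close>
  obtain n where n: "inverse (real (Suc n)) < min (b - a) (min \<delta>m r1)"
    using reals_Archimedean[of "min (b - a) (min \<delta>m r1)"] rat r1(1) \<delta>m(1) by auto
  define \<nu> where "\<nu> = Suc n"
  have \<nu>: "1 \<le> \<nu>" "a + 1 / real \<nu> < b" "1 / real \<nu> < \<delta>m" "1 / real \<nu> < r1" "0 < 1 / real \<nu>"
    using n unfolding \<nu>_def inverse_eq_divide by auto
  define p where "p = a + 1 / real \<nu>"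
  have p: "a \<le> p" "p < b" "p - a < \<delta>m" "p \<in> \<rat>"
    using \<nu> rat by (auto simp: p_def)
  have "modulus (\<Theta>2 j (a, b) \<nu>)"
    using suitable_moduli_modulus(2)[OF \<Theta> j ab \<nu>(1,2)] .
  then obtain r2 where r2: "0 < r2" "\<And>s. 0 \<le> s \<Longrightarrow> s < r2 \<Longrightarrow> \<Theta>2 j (a, b) \<nu> s < \<rho> / 4"
    using modulus_small[OF _ \<open>0 < \<rho> / 4\<close>] by metis
  \<comment> \<open>The threshold \<open>r2\<close> belongs to the modulus for this
    \<open>\<nu>\<close>; \<open>N\<close> makes the mesh smaller than \<open>r2\<close>.\<close>
  obtain N where N: "inverse (real (Suc N)) < r2 / (b - p)"
    using reals_Archimedean[of "r2 / (b - p)"] r2(1) p by auto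
  define K where "K = Suc N"
  have "0 < K"
    by (simp add: K_def)
  define h where "h = (b - p) / real K"
  have h: "0 < h" "h < r2" "p + real K * h = b" "h \<in> \<rat>"
    using N p rat by (auto simp: h_def K_def field_simps)
  let ?\<tau> = "\<lambda>i. p + real i * h"
  have \<tau>: "?\<tau> i \<in> \<rat>" "?\<tau> i < ?\<tau> (Suc i)" "p \<le> ?\<tau> i" for i
    using p h by (auto simp: distrib_right)
  have \<tau>b: "?\<tau> (Suc i) \<le> b" if "i < K" for i
  proof -
    have "real (Suc i) * h \<le> real K * h"
      using that h(1) by (intro mult_right_mono) auto
    then show ?thesis
      using h(3) by linarith
  qed
  \<comment> \<open>All pairs of a piece and a net point are included, since which net point serves
    a piece will depend on \<open>v\<close> and \<open>x\<close>. The endpoints are rational because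
    \<open>a\<close>, \<open>b\<close> and \<open>1 / \<nu>\<close> are, so each pair indexes a
    seminorm of \<open>sigma_D\<close>.\<close>
  define R where "R = (\<lambda>(i, y). ((?\<tau> i, ?\<tau> (Suc i)), y)) ` ({..<K} \<times> Y)"
  have R: "finite R" "R \<subseteq> rat_ivls \<times> D"
    using Y(1,2) \<tau>(1,2) by (auto simp: R_def rat_ivls_def simp del: of_nat_Suc)
  define \<delta> where "\<delta> = \<epsilon> / (8 * real K)"
  have \<delta>: "0 < \<delta>" "real K * \<delta> = \<epsilon> / 8"
    using \<epsilon> \<open>0 < K\<close> by (simp_all add: \<delta>_def)
  have U': "closure U \<noteq> {}"
    using U by simp
  have "weak_sn (closure U) (HH U \<Theta>1 \<Theta>2 j (a, b)) a b (cdiff (rep G) (rep F)) < \<epsilon>"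
    if G: "G \<in> E" and small: "\<forall>q\<in>R.
      weak_sn (closure U) {\<lambda>_ _. snd q} (fst (fst q)) (snd (fst q)) (cdiff (rep G) (rep F)) < \<delta>" for G
  proof -
    let ?d = "cdiff (rep G) (rep F)"
    have d: "?d \<in> SC_maps U"
      using E F G by (intro SC_maps_diff rep_SC_maps LC_imp_SC) auto
    obtain l where l: "l_bound U ?d (l1cball (Suc j)) l" "(LINT t:{a..b}|lebesgue. l t) \<le> c"
      using c(2)[OF F G] by blast
    have l_le: "(LINT t:{p..b}|lebesgue. l t) \<le> c"
      using set_integral_subset_le[of "{a..b}" l "{p..b}"] l p by (auto simp: l_bound_def L1loc_set_integrable)
    have "a \<le> a \<and> a \<le> p \<and> p \<le> b \<and> p - a < \<delta>m"
      using p by simp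
    then obtain mF mG where m: "m_bound U (rep F) (l1cball j) mF" "(LINT t:{a..p}|lebesgue. mF t) < \<epsilon> / 8"
      "m_bound U (rep G) (l1cball j) mG" "(LINT t:{a..p}|lebesgue. mG t) < \<epsilon> / 8"
      using bspec[OF \<delta>m(2) F] bspec[OF \<delta>m(2) G] by blast
    let ?m = "\<lambda>t. mG t + mF t"
    have md: "m_bound U ?d (l1cball j) ?m"
      using m_bound_cdiff[OF m(3,1)] .
    have mint: "set_integrable lebesgue {a..p} mG" "set_integrable lebesgue {a..p} mF"
      using m by (simp_all add: m_bound_def L1loc_set_integrable)
    have m_le: "(LINT t:{a..p}|lebesgue. ?m t) \<le> \<epsilon> / 4"
      using set_integral_add(2)[OF mint] m by simp
    \<comment> \<open>The shares are, in order, the initial piece (two \<open>m\<close>-bounds of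
      \<open>\<epsilon> / 8\<close> each), the \<open>K\<close> tested integrals, and the Lipschitz
      error.\<close>
    have "weak_sn (closure U) (HH U \<Theta>1 \<Theta>2 j (a, b)) a b ?d \<le> \<epsilon> / 4 + \<epsilon> / 8 + \<epsilon> / 4"
    proof (rule weak_sn_least)
      have "(\<lambda>_ _. 0) \<in> HH U \<Theta>1 \<Theta>2 j (a, b)"
        by (rule const_in_HH[OF U \<Theta> j ab zero_in_l1cball])
      then show "HH U \<Theta>1 \<Theta>2 j (a, b) \<noteq> {}"
        by blast
      fix v :: "real \<Rightarrow> real ^ 'm \<Rightarrow> real ^ 'n" and x
      assume v: "v \<in> HH U \<Theta>1 \<Theta>2 j (a, b)" and x: "x \<in> closure U"
      have vCB: "v \<in> CB U j (a, b)"
        using v by (simp add: HH_def)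
      have vCB': "v \<in> CB U (Suc j) (a, b)"
        using CB_mono[OF vCB] by simp
      note int = set_integrable_superposition[OF d vCB x]
      have int1: "set_integrable lebesgue {a..p} (\<lambda>s. ?d s x (v s x))"
        using int p by (auto intro: set_integrable_subset)
      have first: "l1norm (LINT s:{a..p}|lebesgue. ?d s x (v s x)) \<le> \<epsilon> / 4"
      proof -
        have "l1norm (LINT s:{a..p}|lebesgue. ?d s x (v s x)) \<le> (LINT s:{a..p}|lebesgue. l1norm (?d s x (v s x)))"
          by (rule l1norm_set_integral_le[OF int1])
        also have "\<dots> \<le> (LINT s:{a..p}|lebesgue. ?m s)"
        proof (rule set_integral_mono_AE[OF set_integrable_l1norm[OF int1] set_integral_add(1)[OF mint]])
          show "AE s\<in>{a..p} in lebesgue. l1norm (?d s x (v s x)) \<le> ?m s"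
            using m_bound_CB_AE[OF md vCB] by eventually_elim (use p x in auto)
        qed
        finally show ?thesis
          using m_le by linarith
      qed
      have "l1norm (LINT s:{p..?\<tau> K}|lebesgue. ?d s x (v s x)) \<le> real K * \<delta> + \<rho> * (LINT s:{p..?\<tau> K}|lebesgue. l s)"
      proof (rule superposition_partition[OF U d l(1) vCB' x])
        show "a \<le> p" "0 \<le> h" "?\<tau> K \<le> b"
          using p h by simp_all
        fix i assume i: "i < K"
        have "?\<tau> i \<in> {a..b}"
          using \<tau>[of i] \<tau>b[OF i] p by auto
        \<comment> \<open>The net point approximates the value of \<open>v\<close> at the left end
          of the piece, and is then used on the whole piece.\<close>
        then obtain y where y: "y \<in> Y" "l1norm (v (?\<tau> i) x - y) < \<rho> / 2"
          using bspec[OF Y(4) CB_in_l1cball[OF vCB _ x]] by blast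
        have "l1norm (v s x - y) \<le> \<rho>" if s: "s \<in> {?\<tau> i..?\<tau> (Suc i)}" for s
        proof -
          have mem: "s \<in> {a + 1 / real \<nu>..b}" "?\<tau> i \<in> {a + 1 / real \<nu>..b}"
            using s \<tau>[of i] \<tau>b[OF i] by (auto simp: p_def)
          have "l1norm (v s x - v (?\<tau> i) x) \<le> supnorm U (\<lambda>x. v s x - v (?\<tau> i) x)"
            using mem p(1) unfolding p_def[symmetric] by (intro CB_l1norm_diff_le[OF vCB _ _ x]) auto
          also have "\<dots> \<le> \<Theta>2 j (a, b) \<nu> \<bar>s - ?\<tau> i\<bar> + \<Theta>1 j (a, b) (1 / real \<nu>)"
            using v mem \<nu>(1,2) by (simp add: HH_def)
          also have "\<dots> \<le> \<rho> / 4 + \<rho> / 4"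
          proof (intro add_mono less_imp_le)
            show "\<Theta>2 j (a, b) \<nu> \<bar>s - ?\<tau> i\<bar> < \<rho> / 4"
              using s h(2) by (intro r2(2)) (auto simp: distrib_right)
            show "\<Theta>1 j (a, b) (1 / real \<nu>) < \<rho> / 4"
              using \<nu> by (intro r1(2)) auto
          qed
          finally show ?thesis
            using y(2) l1norm_triangle_diff[of "v s x" y "v (?\<tau> i) x"] by simp
        qed
        moreover have "l1norm (LINT s:{?\<tau> i..?\<tau> (Suc i)}|lebesgue. ?d s x y) \<le> \<delta>"
        proof -
          have "y \<in> l1cball (Suc j)"
            using y Y by blast
          then have "(\<lambda>_ _. y) \<in> CB U (Suc j) (?\<tau> i, ?\<tau> (Suc i))"
            by (rule const_in_CB[OF U])
          then have "l1norm (LINT s:{?\<tau> i..?\<tau> (Suc i)}|lebesgue. ?d s x y)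
              \<le> weak_sn (closure U) {\<lambda>_ _. y} (?\<tau> i) (?\<tau> (Suc i)) ?d"
            using weak_sn_upper[OF d, of "{\<lambda>_ _. y}" "Suc j" "?\<tau> i" "?\<tau> (Suc i)" "\<lambda>_ _. y" "closure U" x] x by simp
          moreover have "((?\<tau> i, ?\<tau> (Suc i)), y) \<in> R"
            using i y(1) unfolding R_def by force
          ultimately show ?thesis
            using small by fastforce
        qed
        ultimately show "\<exists>y\<in>l1cball (Suc j). (\<forall>s\<in>{?\<tau> i..?\<tau> (Suc i)}. l1norm (v s x - y) \<le> \<rho>) \<and>
            l1norm (LINT s:{?\<tau> i..?\<tau> (Suc i)}|lebesgue. ?d s x y) \<le> \<delta>"
          using y(1) Y(3) by blast
      qed
      moreover have "\<rho> * (LINT s:{p..b}|lebesgue. l s) \<le> \<rho> * c"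
        using l_le \<rho>(1) by simp
      ultimately have second: "l1norm (LINT s:{p..b}|lebesgue. ?d s x (v s x)) \<le> \<epsilon> / 8 + \<epsilon> / 4"
        using \<delta>(2) \<rho>c unfolding h(3) by linarith
      have "l1norm (LINT s:{a..b}|lebesgue. ?d s x (v s x))
          \<le> l1norm (LINT s:{a..p}|lebesgue. ?d s x (v s x)) + l1norm (LINT s:{p..b}|lebesgue. ?d s x (v s x))"
        unfolding set_integral_combine[OF p(1) less_imp_le[OF p(2)] int] by (rule l1norm_triangle)
      then show "l1norm (LINT s:{a..b}|lebesgue. ?d s x (v s x)) \<le> \<epsilon> / 4 + \<epsilon> / 8 + \<epsilon> / 4"
        using first second by linarith
    qed (rule U')
    then show ?thesis
      using \<epsilon> by simp
  qed
  then show ?thesis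
    using R \<delta>(1) by (intro exI[of _ R] exI[of _ \<delta>]) blast
qed

section \<open>The conditions on the family and one additional map\<close>

text \<open>The kind of bound is kept abstract, as the argument uses only local integrability and
  nonnegativity; it serves \<open>l_bound\<close> and \<open>l_bound_wrt\<close> alike.
  Nonnegativity lets the integral over \<open>{a..b}\<close> be bounded by the one over a symmetric
  interval.\<close>

lemma L1loc_bounded_const:
  assumes bd: "\<And>f K m. bd f K m \<Longrightarrow> m \<in> L1loc \<and> (\<forall>t. 0 \<le> m t)"
    and E: "L1loc_bounded bd E" and j: "1 \<le> j"
  shows "\<exists>c\<ge>0. \<forall>F\<in>E. \<exists>m. bd (rep F) (l1cball j) m \<and> (LINT t:{a..b}|lebesgue. m t) \<le> c"
proof -
  \<comment> \<open>The added 1 makes the radius positive even when both endpoints are 0.\<close>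
  define r where "r = max \<bar>a\<bar> \<bar>b\<bar> + 1"
  have r: "0 < r" "{a..b} \<subseteq> {-r..r}"
    by (auto simp: r_def)
  obtain S where S: "bounds_family bd E j S" "(SUP m\<in>S. ereal (LINT t:{-r..r}|lebesgue. m t)) < \<infinity>"
    using E j r(1) unfolding L1loc_bounded_def by metis
  \<comment> \<open>A natural number above the supremum also covers an empty \<open>S\<close>, where
    the supremum is \<open>-\<infinity>\<close>, and is nonnegative as required.\<close>
  obtain n where n: "(SUP m\<in>S. ereal (LINT t:{-r..r}|lebesgue. m t)) < ereal (real n)"
    using less_PInf_Ex_of_nat[of "SUP m\<in>S. ereal (LINT t:{-r..r}|lebesgue. m t)"] S(2)
    by auto
  show ?thesis
  proof (intro exI[of _ "real n"] conjI ballI)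
    fix F assume "F \<in> E"
    then obtain m where m: "m \<in> S" "bd (rep F) (l1cball j) m"
      using S(1) unfolding bounds_family_def by blast
    have "ereal (LINT t:{-r..r}|lebesgue. m t) < ereal (real n)"
      by (rule le_less_trans[OF SUP_upper[OF m(1)] n])
    moreover have "(LINT t:{a..b}|lebesgue. m t) \<le> (LINT t:{-r..r}|lebesgue. m t)"
      using bd[OF m(2)] r by (intro set_integral_subset_le) (auto simp: L1loc_set_integrable)
    ultimately have "(LINT t:{a..b}|lebesgue. m t) \<le> real n"
      by simp
    with m(2) show "\<exists>m. bd (rep F) (l1cball j) m \<and> (LINT t:{a..b}|lebesgue. m t) \<le> real n"
      by blast
  qed simp
qed

lemma l_bounded_if_L1loc_bounded:
  assumes "L1loc_bounded (l_bound U) E"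
  shows "l_bounded U E"
  unfolding l_bounded_def
proof (intro allI impI)
  fix j :: nat and a b :: real assume "1 \<le> j"
  then show "\<exists>c\<ge>0. \<forall>F\<in>E. \<exists>l. l_bound U (rep F) (l1cball j) l \<and> (LINT t:{a..b}|lebesgue. l t) \<le> c"
    by (intro L1loc_bounded_const[OF _ assms]) (simp_all add: l_bound_def)
qed

text \<open>Take equal space points; the modulus vanishes at 0.\<close>

lemma l_bound_wrt_imp_l_bound:
  assumes \<theta>: "modulus \<theta>" and l: "l_bound_wrt \<theta> U f K l"
  shows "l_bound U f K l"
proof -
  have "AE t in lebesgue. \<forall>x1\<in>closure U. \<forall>x2\<in>closure U. \<forall>y1\<in>K. \<forall>y2\<in>K.
        l1norm (f t x1 y1 - f t x2 y2) \<le> l t * (\<theta> (l1norm (x1 - x2)) + l1norm (y1 - y2))"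
    using l by (simp add: l_bound_wrt_def)
  then have "AE t in lebesgue. \<forall>x\<in>closure U. \<forall>y1\<in>K. \<forall>y2\<in>K.
        l1norm (f t x y1 - f t x y2) \<le> l t * l1norm (y1 - y2)"
  proof eventually_elim
    case (elim t)
    show ?case
    proof (intro ballI)
      fix x y1 y2 assume "x \<in> closure U" "y1 \<in> K" "y2 \<in> K"
      then have "l1norm (f t x y1 - f t x y2) \<le> l t * (\<theta> (l1norm (x - x)) + l1norm (y1 - y2))"
        using elim by blast
      then show "l1norm (f t x y1 - f t x y2) \<le> l t * l1norm (y1 - y2)"
        using \<theta> by (simp add: modulus_def)
    qed
  qed
  then show ?thesis
    using l by (simp add: l_bound_wrt_def l_bound_def)
qed

lemma L1loc_bounded_wrt_const:
  assumes "L1loc_bounded (l_bound_wrt \<theta> U) E" "1 \<le> j"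
  shows "\<exists>c\<ge>0. \<forall>F\<in>E. \<exists>l. l_bound_wrt \<theta> U (rep F) (l1cball j) l \<and> (LINT t:{a..b}|lebesgue. l t) \<le> c"
  by (rule L1loc_bounded_const[OF _ assms]) (simp add: l_bound_wrt_def)

lemma l_bounded_if_L1loc_bounded_wrt:
  assumes \<theta>: "modulus \<theta>" and E: "L1loc_bounded (l_bound_wrt \<theta> U) E"
  shows "l_bounded U E"
  unfolding l_bounded_def
proof (intro allI impI)
  fix j :: nat and a b :: real assume j: "1 \<le> j"
  obtain c where c: "0 \<le> c"
    "\<forall>F\<in>E. \<exists>l. l_bound_wrt \<theta> U (rep F) (l1cball j) l \<and> (LINT t:{a..b}|lebesgue. l t) \<le> c"
    using L1loc_bounded_wrt_const[OF E j, of a b] by (elim exE conjE)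
  then show "\<exists>c\<ge>0. \<forall>F\<in>E. \<exists>l. l_bound U (rep F) (l1cball j) l \<and> (LINT t:{a..b}|lebesgue. l t) \<le> c"
    using l_bound_wrt_imp_l_bound[OF \<theta>] by meson
qed

text \<open>Take equal values \<open>y\<close>, so that only the modulus of the distance in space
  remains. It is below \<open>e\<close> for near points, and \<open>e\<close> times the
  \<open>l\<close>-bound serves as \<open>w\<close>; the radius comes from \<theta> and the common
  constant \<open>c\<close> alone.\<close>

lemma x_equicontinuous_if_L1loc_bounded_wrt:
  assumes \<theta>: "modulus \<theta>" and E: "L1loc_bounded (l_bound_wrt \<theta> U) E"
  shows "x_equicontinuous U E"
  unfolding x_equicontinuous_def
proof (intro allI impI)
  fix y :: "real ^ 'b" and a b \<epsilon> :: real assume \<epsilon>: "0 < \<epsilon>"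
  obtain j where j: "1 \<le> j" "y \<in> l1cball j"
    using ex_l1cball by blast
  obtain c where c: "0 \<le> c"
    "\<forall>F\<in>E. \<exists>l. l_bound_wrt \<theta> U (rep F) (l1cball j) l \<and> (LINT t:{a..b}|lebesgue. l t) \<le> c"
    using L1loc_bounded_wrt_const[OF E j(1), of a b] by (elim exE conjE)
  define e where "e = \<epsilon> / (c + 1)"
  have e: "0 < e" "e * c \<le> \<epsilon>"
    using \<epsilon> c(1) by (simp_all add: e_def field_simps)
  obtain r where r: "0 < r" "\<And>s. 0 \<le> s \<Longrightarrow> s < r \<Longrightarrow> \<theta> s < e"
    using modulus_small[OF \<theta> e(1)] by metis
  show "\<exists>\<delta>>0. \<forall>F\<in>E. \<exists>w.
     set_integrable lebesgue {a..b} w \<and> (LINT t:{a..b}|lebesgue. w t) \<le> \<epsilon> \<and>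
     (AE t in lebesgue. t \<in> {a..b} \<longrightarrow> (\<forall>x1\<in>closure U. \<forall>x2\<in>closure U. l1norm (x1 - x2) < \<delta> \<longrightarrow>
        l1norm (rep F t x1 y - rep F t x2 y) \<le> w t))"
  proof (intro exI[of _ r] conjI r(1) ballI)
    fix F assume "F \<in> E"
    then obtain l where l: "l_bound_wrt \<theta> U (rep F) (l1cball j) l" "(LINT t:{a..b}|lebesgue. l t) \<le> c"
      using c(2) by blast
    show "\<exists>w. set_integrable lebesgue {a..b} w \<and> (LINT t:{a..b}|lebesgue. w t) \<le> \<epsilon> \<and>
     (AE t in lebesgue. t \<in> {a..b} \<longrightarrow> (\<forall>x1\<in>closure U. \<forall>x2\<in>closure U. l1norm (x1 - x2) < r \<longrightarrow>
        l1norm (rep F t x1 y - rep F t x2 y) \<le> w t))"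
    proof (intro exI[of _ "\<lambda>t. e * l t"] conjI)
      show "set_integrable lebesgue {a..b} (\<lambda>t. e * l t)"
        using l by (simp add: l_bound_wrt_def L1loc_set_integrable)
      have "e * (LINT t:{a..b}|lebesgue. l t) \<le> e * c"
        using l(2) e(1) by simp
      then show "(LINT t:{a..b}|lebesgue. e * l t) \<le> \<epsilon>"
        using e(2) by simp
      have "AE t in lebesgue. \<forall>x1\<in>closure U. \<forall>x2\<in>closure U. \<forall>y1\<in>l1cball j. \<forall>y2\<in>l1cball j.
        l1norm (rep F t x1 y1 - rep F t x2 y2) \<le> l t * (\<theta> (l1norm (x1 - x2)) + l1norm (y1 - y2))"
        using l by (simp add: l_bound_wrt_def)
      then show "AE t in lebesgue. t \<in> {a..b} \<longrightarrow> (\<forall>x1\<in>closure U. \<forall>x2\<in>closure U. l1norm (x1 - x2) < r \<longrightarrow>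
        l1norm (rep F t x1 y - rep F t x2 y) \<le> e * l t)"
      proof eventually_elim
        case (elim t)
        show ?case
        proof (intro impI ballI)
          fix x1 x2 assume x: "x1 \<in> closure U" "x2 \<in> closure U" "l1norm (x1 - x2) < r"
          have "l1norm (rep F t x1 y - rep F t x2 y) \<le> l t * (\<theta> (l1norm (x1 - x2)) + l1norm (y - y))"
            using elim x j(2) by blast
          also have "\<dots> \<le> l t * e"
            using r(2)[OF l1norm_nonneg x(3)] l(1) by (intro mult_left_mono) (auto simp: l_bound_wrt_def)
          finally show "l1norm (rep F t x1 y - rep F t x2 y) \<le> e * l t"
            by (simp add: mult.commute)
        qed
      qed
    qed
  qed
qed

lemma m_equicontinuous_if_L1loc_equicontinuous:
  assumes E: "L1loc_equicontinuous (m_bound U) E"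
  shows "m_equicontinuous U E"
  unfolding m_equicontinuous_def
proof (intro allI impI)
  fix j :: nat and a b \<epsilon> :: real assume j: "1 \<le> j" and \<epsilon>: "0 < \<epsilon>"
  define r where "r = max \<bar>a\<bar> \<bar>b\<bar> + 1"
  have r: "0 < r" "-r \<le> a" "b \<le> r"
    by (auto simp: r_def)
  obtain S \<delta> where S: "bounds_family (m_bound U) E j S" "0 < \<delta>"
    "\<forall>t1 t2. -r \<le> t1 \<and> t1 \<le> t2 \<and> t2 \<le> r \<and> t2 - t1 < \<delta> \<longrightarrow>
        (SUP m\<in>S. ereal (LINT t:{t1..t2}|lebesgue. m t)) < ereal \<epsilon>"
    using E j r(1) \<epsilon> unfolding L1loc_equicontinuous_def by metis
  show "\<exists>\<delta>>0. \<forall>F\<in>E. \<exists>m. m_bound U (rep F) (l1cball j) m \<and>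
     (\<forall>t1 t2. a \<le> t1 \<and> t1 \<le> t2 \<and> t2 \<le> b \<and> t2 - t1 < \<delta> \<longrightarrow> (LINT t:{t1..t2}|lebesgue. m t) < \<epsilon>)"
  proof (intro exI[of _ \<delta>] conjI S(2) ballI)
    fix F assume "F \<in> E"
    then obtain m where m: "m \<in> S" "m_bound U (rep F) (l1cball j) m"
      using S(1) unfolding bounds_family_def by blast
    have "(LINT t:{t1..t2}|lebesgue. m t) < \<epsilon>" if "a \<le> t1" "t1 \<le> t2" "t2 \<le> b" "t2 - t1 < \<delta>" for t1 t2
    proof -
      have "(SUP m\<in>S. ereal (LINT t:{t1..t2}|lebesgue. m t)) < ereal \<epsilon>"
        using S(3) r that by simp
      moreover have "ereal (LINT t:{t1..t2}|lebesgue. m t) \<le> (SUP m\<in>S. ereal (LINT t:{t1..t2}|lebesgue. m t))"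
        using m(1) by (rule SUP_upper)
      ultimately have "ereal (LINT t:{t1..t2}|lebesgue. m t) < ereal \<epsilon>"
        by (rule le_less_trans[rotated])
      then show ?thesis
        by simp
    qed
    with m(2) show "\<exists>m. m_bound U (rep F) (l1cball j) m \<and>
      (\<forall>t1 t2. a \<le> t1 \<and> t1 \<le> t2 \<and> t2 \<le> b \<and> t2 - t1 < \<delta> \<longrightarrow> (LINT t:{t1..t2}|lebesgue. m t) < \<epsilon>)"
      by blast
  qed
qed

section \<open>Adjoining one class to the family\<close>

lemma l_bounded_insert:
  assumes E: "l_bounded U E" and G: "G \<in> LC U"
  shows "l_bounded U (insert G E)"
  unfolding l_bounded_def
proof (intro allI impI)
  fix j :: nat and a b :: real assume j: "1 \<le> j"
  obtain c where c: "0 \<le> c" "\<forall>F\<in>E. \<exists>l.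
     l_bound U (rep F) (l1cball j) l \<and> (LINT t:{a..b}|lebesgue. l t) \<le> c"
    using E[unfolded l_bounded_def, rule_format, OF j, of a b] by (elim exE conjE)
  have "\<forall>K. compact K \<longrightarrow> (\<exists>l. l_bound U (rep G) K l)"
    using G by (simp add: LC_def LC_maps_def)
  then obtain l where l: "l_bound U (rep G) (l1cball j) l"
    using compact_l1cball[of j] by blast
  let ?c = "max c (LINT t:{a..b}|lebesgue. l t)"
  have "\<exists>l. l_bound U (rep F) (l1cball j) l \<and> (LINT t:{a..b}|lebesgue. l t) \<le> ?c" if "F \<in> insert G E" for F
  proof (cases "F = G")
    case True
    then show ?thesis
      using l by (intro exI[of _ l]) simp
  next
    case False
    then have "F \<in> E"
      using that by simp
    then obtain k where "l_bound U (rep F) (l1cball j) k" "(LINT t:{a..b}|lebesgue. k t) \<le> c"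
      using bspec[OF c(2), of F] by auto
    then show ?thesis
      by (intro exI[of _ k]) simp
  qed
  then show "\<exists>c\<ge>0. \<forall>F\<in>insert G E. \<exists>l. l_bound U (rep F) (l1cball j) l \<and> (LINT t:{a..b}|lebesgue. l t) \<le> c"
    using c(1) by (intro exI[of _ ?c]) simp
qed

text \<open>The indefinite integral is continuous on a compact interval, hence uniformly continuous.
  Thus a single \<open>m\<close>-bound meets the equicontinuity requirement by itself.\<close>

lemma L1loc_absolutely_continuous:
  assumes m: "m \<in> L1loc" and \<epsilon>: "0 < \<epsilon>"
  obtains \<delta> where "0 < \<delta>" "\<And>t1 t2. a \<le> t1 \<Longrightarrow> t1 \<le> t2 \<Longrightarrow> t2 \<le> b \<Longrightarrow> t2 - t1 < \<delta> \<Longrightarrow>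
    (LINT t:{t1..t2}|lebesgue. m t) < \<epsilon>"
proof -
  have int: "set_integrable lebesgue {p..q} m" for p q
    using m by (rule L1loc_set_integrable)
  let ?I = "\<lambda>t. integral {a..t} m"
  have "continuous_on {a..b} ?I"
    using set_lebesgue_integral_eq_integral(1)[OF int] by (rule indefinite_integral_continuous_1)
  then have "uniformly_continuous_on {a..b} ?I"
    by (rule compact_uniformly_continuous) simp
  then obtain \<delta> where \<delta>: "0 < \<delta>" "\<forall>t1\<in>{a..b}. \<forall>t2\<in>{a..b}. dist t2 t1 < \<delta> \<longrightarrow> dist (?I t2) (?I t1) < \<epsilon>"
    unfolding uniformly_continuous_on_def using \<epsilon> by metis
  show ?thesis
  proof (rule that[OF \<delta>(1)])
    fix t1 t2 assume t: "a \<le> t1" "t1 \<le> t2" "t2 \<le> b" "t2 - t1 < \<delta>"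
    have "dist (?I t2) (?I t1) < \<epsilon>"
      using \<delta>(2) t by (simp add: dist_real_def)
    moreover have "(LINT t:{t1..t2}|lebesgue. m t) = ?I t2 - ?I t1"
      using set_integral_combine[OF t(1,2) int] set_lebesgue_integral_eq_integral(2)[OF int] by simp
    ultimately show "(LINT t:{t1..t2}|lebesgue. m t) < \<epsilon>"
      by (simp add: dist_real_def)
  qed
qed

lemma m_equicontinuous_insert:
  assumes E: "m_equicontinuous U E" and G: "G \<in> LC U"
  shows "m_equicontinuous U (insert G E)"
  unfolding m_equicontinuous_def
proof (intro allI impI)
  fix j :: nat and a b \<epsilon> :: real assume j: "1 \<le> j" and \<epsilon>: "0 < \<epsilon>"
  let ?P = "\<lambda>F \<delta>. \<exists>m. m_bound U (rep F) (l1cball j) m \<and>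
     (\<forall>t1 t2. a \<le> t1 \<and> t1 \<le> t2 \<and> t2 \<le> b \<and> t2 - t1 < \<delta> \<longrightarrow> (LINT t:{t1..t2}|lebesgue. m t) < \<epsilon>)"
  obtain \<delta>1 where \<delta>1: "0 < \<delta>1" "\<forall>F\<in>E. ?P F \<delta>1"
    using E[unfolded m_equicontinuous_def, rule_format, OF j \<epsilon>, of a b] by (elim exE conjE)
  obtain m where m: "m_bound U (rep G) (l1cball j) m"
    using SC_maps_m_bound[OF rep_SC_maps[OF LC_imp_SC[OF G]]] .
  then have "m \<in> L1loc"
    by (simp add: m_bound_def)
  then obtain \<delta>2 where \<delta>2: "0 < \<delta>2" "\<And>t1 t2. a \<le> t1 \<Longrightarrow> t1 \<le> t2 \<Longrightarrow> t2 \<le> b \<Longrightarrow> t2 - t1 < \<delta>2 \<Longrightarrow>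
    (LINT t:{t1..t2}|lebesgue. m t) < \<epsilon>"
    using L1loc_absolutely_continuous[OF _ \<epsilon>, of m a b] by metis
  have "?P F (min \<delta>1 \<delta>2)" if "F \<in> insert G E" for F
  proof (cases "F = G")
    case True
    then show ?thesis
      using m \<delta>2(2) by (intro exI[of _ m]) simp
  next
    case False
    then have "F \<in> E"
      using that by simp
    then have "?P F \<delta>1"
      by (rule bspec[OF \<delta>1(2)])
    then obtain m' where "m_bound U (rep F) (l1cball j) m' \<and> (\<forall>t1 t2.
        a \<le> t1 \<and> t1 \<le> t2 \<and> t2 \<le> b \<and> t2 - t1 < \<delta>1 \<longrightarrow> (LINT t:{t1..t2}|lebesgue. m' t) < \<epsilon>)"
      by (elim exE)
    then show ?thesis
      by (intro exI[of _ m']) auto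
  qed
  then show "\<exists>\<delta>>0. \<forall>F\<in>insert G E. ?P F \<delta>"
    using \<delta>1(1) \<delta>2(1) by (intro exI[of _ "min \<delta>1 \<delta>2"]) simp
qed

section \<open>Oscillation in space of a single Caratheodory map\<close>

lemma l1norm_le_norm: "l1norm (y :: real ^ 'k::finite) \<le> real CARD('k) * norm y"
  unfolding l1norm_def using sum_bounded_above[of UNIV "\<lambda>i. \<bar>y $ i\<bar>" "norm y"] component_le_norm_cart[of y]
  by simp

text \<open>For almost every \<open>t\<close> the map \<open>f t _ y\<close> is uniformly continuous
  on the compact \<open>closure U\<close>, so its largest oscillation \<open>w n t\<close> over
  pairs closer than \<open>1 / (n + 1)\<close> tends to 0. Twice an \<open>m\<close>-bound dominates
  it; dominated convergence makes its integral small for some \<open>n\<close>, which gives both the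
  radius and \<open>w\<close>.\<close>

lemma SC_maps_x_oscillation:
  fixes f :: "('m::finite, 'n::finite) cmap"
  assumes U: "bounded U" "U \<noteq> {}" and f: "f \<in> SC_maps U" and \<epsilon>: "0 < \<epsilon>"
  obtains \<delta> w where "0 < \<delta>" "set_integrable lebesgue {a..b} w" "(LINT t:{a..b}|lebesgue. w t) \<le> \<epsilon>"
    "AE t in lebesgue. t \<in> {a..b} \<longrightarrow> (\<forall>x1\<in>closure U. \<forall>x2\<in>closure U. l1norm (x1 - x2) < \<delta> \<longrightarrow>
        l1norm (f t x1 y - f t x2 y) \<le> w t)"
proof -
  obtain j where j: "1 \<le> j" "y \<in> l1cball j"
    using ex_l1cball by blast
  note CBy = const_in_CB[OF U(2) j(2), of a b]
  obtain m where m: "m_bound U f (l1cball j) m"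
    using SC_maps_m_bound[OF f] .
  have m_int: "set_integrable lebesgue {a..b} m" and m0: "\<And>t. 0 \<le> m t"
    using m by (simp_all add: m_bound_def L1loc_set_integrable)
  obtain Y where Y: "countable Y" "Y \<subseteq> closure U" "closure U \<subseteq> closure Y"
    using separable .
  have clY: "closure Y = closure U"
    using Y(2,3) by (simp add: closure_minimal antisym)
  have "closure U \<noteq> {}"
    using U by simp
  then obtain y0 where y0: "y0 \<in> Y"
    using Y(3) by (metis closure_empty ex_in_conv subset_empty)
  define Nr where "Nr n = {p :: (real ^ 'm) \<times> (real ^ 'm). l1norm (fst p - snd p) < 1 / real (Suc n)}" for n
  \<comment> \<open>Only pairs from a countable dense set enter, so that the supremum
    \<open>w n\<close> is measurable.\<close>
  define P where "P n = (Y \<times> Y) \<inter> Nr n" for n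
  define \<psi> where "\<psi> t p = l1norm (f t (fst p) y - f t (snd p) y)" for t and p :: "(real ^ 'm) \<times> (real ^ 'm)"
  \<comment> \<open>With the indicator inside the supremum, \<open>w n\<close> vanishes outside the
    interval and is integrable on the whole line.\<close>
  define w where "w n t = (SUP p\<in>P n. indicat_real {a..b} t *\<^sub>R \<psi> t p)" for n t
  have P_ne: "P n \<noteq> {}" for n
    using y0 by (auto simp: P_def Nr_def intro!: exI[of _ y0])
  have P_sub: "p \<in> P n \<Longrightarrow> fst p \<in> closure U \<and> snd p \<in> closure U" for n p
    using Y(2) by (auto simp: P_def)
  have open_Nr: "open (Nr n)" for n
    unfolding Nr_def by (intro open_Collect_less continuous_intros)
  have le_m: "AE t in lebesgue. \<forall>x\<in>closure U. \<forall>z\<in>l1cball j. l1norm (f t x z) \<le> m t"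
    using m by (simp add: m_bound_def)
  have cont: "AE t in lebesgue. continuous_on (closure U) (\<lambda>x. f t x y)"
  proof -
    have "AE t in lebesgue. continuous_on (closure U \<times> UNIV) (\<lambda>(x, y). f t x y)"
      using f by (simp add: SC_maps_def)
    then show ?thesis
      by eventually_elim (rule continuous_on_superposition, simp_all)
  qed
  have bound: "AE t in lebesgue. \<forall>n. \<forall>p\<in>P n. indicat_real {a..b} t *\<^sub>R \<psi> t p \<le> 2 * (indicat_real {a..b} t *\<^sub>R m t)"
    using le_m
  proof eventually_elim
    case (elim t)
    show ?case
    proof (intro allI ballI)
      fix n p assume "p \<in> P n"
      then have "l1norm (f t (fst p) y) \<le> m t" "l1norm (f t (snd p) y) \<le> m t"
        using P_sub elim j(2) by blast+
      then have "\<psi> t p \<le> 2 * m t"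
        using l1norm_diff_le[of "f t (fst p) y" "f t (snd p) y"] by (simp add: \<psi>_def)
      then show "indicat_real {a..b} t *\<^sub>R \<psi> t p \<le> 2 * (indicat_real {a..b} t *\<^sub>R m t)"
        by (simp add: indicator_def)
    qed
  qed
  have w_meas: "w n \<in> borel_measurable lebesgue" for n
  proof (rule borel_measurable_cSUP_AE)
    show "countable (P n)"
      unfolding P_def using Y(1) by blast
    show "(\<lambda>t. indicat_real {a..b} t *\<^sub>R \<psi> t p) \<in> borel_measurable lebesgue" if "p \<in> P n" for p
      using set_integrable_l1norm[OF set_integral_diff(1)[OF
          set_integrable_superposition[OF f CBy, of "fst p"] set_integrable_superposition[OF f CBy, of "snd p"]]]
        P_sub[OF that] by (simp add: set_integrable_def \<psi>_def)
    show "AE t in lebesgue. bdd_above ((\<lambda>p. indicat_real {a..b} t *\<^sub>R \<psi> t p) ` P n)"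
      using bound by eventually_elim (rule bdd_aboveI2, blast)
    show "AE t in lebesgue. w n t = (SUP p\<in>P n. indicat_real {a..b} t *\<^sub>R \<psi> t p)"
      by (simp add: w_def)
  qed
  have w0: "AE t in lebesgue. \<forall>n. 0 \<le> w n t"
    using bound
  proof eventually_elim
    case (elim t)
    show ?case
    proof
      fix n
      obtain p where p: "p \<in> P n"
        using P_ne by blast
      have "0 \<le> indicat_real {a..b} t *\<^sub>R \<psi> t p"
        by (simp add: \<psi>_def)
      also have "\<dots> \<le> w n t"
        unfolding w_def by (rule cSUP_upper[OF p bdd_aboveI2]) (use elim in blast)
      finally show "0 \<le> w n t" .
    qed
  qed
  have dom_int: "integrable lebesgue (\<lambda>t. 2 * (indicat_real {a..b} t *\<^sub>R m t))"
    using m_int by (simp add: set_integrable_def)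
  have dom: "AE t in lebesgue. norm (w n t) \<le> 2 * (indicat_real {a..b} t *\<^sub>R m t)" for n
    using bound w0
  proof eventually_elim
    case (elim t)
    have "w n t \<le> 2 * (indicat_real {a..b} t *\<^sub>R m t)"
      unfolding w_def by (rule cSUP_least[OF P_ne]) (use elim(1) in blast)
    then show ?case
      using elim(2) by simp
  qed
  have w_int: "integrable lebesgue (w n)" for n
    using dom_int w_meas
  proof (rule Bochner_Integration.integrable_bound)
    show "AE t in lebesgue. norm (w n t) \<le> norm (2 * (indicat_real {a..b} t *\<^sub>R m t))"
      using dom[of n] by eventually_elim simp
  qed
  have "(\<lambda>n. \<integral>t. w n t \<partial>lebesgue) \<longlonglongrightarrow> (\<integral>t. 0 \<partial>(lebesgue :: real measure))"
  proof (rule integral_dominated_convergence[OF _ w_meas dom_int _ dom])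
    show "AE t in lebesgue. (\<lambda>n. w n t) \<longlonglongrightarrow> 0"
      using cont w0
    proof eventually_elim
      case (elim t)
      have uc: "uniformly_continuous_on (closure U) (\<lambda>x. f t x y)"
        using elim(1) U by (intro compact_uniformly_continuous) simp_all
      show ?case
      proof (rule LIMSEQ_I)
        fix e :: real assume e: "0 < e"
        \<comment> \<open>Uniform continuity yields a Euclidean estimate; passing to the
          \<open>l1norm\<close> costs the dimension, and the 2 leaves a strict inequality.\<close>
        define e' where "e' = e / (2 * real CARD('n))"
        have e': "0 < e'" "real CARD('n) * e' < e"
          using e by (simp_all add: e'_def)
        obtain r where r: "0 < r" "\<forall>x\<in>closure U. \<forall>x'\<in>closure U. dist x' x < r \<longrightarrow> dist (f t x' y) (f t x y) < e'"
          using uc e'(1) unfolding uniformly_continuous_on_def by metis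
        obtain N where N: "inverse (real (Suc N)) < r"
          using reals_Archimedean[OF r(1)] by blast
        have "w n t \<le> real CARD('n) * e'" if "N \<le> n" for n
          unfolding w_def
        proof (rule cSUP_least[OF P_ne])
          fix p assume p: "p \<in> P n"
          have "norm (fst p - snd p) \<le> l1norm (fst p - snd p)"
            by (rule norm_le_l1norm)
          also have "\<dots> < inverse (real (Suc n))"
            using p by (simp add: P_def Nr_def inverse_eq_divide)
          also have "\<dots> \<le> inverse (real (Suc N))"
            using that by (intro le_imp_inverse_le) simp_all
          finally have "dist (fst p) (snd p) < r"
            using N by (simp add: dist_norm)
          then have "dist (f t (fst p) y) (f t (snd p) y) < e'"
            using r(2) P_sub[OF p] by blast
          then have "real CARD('n) * norm (f t (fst p) y - f t (snd p) y) \<le> real CARD('n) * e'"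
            by (intro mult_left_mono) (simp_all add: dist_norm)
          then have "\<psi> t p \<le> real CARD('n) * e'"
            unfolding \<psi>_def using l1norm_le_norm order_trans by blast
          then show "indicat_real {a..b} t *\<^sub>R \<psi> t p \<le> real CARD('n) * e'"
            using e'(1) by (simp add: indicator_def)
        qed
        then show "\<exists>N. \<forall>n\<ge>N. norm (w n t - 0) < e"
          using elim(2) e'(2) by (intro exI[of _ N]) force
      qed
    qed
  qed simp
  then obtain N where "\<forall>n\<ge>N. norm ((\<integral>t. w n t \<partial>lebesgue) - 0) < \<epsilon>"
    using LIMSEQ_D[OF _ \<epsilon>, of "\<lambda>n. \<integral>t. w n t \<partial>lebesgue" 0] by auto
  then have N: "(\<integral>t. w N t \<partial>lebesgue) \<le> \<epsilon>"
    by force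
  have w_ind: "(\<lambda>t. indicat_real {a..b} t *\<^sub>R w N t) = w N"
    using P_ne[of N] by (auto simp: w_def fun_eq_iff indicator_def)
  show ?thesis
  proof (rule that)
    show "0 < 1 / real (Suc N)"
      by simp
    show "set_integrable lebesgue {a..b} (w N)"
      unfolding set_integrable_def w_ind by (rule w_int)
    show "(LINT t:{a..b}|lebesgue. w N t) \<le> \<epsilon>"
      unfolding set_lebesgue_integral_def w_ind by (rule N)
    show "AE t in lebesgue. t \<in> {a..b} \<longrightarrow> (\<forall>x1\<in>closure U. \<forall>x2\<in>closure U.
        l1norm (x1 - x2) < 1 / real (Suc N) \<longrightarrow> l1norm (f t x1 y - f t x2 y) \<le> w N t)"
      using bound cont
    proof eventually_elim
      case (elim t)
      show ?case
      proof (intro impI ballI)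
        fix x1 x2
        assume t: "t \<in> {a..b}" and x: "x1 \<in> closure U" "x2 \<in> closure U" "l1norm (x1 - x2) < 1 / real (Suc N)"
        \<comment> \<open>The strict inequality makes \<open>Nr N\<close> open, so a pair in it that
          is a limit of pairs from \<open>Y \<times> Y\<close> is a limit of pairs from
          \<open>P N\<close>; continuity extends the bound to it.\<close>
        have "(x1, x2) \<in> Nr N \<inter> closure (Y \<times> Y)"
          using x clY by (simp add: Nr_def closure_Times)
        then have mem: "(x1, x2) \<in> closure (P N)"
          using open_Int_closure_subset[OF open_Nr, of N "Y \<times> Y"] by (auto simp: P_def Int_commute)
        have "closure (P N) \<subseteq> closure (Y \<times> Y)"
          by (intro closure_mono) (auto simp: P_def)
        then have sub: "closure (P N) \<subseteq> closure U \<times> closure U"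
          using clY by (simp add: closure_Times)
        have "continuous_on (closure (P N)) (\<psi> t)"
          unfolding \<psi>_def using sub
          by (intro continuous_on_l1norm continuous_on_diff continuous_on_compose2[OF elim(2)]
              continuous_on_fst continuous_on_snd continuous_on_id) auto
        then have "\<psi> t (x1, x2) \<le> w N t"
          using mem
        proof (rule continuous_le_on_closure)
          fix p assume p: "p \<in> P N"
          have "indicat_real {a..b} t *\<^sub>R \<psi> t p \<le> w N t"
            unfolding w_def by (rule cSUP_upper[OF p bdd_aboveI2]) (use elim(1) in blast)
          then show "\<psi> t p \<le> w N t"
            using t by simp
        qed
        then show "l1norm (f t x1 y - f t x2 y) \<le> w N t"
          by (simp add: \<psi>_def)
      qed
    qed
  qed
qed

lemma x_equicontinuous_insert:
  assumes U: "bounded U" "U \<noteq> {}" and E: "x_equicontinuous U E" and G: "G \<in> LC U"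
  shows "x_equicontinuous U (insert G E)"
  unfolding x_equicontinuous_def
proof (intro allI impI)
  fix y :: "real ^ 'b" and a b \<epsilon> :: real assume \<epsilon>: "0 < \<epsilon>"
  let ?P = "\<lambda>F \<delta> w. set_integrable lebesgue {a..b} w \<and> (LINT t:{a..b}|lebesgue. w t) \<le> \<epsilon> \<and>
     (AE t in lebesgue. t \<in> {a..b} \<longrightarrow> (\<forall>x1\<in>closure U. \<forall>x2\<in>closure U. l1norm (x1 - x2) < \<delta> \<longrightarrow>
        l1norm (rep F t x1 y - rep F t x2 y) \<le> w t))"
  have weaken: "?P F \<delta> w" if "?P F \<delta>' w" "\<delta> \<le> \<delta>'" for F w and \<delta> \<delta>' :: real
  proof -
    have "AE t in lebesgue. t \<in> {a..b} \<longrightarrow> (\<forall>x1\<in>closure U. \<forall>x2\<in>closure U. l1norm (x1 - x2) < \<delta>' \<longrightarrow>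
        l1norm (rep F t x1 y - rep F t x2 y) \<le> w t)"
      using that(1) by blast
    then have "AE t in lebesgue. t \<in> {a..b} \<longrightarrow> (\<forall>x1\<in>closure U. \<forall>x2\<in>closure U. l1norm (x1 - x2) < \<delta> \<longrightarrow>
        l1norm (rep F t x1 y - rep F t x2 y) \<le> w t)"
      by eventually_elim (use that(2) in \<open>meson less_le_trans\<close>)
    then show ?thesis
      using that(1) by blast
  qed
  obtain \<delta>1 where \<delta>1: "0 < \<delta>1" "\<forall>F\<in>E. \<exists>w. ?P F \<delta>1 w"
    using E[unfolded x_equicontinuous_def, rule_format, OF \<epsilon>, of a b y] by (elim exE conjE)
  obtain \<delta>2 w2 where \<delta>2: "0 < \<delta>2" "?P G \<delta>2 w2"
    by (rule SC_maps_x_oscillation[OF U rep_SC_maps[OF LC_imp_SC[OF G]] \<epsilon>, of a b y]) blast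
  have "\<exists>w. ?P F (min \<delta>1 \<delta>2) w" if F: "F \<in> insert G E" for F
  proof (cases "F = G")
    case True
    then show ?thesis
      using weaken[OF \<delta>2(2), of "min \<delta>1 \<delta>2"] by (intro exI[of _ w2]) simp
  next
    case False
    then have "F \<in> E"
      using F by simp
    then have "\<exists>w. ?P F \<delta>1 w"
      by (rule bspec[OF \<delta>1(2)])
    then obtain w where w: "?P F \<delta>1 w"
      by (elim exE)
    show ?thesis
      using weaken[OF w, of "min \<delta>1 \<delta>2"] by (intro exI[of _ w]) simp
  qed
  then show "\<exists>\<delta>>0. \<forall>F\<in>insert G E. \<exists>w. ?P F \<delta> w"
    using \<delta>1(1) \<delta>2(1) by (intro exI[of _ "min \<delta>1 \<delta>2"]) simp
qed

section \<open>Coincidence of the topologies\<close>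

text \<open>Records the two facts by which balls are recentred: the triangle inequality between
  three maps and the value 0 at the zero map.\<close>

definition seminorm_on :: "(real ^ 'm) set \<Rightarrow> (('m::finite, 'n::finite) cmap \<Rightarrow> real) \<Rightarrow> bool" where
  "seminorm_on U p \<longleftrightarrow> (\<forall>f\<in>SC_maps U. \<forall>g\<in>SC_maps U. \<forall>h\<in>SC_maps U.
     p (cdiff f h) \<le> p (cdiff f g) + p (cdiff g h)) \<and> p (\<lambda>_ _ _. 0) = 0"

lemma seminorm_on_strong_sn:
  assumes "V \<noteq> {}" "V \<subseteq> CB U j (a, b)" "X \<subseteq> closure U" "X \<noteq> {}"
  shows "seminorm_on U (strong_sn X V a b)"
  unfolding seminorm_on_def using strong_sn_triangle[OF _ _ _ assms] strong_sn_zero[OF assms(1,4)] by blast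

lemma seminorm_on_weak_sn:
  assumes "V \<noteq> {}" "V \<subseteq> CB U j (a, b)" "X \<subseteq> closure U" "X \<noteq> {}"
  shows "seminorm_on U (weak_sn X V a b)"
  unfolding seminorm_on_def using weak_sn_triangle[OF _ _ _ assms] weak_sn_zero[OF assms(1,4)] by blast

text \<open>\<open>P\<close> is the finer family. Each member of \<open>Q\<close> lies below one of
  \<open>P\<close>, so in that direction a single seminorm with the same radius suffices; the other
  direction is the finite control on \<open>E\<close>.\<close>

lemma seminorm_topologies_agree:
  fixes P Q :: "(('m::finite, 'n::finite) cmap \<Rightarrow> real) set"
  assumes E: "E \<subseteq> SC U"
    and P: "\<And>p. p \<in> P \<Longrightarrow> seminorm_on U p" and Q: "\<And>q. q \<in> Q \<Longrightarrow> seminorm_on U q"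
    and coarser: "\<And>q. q \<in> Q \<Longrightarrow> \<exists>p\<in>P. \<forall>d\<in>SC_maps U. q d \<le> p d"
    and control: "\<And>p F \<epsilon>. p \<in> P \<Longrightarrow> F \<in> E \<Longrightarrow> 0 < \<epsilon> \<Longrightarrow> \<exists>Q0 \<delta>. finite Q0 \<and> Q0 \<subseteq> Q \<and> 0 < \<delta> \<and>
      (\<forall>G\<in>E. (\<forall>q\<in>Q0. q (cdiff (rep G) (rep F)) < \<delta>) \<longrightarrow> p (cdiff (rep G) (rep F)) < \<epsilon>)"
  shows "subtopology (seminorm_topology U P) E = subtopology (seminorm_topology U Q) E"
  unfolding topology_eq
proof (intro allI iffI)
  show "openin (subtopology (seminorm_topology U Q) E) W"
    if "openin (subtopology (seminorm_topology U P) E) W" for W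
    by (rule openin_seminorm_topology_transfer[OF E _ _ control that])
      (use P Q in \<open>simp_all add: seminorm_on_def\<close>)
  show "openin (subtopology (seminorm_topology U P) E) W"
    if "openin (subtopology (seminorm_topology U Q) E) W" for W
  proof (rule openin_seminorm_topology_transfer[OF E _ _ _ that])
    fix q F and \<epsilon> :: real assume q: "q \<in> Q" and F: "F \<in> E" and \<epsilon>: "0 < \<epsilon>"
    obtain p where p: "p \<in> P" "\<forall>d\<in>SC_maps U. q d \<le> p d"
      using coarser[OF q] by blast
    have "q (cdiff (rep G) (rep F)) < \<epsilon>" if "G \<in> E" "p (cdiff (rep G) (rep F)) < \<epsilon>" for G
    proof -
      have "cdiff (rep G) (rep F) \<in> SC_maps U"
        using E F that(1) by (intro SC_maps_diff rep_SC_maps) auto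
      then show ?thesis
        using p(2) that(2) le_less_trans by blast
    qed
    then show "\<exists>P0 \<delta>. finite P0 \<and> P0 \<subseteq> P \<and> 0 < \<delta> \<and>
      (\<forall>G\<in>E. (\<forall>p\<in>P0. p (cdiff (rep G) (rep F)) < \<delta>) \<longrightarrow> q (cdiff (rep G) (rep F)) < \<epsilon>)"
      using p(1) \<epsilon> by (intro exI[of _ "{p}"] exI[of _ \<epsilon>]) simp
  qed (use P Q in \<open>simp_all add: seminorm_on_def\<close>)
qed

text \<open>In this rewriting and the next six, \<open>supnorm\<close> unfolds to a supremum over
  \<open>closure U\<close>, and suprema over a single constant map or a single point collapse to
  their only value.\<close>

lemma T_B_eq: "T_B U = seminorm_topology U
    {strong_sn (closure U) (CB U j (a, b)) a b | a b j. (a, b) \<in> rat_ivls \<and> 1 \<le> j}"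
  by (simp add: T_B_def strong_sn_def[abs_def] strong_int_def supnorm_def)

lemma T_Theta_eq: "T_Theta U \<Theta>1 \<Theta>2 = seminorm_topology U
    {strong_sn (closure U) (HH U \<Theta>1 \<Theta>2 j (a, b)) a b | a b j. (a, b) \<in> rat_ivls \<and> 1 \<le> j}"
  by (simp add: T_Theta_def strong_sn_def[abs_def] strong_int_def supnorm_def)

lemma T_D_eq: "T_D U D = seminorm_topology U
    {strong_sn (closure U) {\<lambda>_ _. y} a b | a b y. (a, b) \<in> rat_ivls \<and> y \<in> D}"
  by (simp add: T_D_def strong_sn_def[abs_def] strong_int_def supnorm_def)

lemma T_DD_eq: "T_DD U D' D = seminorm_topology U
    {strong_sn {x} {\<lambda>_ _. y} a b | a b x y. (a, b) \<in> rat_ivls \<and> x \<in> D' \<and> y \<in> D}"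
  by (simp add: T_DD_def strong_sn_def[abs_def] strong_int_def)

lemma sigma_Theta_eq: "sigma_Theta U \<Theta>1 \<Theta>2 = seminorm_topology U
    {weak_sn (closure U) (HH U \<Theta>1 \<Theta>2 j (a, b)) a b | a b j. (a, b) \<in> rat_ivls \<and> 1 \<le> j}"
  by (simp add: sigma_Theta_def weak_sn_def[abs_def] supnorm_def)

lemma sigma_D_eq: "sigma_D U D = seminorm_topology U
    {weak_sn (closure U) {\<lambda>_ _. y} a b | a b y. (a, b) \<in> rat_ivls \<and> y \<in> D}"
  by (simp add: sigma_D_def weak_sn_def[abs_def] supnorm_def)

lemma sigma_DD_eq: "sigma_DD U D' D = seminorm_topology U
    {weak_sn {x} {\<lambda>_ _. y} a b | a b x y. (a, b) \<in> rat_ivls \<and> x \<in> D' \<and> y \<in> D}"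
  by (simp add: sigma_DD_def weak_sn_def[abs_def])

section \<open>Pairwise comparison of the topologies on a family\<close>

lemma ex_const_subset_HH:
  assumes "U \<noteq> {}" "suitable_moduli \<Theta>1 \<Theta>2" "(a, b) \<in> rat_ivls"
  obtains j where "1 \<le> j" "{\<lambda>_ _. y} \<subseteq> HH U \<Theta>1 \<Theta>2 j (a, b)"
proof -
  obtain j where j: "1 \<le> j" "y \<in> l1cball j"
    using ex_l1cball by blast
  then show ?thesis
    using that[of j] const_in_HH[OF assms(1,2) j(1) assms(3) j(2)] by simp
qed

lemma HH_nonempty:
  assumes "U \<noteq> {}" "suitable_moduli \<Theta>1 \<Theta>2" "(a, b) \<in> rat_ivls" "1 \<le> j"
  shows "HH U \<Theta>1 \<Theta>2 j (a, b) \<noteq> {}"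
  using const_in_HH[OF assms(1,2,4,3) zero_in_l1cball] by blast

text \<open>\<open>V\<close> stands for any choice between \<open>HH\<close> and \<open>CB\<close>,
  so one argument covers both \<open>T_Theta\<close> and \<open>T_B\<close>: the lower bound
  supplies the constant maps, the upper one lets the control over \<open>CB\<close> apply.\<close>

lemma strong_topologies_agree:
  fixes E :: "('m::finite, 'n::finite) cmap set set"
  assumes U: "U \<noteq> {}" and D: "closure D = UNIV" and \<Theta>: "suitable_moduli \<Theta>1 \<Theta>2"
    and E: "E \<subseteq> LC U" "l_bounded U E"
    and V: "\<And>a b j. (a, b) \<in> rat_ivls \<Longrightarrow> 1 \<le> j \<Longrightarrow>
      HH U \<Theta>1 \<Theta>2 j (a, b) \<subseteq> V j a b \<and> V j a b \<subseteq> CB U j (a, b)"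
  shows "subtopology (seminorm_topology U
      {strong_sn (closure U) (V j a b) a b | a b j. (a, b) \<in> rat_ivls \<and> 1 \<le> j}) E = subtopology (T_D U D) E"
  unfolding T_D_eq
proof (rule seminorm_topologies_agree)
  have U': "closure U \<noteq> {}"
    using U by simp
  have V_ne: "V j a b \<noteq> {}" if "(a, b) \<in> rat_ivls" "1 \<le> j" for a b j
    using HH_nonempty[OF U \<Theta> that] V[OF that] by blast
  show "E \<subseteq> SC U"
    using E by (auto simp: LC_def)
  show "seminorm_on U p" if mem: "p \<in> {strong_sn (closure U) (V j a b) a b | a b j. (a, b) \<in> rat_ivls \<and> 1 \<le> j}" for p
  proof -
    obtain a b j where p: "p = strong_sn (closure U) (V j a b) a b" and "(a, b) \<in> rat_ivls" "1 \<le> j"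
      using mem unfolding mem_Collect_eq by (elim exE conjE)
    then show ?thesis
      unfolding p using V V_ne by (intro seminorm_on_strong_sn[OF _ _ order_refl U']) blast+
  qed
  show "seminorm_on U q"
    if mem: "q \<in> {strong_sn (closure U) {\<lambda>_ _. y} a b | a b y. (a, b) \<in> rat_ivls \<and> y \<in> D}" for q
  proof -
    obtain a b y where q: "q = strong_sn (closure U) {\<lambda>_ _. y} a b" and ab: "(a, b) \<in> rat_ivls" and y: "y \<in> D"
      using mem unfolding mem_Collect_eq by (elim exE conjE)
    obtain j where "y \<in> l1cball j"
      using ex_l1cball by blast
    then show ?thesis
      unfolding q using const_in_CB[OF U] by (intro seminorm_on_strong_sn[OF _ _ order_refl U']) auto
  qed
  show "\<exists>p\<in>{strong_sn (closure U) (V j a b) a b | a b j. (a, b) \<in> rat_ivls \<and> 1 \<le> j}. \<forall>d\<in>SC_maps U. q d \<le> p d"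
    if mem: "q \<in> {strong_sn (closure U) {\<lambda>_ _. y} a b | a b y. (a, b) \<in> rat_ivls \<and> y \<in> D}" for q
  proof -
    obtain a b y where q: "q = strong_sn (closure U) {\<lambda>_ _. y} a b" and ab: "(a, b) \<in> rat_ivls" and y: "y \<in> D"
      using mem unfolding mem_Collect_eq by (elim exE conjE)
    obtain j where j: "1 \<le> j" "{\<lambda>_ _. y} \<subseteq> HH U \<Theta>1 \<Theta>2 j (a, b)"
      using ex_const_subset_HH[OF U \<Theta> ab] .
    then have sub: "{\<lambda>_ _. y} \<subseteq> V j a b" "V j a b \<subseteq> CB U j (a, b)"
      using V[OF ab j(1)] by auto
    have "\<forall>d\<in>SC_maps U. q d \<le> strong_sn (closure U) (V j a b) a b d"
      unfolding q using strong_sn_mono[OF _ _ sub U' order_refl order_refl] by blast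
    then show ?thesis
      using ab j(1) by blast
  qed
  show "\<exists>Q0 \<delta>. finite Q0 \<and> Q0 \<subseteq> {strong_sn (closure U) {\<lambda>_ _. y} a b | a b y. (a, b) \<in> rat_ivls \<and> y \<in> D} \<and>
      0 < \<delta> \<and> (\<forall>G\<in>E. (\<forall>q\<in>Q0. q (cdiff (rep G) (rep F)) < \<delta>) \<longrightarrow> p (cdiff (rep G) (rep F)) < \<epsilon>)"
    if p: "p \<in> {strong_sn (closure U) (V j a b) a b | a b j. (a, b) \<in> rat_ivls \<and> 1 \<le> j}"
      and F: "F \<in> E" and \<epsilon>: "0 < \<epsilon>" for p F \<epsilon>
  proof -
    obtain a b j where p: "p = strong_sn (closure U) (V j a b) a b" and ab: "(a, b) \<in> rat_ivls" and j: "1 \<le> j"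
      using p unfolding mem_Collect_eq by (elim exE conjE)
    obtain Y \<delta> where Y: "finite Y" "Y \<subseteq> D" "0 < \<delta>" "\<forall>G\<in>E.
      (\<forall>y\<in>Y. strong_sn (closure U) {\<lambda>_ _. y} a b (cdiff (rep G) (rep F)) < \<delta>) \<longrightarrow>
      strong_sn (closure U) (CB U j (a, b)) a b (cdiff (rep G) (rep F)) < \<epsilon>"
      using strong_sn_CB_control[OF U D E F \<epsilon> j, of a b] by (elim exE conjE)
    let ?Q0 = "(\<lambda>y. strong_sn (closure U) {\<lambda>_ _. y} a b) ` Y"
    have "p (cdiff (rep G) (rep F)) < \<epsilon>" if G: "G \<in> E" and "\<forall>q\<in>?Q0. q (cdiff (rep G) (rep F)) < \<delta>" for G
    proof -
      have d: "cdiff (rep G) (rep F) \<in> SC_maps U"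
        using E F G by (intro SC_maps_diff rep_SC_maps LC_imp_SC) auto
      have sub: "V j a b \<subseteq> CB U j (a, b)"
        using V[OF ab j] by blast
      have "p (cdiff (rep G) (rep F)) \<le> strong_sn (closure U) (CB U j (a, b)) a b (cdiff (rep G) (rep F))"
        unfolding p by (rule strong_sn_mono[OF d V_ne[OF ab j] sub order_refl U' order_refl order_refl])
      also have "\<dots> < \<epsilon>"
        using bspec[OF Y(4) G] that(2) by simp
      finally show ?thesis .
    qed
    moreover have "?Q0 \<subseteq> {strong_sn (closure U) {\<lambda>_ _. y} a b | a b y. (a, b) \<in> rat_ivls \<and> y \<in> D}"
      using Y(2) ab by blast
    ultimately show ?thesis
      using Y(1,3) by (intro exI[of _ ?Q0] exI[of _ \<delta>]) simp
  qed
qed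

lemma sigma_D_agrees_sigma_Theta:
  fixes E :: "('m::finite, 'n::finite) cmap set set"
  assumes U: "U \<noteq> {}" and D: "closure D = UNIV" and \<Theta>: "suitable_moduli \<Theta>1 \<Theta>2"
    and E: "E \<subseteq> LC U" "l_bounded U E" "m_equicontinuous U E"
  shows "subtopology (sigma_D U D) E = subtopology (sigma_Theta U \<Theta>1 \<Theta>2) E"
  unfolding sigma_D_eq sigma_Theta_eq
\<comment> \<open>The equation is reversed because the criterion expects the finer family on the
  left.\<close>
proof (rule sym, rule seminorm_topologies_agree)
  have U': "closure U \<noteq> {}"
    using U by simp
  show "E \<subseteq> SC U"
    using E by (auto simp: LC_def)
  show "seminorm_on U p"
    if mem: "p \<in> {weak_sn (closure U) (HH U \<Theta>1 \<Theta>2 j (a, b)) a b | a b j. (a, b) \<in> rat_ivls \<and> 1 \<le> j}" for p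
  proof -
    obtain a b j where p: "p = weak_sn (closure U) (HH U \<Theta>1 \<Theta>2 j (a, b)) a b"
      and "(a, b) \<in> rat_ivls" "1 \<le> j"
      using mem unfolding mem_Collect_eq by (elim exE conjE)
    then show ?thesis
      unfolding p by (intro seminorm_on_weak_sn[OF _ HH_subset_CB order_refl U'] HH_nonempty[OF U \<Theta>])
  qed
  show "seminorm_on U q"
    if mem: "q \<in> {weak_sn (closure U) {\<lambda>_ _. y} a b | a b y. (a, b) \<in> rat_ivls \<and> y \<in> D}" for q
  proof -
    obtain a b y where q: "q = weak_sn (closure U) {\<lambda>_ _. y} a b" and ab: "(a, b) \<in> rat_ivls" and y: "y \<in> D"
      using mem unfolding mem_Collect_eq by (elim exE conjE)
    obtain j where "y \<in> l1cball j"
      using ex_l1cball by blast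
    then show ?thesis
      unfolding q using const_in_CB[OF U] by (intro seminorm_on_weak_sn[OF _ _ order_refl U']) auto
  qed
  show "\<exists>p\<in>{weak_sn (closure U) (HH U \<Theta>1 \<Theta>2 j (a, b)) a b | a b j. (a, b) \<in> rat_ivls \<and> 1 \<le> j}.
      \<forall>d\<in>SC_maps U. q d \<le> p d"
    if mem: "q \<in> {weak_sn (closure U) {\<lambda>_ _. y} a b | a b y. (a, b) \<in> rat_ivls \<and> y \<in> D}" for q
  proof -
    obtain a b y where q: "q = weak_sn (closure U) {\<lambda>_ _. y} a b" and ab: "(a, b) \<in> rat_ivls" and y: "y \<in> D"
      using mem unfolding mem_Collect_eq by (elim exE conjE)
    obtain j where j: "1 \<le> j" "{\<lambda>_ _. y} \<subseteq> HH U \<Theta>1 \<Theta>2 j (a, b)"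
      using ex_const_subset_HH[OF U \<Theta> ab] .
    have "\<forall>d\<in>SC_maps U. q d \<le> weak_sn (closure U) (HH U \<Theta>1 \<Theta>2 j (a, b)) a b d"
      unfolding q using weak_sn_mono[OF _ _ j(2) HH_subset_CB U' order_refl order_refl] by blast
    then show ?thesis
      using ab j(1) by blast
  qed
  show "\<exists>Q0 \<delta>. finite Q0 \<and> Q0 \<subseteq> {weak_sn (closure U) {\<lambda>_ _. y} a b | a b y. (a, b) \<in> rat_ivls \<and> y \<in> D} \<and>
      0 < \<delta> \<and> (\<forall>G\<in>E. (\<forall>q\<in>Q0. q (cdiff (rep G) (rep F)) < \<delta>) \<longrightarrow> p (cdiff (rep G) (rep F)) < \<epsilon>)"
    if p: "p \<in> {weak_sn (closure U) (HH U \<Theta>1 \<Theta>2 j (a, b)) a b | a b j. (a, b) \<in> rat_ivls \<and> 1 \<le> j}"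
      and F: "F \<in> E" and \<epsilon>: "0 < \<epsilon>" for p F \<epsilon>
  proof -
    obtain a b j where p: "p = weak_sn (closure U) (HH U \<Theta>1 \<Theta>2 j (a, b)) a b"
      and ab: "(a, b) \<in> rat_ivls" and j: "1 \<le> j"
      using p unfolding mem_Collect_eq by (elim exE conjE)
    \<comment> \<open>An element of \<open>R\<close> pairs an interval with a point of
      \<open>D\<close>; \<open>?s\<close> is the seminorm it indexes.\<close>
    let ?s = "\<lambda>q. weak_sn (closure U) {\<lambda>_ _. snd q} (fst (fst q)) (snd (fst q))"
    obtain R \<delta> where R: "finite R" "R \<subseteq> rat_ivls \<times> D" "0 < \<delta>" "\<forall>G\<in>E.
      (\<forall>q\<in>R. ?s q (cdiff (rep G) (rep F)) < \<delta>) \<longrightarrow>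
      weak_sn (closure U) (HH U \<Theta>1 \<Theta>2 j (a, b)) a b (cdiff (rep G) (rep F)) < \<epsilon>"
      using weak_sn_HH_control[OF U D \<Theta> ab j E F \<epsilon>] by (elim exE conjE)
    have "p (cdiff (rep G) (rep F)) < \<epsilon>" if "G \<in> E" "\<forall>q\<in>?s ` R. q (cdiff (rep G) (rep F)) < \<delta>" for G
      unfolding p using bspec[OF R(4) that(1)] that(2) by simp
    moreover have "?s ` R \<subseteq> {weak_sn (closure U) {\<lambda>_ _. y} a b | a b y. (a, b) \<in> rat_ivls \<and> y \<in> D}"
    proof
      fix q assume "q \<in> ?s ` R"
      then obtain r where "r \<in> R" "q = ?s r"
        by blast
      then show "q \<in> {weak_sn (closure U) {\<lambda>_ _. y} a b | a b y. (a, b) \<in> rat_ivls \<and> y \<in> D}"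
        using R(2) by (intro CollectI exI[of _ "fst (fst r)"] exI[of _ "snd (fst r)"] exI[of _ "snd r"]) auto
    qed
    ultimately show ?thesis
      using R(1,3) by (intro exI[of _ "?s ` R"] exI[of _ \<delta>]) simp
  qed
qed

text \<open>Only the space variable is discretised: interval and value \<open>y\<close> are the same
  on both sides, and finitely many points of \<open>D'\<close> suffice for each seminorm of
  \<open>T_D\<close>.\<close>

lemma T_DD_agrees_T_D:
  fixes E :: "('m::finite, 'n::finite) cmap set set"
  assumes U: "bounded U" "U \<noteq> {}" and D': "D' \<subseteq> U" "U \<subseteq> closure D'"
    and E: "E \<subseteq> LC U" "x_equicontinuous U E"
  shows "subtopology (T_DD U D' D) E = subtopology (T_D U D) E"
  unfolding T_D_eq T_DD_eq
proof (rule sym, rule seminorm_topologies_agree)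
  have U': "closure U \<noteq> {}"
    using U by simp
  have D'U: "{x} \<subseteq> closure U" if "x \<in> D'" for x
    using D'(1) closure_subset that by auto
  have sn: "seminorm_on U (strong_sn X {\<lambda>_ _. y} a b)" if "X \<subseteq> closure U" "X \<noteq> {}"
    for X a b and y :: "real ^ 'n"
  proof -
    obtain j where "y \<in> l1cball j"
      using ex_l1cball by blast
    then show ?thesis
      using const_in_CB[OF U(2)] by (intro seminorm_on_strong_sn[OF _ _ that]) auto
  qed
  show "E \<subseteq> SC U"
    using E by (auto simp: LC_def)
  show "seminorm_on U p"
    if mem: "p \<in> {strong_sn (closure U) {\<lambda>_ _. y} a b | a b y. (a, b) \<in> rat_ivls \<and> y \<in> D}" for p
    using mem sn[OF order_refl U'] by blast
  show "seminorm_on U q"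
    if mem: "q \<in> {strong_sn {x} {\<lambda>_ _. y} a b | a b x y. (a, b) \<in> rat_ivls \<and> x \<in> D' \<and> y \<in> D}" for q
    using mem sn[OF D'U] by blast
  show "\<exists>p\<in>{strong_sn (closure U) {\<lambda>_ _. y} a b | a b y. (a, b) \<in> rat_ivls \<and> y \<in> D}. \<forall>d\<in>SC_maps U. q d \<le> p d"
    if mem: "q \<in> {strong_sn {x} {\<lambda>_ _. y} a b | a b x y. (a, b) \<in> rat_ivls \<and> x \<in> D' \<and> y \<in> D}" for q
  proof -
    obtain a b x y where q: "q = strong_sn {x} {\<lambda>_ _. y} a b"
      and ab: "(a, b) \<in> rat_ivls" and x: "x \<in> D'" and y: "y \<in> D"
      using mem unfolding mem_Collect_eq by (elim exE conjE)
    obtain j where "y \<in> l1cball j"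
      using ex_l1cball by blast
    then have "{\<lambda>_ _. y} \<subseteq> CB U j (a, b)"
      using const_in_CB[OF U(2)] by simp
    then have "strong_sn {x} {\<lambda>_ _. y} a b d \<le> strong_sn (closure U) {\<lambda>_ _. y} a b d" if "d \<in> SC_maps U" for d
      by (intro strong_sn_mono[OF that _ order_refl _ _ D'U[OF x] order_refl]) auto
    then show ?thesis
      unfolding q using ab y by blast
  qed
  show "\<exists>Q0 \<delta>. finite Q0 \<and>
      Q0 \<subseteq> {strong_sn {x} {\<lambda>_ _. y} a b | a b x y. (a, b) \<in> rat_ivls \<and> x \<in> D' \<and> y \<in> D} \<and>
      0 < \<delta> \<and> (\<forall>G\<in>E. (\<forall>q\<in>Q0. q (cdiff (rep G) (rep F)) < \<delta>) \<longrightarrow> p (cdiff (rep G) (rep F)) < \<epsilon>)"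
    if mem: "p \<in> {strong_sn (closure U) {\<lambda>_ _. y} a b | a b y. (a, b) \<in> rat_ivls \<and> y \<in> D}"
      and F: "F \<in> E" and \<epsilon>: "0 < \<epsilon>" for p F \<epsilon>
  proof -
    obtain a b y where p: "p = strong_sn (closure U) {\<lambda>_ _. y} a b"
      and ab: "(a, b) \<in> rat_ivls" and y: "y \<in> D"
      using mem unfolding mem_Collect_eq by (elim exE conjE)
    obtain Y \<delta> where Y: "finite Y" "Y \<subseteq> D'" "0 < \<delta>" "\<forall>G\<in>E.
      (\<forall>x\<in>Y. strong_sn {x} {\<lambda>_ _. y} a b (cdiff (rep G) (rep F)) < \<delta>) \<longrightarrow>
      strong_sn (closure U) {\<lambda>_ _. y} a b (cdiff (rep G) (rep F)) < \<epsilon>"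
      using strong_sn_x_control[OF U D' E F \<epsilon>, of y a b] by (elim exE conjE)
    let ?Q0 = "(\<lambda>x. strong_sn {x} {\<lambda>_ _. y} a b) ` Y"
    have "p (cdiff (rep G) (rep F)) < \<epsilon>" if "G \<in> E" "\<forall>q\<in>?Q0. q (cdiff (rep G) (rep F)) < \<delta>" for G
      unfolding p using bspec[OF Y(4) that(1)] that(2) by simp
    moreover have "?Q0 \<subseteq> {strong_sn {x} {\<lambda>_ _. y} a b | a b x y. (a, b) \<in> rat_ivls \<and> x \<in> D' \<and> y \<in> D}"
      using Y(2) ab y by blast
    ultimately show ?thesis
      using Y(1,3) by (intro exI[of _ ?Q0] exI[of _ \<delta>]) simp
  qed
qed

lemma sigma_DD_agrees_sigma_D:
  fixes E :: "('m::finite, 'n::finite) cmap set set"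
  assumes U: "bounded U" "U \<noteq> {}" and D': "D' \<subseteq> U" "U \<subseteq> closure D'"
    and E: "E \<subseteq> LC U" "x_equicontinuous U E"
  shows "subtopology (sigma_DD U D' D) E = subtopology (sigma_D U D) E"
  unfolding sigma_D_eq sigma_DD_eq
proof (rule sym, rule seminorm_topologies_agree)
  have U': "closure U \<noteq> {}"
    using U by simp
  have D'U: "{x} \<subseteq> closure U" if "x \<in> D'" for x
    using D'(1) closure_subset that by auto
  have sn: "seminorm_on U (weak_sn X {\<lambda>_ _. y} a b)" if "X \<subseteq> closure U" "X \<noteq> {}"
    for X a b and y :: "real ^ 'n"
  proof -
    obtain j where "y \<in> l1cball j"
      using ex_l1cball by blast
    then show ?thesis
      using const_in_CB[OF U(2)] by (intro seminorm_on_weak_sn[OF _ _ that]) auto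
  qed
  show "E \<subseteq> SC U"
    using E by (auto simp: LC_def)
  show "seminorm_on U p"
    if mem: "p \<in> {weak_sn (closure U) {\<lambda>_ _. y} a b | a b y. (a, b) \<in> rat_ivls \<and> y \<in> D}" for p
    using mem sn[OF order_refl U'] by blast
  show "seminorm_on U q"
    if mem: "q \<in> {weak_sn {x} {\<lambda>_ _. y} a b | a b x y. (a, b) \<in> rat_ivls \<and> x \<in> D' \<and> y \<in> D}" for q
    using mem sn[OF D'U] by blast
  show "\<exists>p\<in>{weak_sn (closure U) {\<lambda>_ _. y} a b | a b y. (a, b) \<in> rat_ivls \<and> y \<in> D}. \<forall>d\<in>SC_maps U. q d \<le> p d"
    if mem: "q \<in> {weak_sn {x} {\<lambda>_ _. y} a b | a b x y. (a, b) \<in> rat_ivls \<and> x \<in> D' \<and> y \<in> D}" for q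
  proof -
    obtain a b x y where q: "q = weak_sn {x} {\<lambda>_ _. y} a b"
      and ab: "(a, b) \<in> rat_ivls" and x: "x \<in> D'" and y: "y \<in> D"
      using mem unfolding mem_Collect_eq by (elim exE conjE)
    obtain j where "y \<in> l1cball j"
      using ex_l1cball by blast
    then have "{\<lambda>_ _. y} \<subseteq> CB U j (a, b)"
      using const_in_CB[OF U(2)] by simp
    then have "weak_sn {x} {\<lambda>_ _. y} a b d \<le> weak_sn (closure U) {\<lambda>_ _. y} a b d" if "d \<in> SC_maps U" for d
      by (intro weak_sn_mono[OF that _ order_refl _ _ D'U[OF x] order_refl]) auto
    then show ?thesis
      unfolding q using ab y by blast
  qed
  show "\<exists>Q0 \<delta>. finite Q0 \<and>
      Q0 \<subseteq> {weak_sn {x} {\<lambda>_ _. y} a b | a b x y. (a, b) \<in> rat_ivls \<and> x \<in> D' \<and> y \<in> D} \<and>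
      0 < \<delta> \<and> (\<forall>G\<in>E. (\<forall>q\<in>Q0. q (cdiff (rep G) (rep F)) < \<delta>) \<longrightarrow> p (cdiff (rep G) (rep F)) < \<epsilon>)"
    if mem: "p \<in> {weak_sn (closure U) {\<lambda>_ _. y} a b | a b y. (a, b) \<in> rat_ivls \<and> y \<in> D}"
      and F: "F \<in> E" and \<epsilon>: "0 < \<epsilon>" for p F \<epsilon>
  proof -
    obtain a b y where p: "p = weak_sn (closure U) {\<lambda>_ _. y} a b"
      and ab: "(a, b) \<in> rat_ivls" and y: "y \<in> D"
      using mem unfolding mem_Collect_eq by (elim exE conjE)
    obtain Y \<delta> where Y: "finite Y" "Y \<subseteq> D'" "0 < \<delta>" "\<forall>G\<in>E.
      (\<forall>x\<in>Y. weak_sn {x} {\<lambda>_ _. y} a b (cdiff (rep G) (rep F)) < \<delta>) \<longrightarrow>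
      weak_sn (closure U) {\<lambda>_ _. y} a b (cdiff (rep G) (rep F)) < \<epsilon>"
      using weak_sn_x_control[OF U D' E F \<epsilon>, of y a b] by (elim exE conjE)
    let ?Q0 = "(\<lambda>x. weak_sn {x} {\<lambda>_ _. y} a b) ` Y"
    have "p (cdiff (rep G) (rep F)) < \<epsilon>" if "G \<in> E" "\<forall>q\<in>?Q0. q (cdiff (rep G) (rep F)) < \<delta>" for G
      unfolding p using bspec[OF Y(4) that(1)] that(2) by simp
    moreover have "?Q0 \<subseteq> {weak_sn {x} {\<lambda>_ _. y} a b | a b x y. (a, b) \<in> rat_ivls \<and> x \<in> D' \<and> y \<in> D}"
      using Y(2) ab y by blast
    ultimately show ?thesis
      using Y(1,3) by (intro exI[of _ ?Q0] exI[of _ \<delta>]) simp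
  qed
qed

text \<open>For \<open>U = {}\<close> the suprema over \<open>closure U\<close> are junk values, but all maps are then identified.\<close>

lemma seminorm_topology_empty_domain:
  "seminorm_topology {} P = (seminorm_topology {} Q :: ('m::finite, 'n::finite) cmap set topology)"
proof -
  have single: "F = G" if "F \<in> SC {}" "G \<in> SC {}" for F G :: "('m, 'n) cmap set"
    using that by (auto simp: SC_def quotient_def SC_rel_def)
  have "openin (seminorm_topology {} R) W \<longleftrightarrow> W = {} \<or> W = SC {}"
    for R :: "(('m, 'n) cmap \<Rightarrow> real) set" and W
  proof
    assume "openin (seminorm_topology {} R) W"
    then have "W \<subseteq> SC {}"
      using openin_subset[of "seminorm_topology {} R" W] by (simp add: topspace_seminorm_topology)
    then show "W = {} \<or> W = SC {}"
      using single by blast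
  next
    assume "W = {} \<or> W = SC {}"
    then show "openin (seminorm_topology {} R) W"
      using openin_topspace[of "seminorm_topology {} R"] by (auto simp: topspace_seminorm_topology)
  qed
  then show ?thesis
    by (simp add: topology_eq)
qed

text \<open>\<open>C\<close> is a condition on families that persists when one member of
  \<open>L\<close> is added. Agreement for all families satisfying \<open>C\<close> then gives the
  closures as well.\<close>

lemma agree_on_E_and_closure:
  assumes "E \<subseteq> L" "C E" "\<And>G. G \<in> L \<Longrightarrow> C (insert G E)"
    and "\<And>E'. E' \<subseteq> L \<Longrightarrow> C E' \<Longrightarrow> subtopology T1 E' = subtopology T2 E'"
  shows "subtopology T1 E = subtopology T2 E \<and> cls L T1 E = cls L T2 E"
proof
  show "subtopology T1 E = subtopology T2 E"
    using assms by blast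
  show "cls L T1 E = cls L T2 E"
    using assms by (intro agree_on_insert_imp_cls_eq) auto
qed

theorem theorem3p9:
  fixes U D' :: "(real ^ 'm::finite) set"
    and D :: "(real ^ 'n::finite) set"
    and \<Theta>1 :: "nat \<Rightarrow> real \<times> real \<Rightarrow> real \<Rightarrow> real"
    and \<Theta>2 :: "nat \<Rightarrow> real \<times> real \<Rightarrow> nat \<Rightarrow> real \<Rightarrow> real"
    and E :: "('m, 'n) cmap set set"
  assumes "bounded U" and "open U" and "connected U" and "C1_boundary U"
    and "D' \<subseteq> U" and "U \<subseteq> closure D'" and "countable D'"
    and "closure D = UNIV" and "countable D"
    and "suitable_moduli \<Theta>1 \<Theta>2"
    and "E \<subseteq> LC U"
  shows
    "(L1loc_bounded (l_bound U) E \<longrightarrow>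
        (\<forall>T1\<in>{T_D U D, T_Theta U \<Theta>1 \<Theta>2, T_B U}. \<forall>T2\<in>{T_D U D, T_Theta U \<Theta>1 \<Theta>2, T_B U}.
           subtopology T1 E = subtopology T2 E \<and> cls (LC U) T1 E = cls (LC U) T2 E)) \<and>
     (L1loc_equicontinuous (m_bound U) E \<and> L1loc_bounded (l_bound U) E \<longrightarrow>
        subtopology (sigma_D U D) E = subtopology (sigma_Theta U \<Theta>1 \<Theta>2) E \<and>
        cls (LC U) (sigma_D U D) E = cls (LC U) (sigma_Theta U \<Theta>1 \<Theta>2) E) \<and>
     (\<forall>\<theta>. modulus \<theta> \<and> L1loc_bounded (l_bound_wrt \<theta> U) E \<longrightarrow>
        subtopology (sigma_DD U D' D) E = subtopology (sigma_D U D) E \<and>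
        cls (LC U) (sigma_DD U D' D) E = cls (LC U) (sigma_D U D) E \<and>
        (\<forall>T\<in>{T_D U D, T_Theta U \<Theta>1 \<Theta>2, T_B U}.
           subtopology (T_DD U D' D) E = subtopology T E \<and>
           cls (LC U) (T_DD U D' D) E = cls (LC U) T E))"
proof (cases "U = {}")
  case True
  \<comment> \<open>The empty set is open, bounded and connected, and its boundary condition is
    vacuous, so it has to be covered.\<close>
  have "T_Theta U \<Theta>1 \<Theta>2 = T_D U D" "T_B U = T_D U D" "T_DD U D' D = T_D U D"
    "sigma_Theta U \<Theta>1 \<Theta>2 = sigma_D U D" "sigma_DD U D' D = sigma_D U D"
    unfolding True T_B_def T_D_def T_DD_def T_Theta_def sigma_D_def sigma_DD_def sigma_Theta_def
    by (rule seminorm_topology_empty_domain)+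
  then show ?thesis
    by simp
next
  case U: False
  note E = \<open>E \<subseteq> LC U\<close>
  let ?agree = "\<lambda>T1 T2. subtopology T1 E = subtopology T2 E \<and> cls (LC U) T1 E = cls (LC U) T2 E"
  \<comment> \<open>\<open>T_D\<close> is the common reference; any two strong topologies are
    compared through it.\<close>
  have strong: "?agree T (T_D U D)"
    if l: "l_bounded U E" and T: "T \<in> {T_D U D, T_Theta U \<Theta>1 \<Theta>2, T_B U}" for T
  proof (rule agree_on_E_and_closure[OF E, of "l_bounded U"])
    fix E' :: "('m, 'n) cmap set set" assume E': "E' \<subseteq> LC U" "l_bounded U E'"
    have "subtopology (T_Theta U \<Theta>1 \<Theta>2) E' = subtopology (T_D U D) E'"
      unfolding T_Theta_eq
      by (rule strong_topologies_agree[OF U assms(8,10) E']) (simp add: HH_subset_CB)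
    moreover have "subtopology (T_B U) E' = subtopology (T_D U D) E'"
      unfolding T_B_eq
      by (rule strong_topologies_agree[OF U assms(8,10) E']) (simp add: HH_subset_CB)
    ultimately show "subtopology T E' = subtopology (T_D U D) E'"
      using T by auto
  qed (use l l_bounded_insert in auto)
  have x_strong: "?agree (T_DD U D' D) (T_D U D)" if x: "x_equicontinuous U E"
    using x_equicontinuous_insert[OF assms(1) U x] T_DD_agrees_T_D[OF assms(1) U assms(5,6)]
    by (rule agree_on_E_and_closure[OF E, of "x_equicontinuous U", OF x])
  have x_weak: "?agree (sigma_DD U D' D) (sigma_D U D)" if x: "x_equicontinuous U E"
    using x_equicontinuous_insert[OF assms(1) U x] sigma_DD_agrees_sigma_D[OF assms(1) U assms(5,6)]
    by (rule agree_on_E_and_closure[OF E, of "x_equicontinuous U", OF x])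
  have ii: "?agree (sigma_D U D) (sigma_Theta U \<Theta>1 \<Theta>2)" if "m_equicontinuous U E" "l_bounded U E"
  proof (rule agree_on_E_and_closure[OF E, of "\<lambda>E. m_equicontinuous U E \<and> l_bounded U E"])
    fix E' :: "('m, 'n) cmap set set" assume "E' \<subseteq> LC U" "m_equicontinuous U E' \<and> l_bounded U E'"
    then show "subtopology (sigma_D U D) E' = subtopology (sigma_Theta U \<Theta>1 \<Theta>2) E'"
      by (intro sigma_D_agrees_sigma_Theta[OF U assms(8,10)]) auto
  qed (use that l_bounded_insert m_equicontinuous_insert in auto)
  have i: "?agree T1 T2"
    if "l_bounded U E" "T1 \<in> {T_D U D, T_Theta U \<Theta>1 \<Theta>2, T_B U}" "T2 \<in> {T_D U D, T_Theta U \<Theta>1 \<Theta>2, T_B U}"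
    for T1 T2
    using strong[OF that(1,2)] strong[OF that(1,3)] by simp
  \<comment> \<open>The bounds with respect to \<theta> are used twice: equal values give the
    oscillation estimate that leads from \<open>T_DD\<close> to \<open>T_D\<close>, equal space
    points give the \<open>l\<close>-bounds that lead from \<open>T_D\<close> to
    \<open>T\<close>.\<close>
  have iii_strong: "?agree (T_DD U D' D) T"
    if "modulus \<theta>" "L1loc_bounded (l_bound_wrt \<theta> U) E" "T \<in> {T_D U D, T_Theta U \<Theta>1 \<Theta>2, T_B U}" for \<theta> T
    using x_strong[OF x_equicontinuous_if_L1loc_bounded_wrt[OF that(1,2)]]
      strong[OF l_bounded_if_L1loc_bounded_wrt[OF that(1,2)] that(3)] by simp
  have iii_weak: "?agree (sigma_DD U D' D) (sigma_D U D)"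
    if "modulus \<theta>" "L1loc_bounded (l_bound_wrt \<theta> U) E" for \<theta>
    using x_weak[OF x_equicontinuous_if_L1loc_bounded_wrt[OF that]] .
  show ?thesis
  proof (intro conjI impI allI)
    show "\<forall>T1\<in>{T_D U D, T_Theta U \<Theta>1 \<Theta>2, T_B U}. \<forall>T2\<in>{T_D U D, T_Theta U \<Theta>1 \<Theta>2, T_B U}. ?agree T1 T2"
      if "L1loc_bounded (l_bound U) E"
      by (intro ballI i l_bounded_if_L1loc_bounded that)
    show "subtopology (sigma_D U D) E = subtopology (sigma_Theta U \<Theta>1 \<Theta>2) E"
      "cls (LC U) (sigma_D U D) E = cls (LC U) (sigma_Theta U \<Theta>1 \<Theta>2) E"
      if "L1loc_equicontinuous (m_bound U) E \<and> L1loc_bounded (l_bound U) E"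
      using ii that m_equicontinuous_if_L1loc_equicontinuous l_bounded_if_L1loc_bounded by auto
    fix \<theta> assume "modulus \<theta> \<and> L1loc_bounded (l_bound_wrt \<theta> U) E"
    then have \<theta>: "modulus \<theta>" "L1loc_bounded (l_bound_wrt \<theta> U) E"
      by auto
    show "subtopology (sigma_DD U D' D) E = subtopology (sigma_D U D) E"
      "cls (LC U) (sigma_DD U D' D) E = cls (LC U) (sigma_D U D) E"
      using iii_weak[OF \<theta>] by auto
    show "\<forall>T\<in>{T_D U D, T_Theta U \<Theta>1 \<Theta>2, T_B U}. ?agree (T_DD U D' D) T"
      using iii_strong[OF \<theta>] by (intro ballI)
  qed
qed

end
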